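(* Let $\mu$ be a nonzero finite even Borel measure on $S^{n-1}$ vanishing on great subspheres. Let $G:(0,\infty)\times S^{n-1}\to(0,\infty)$ and $G_t=\partial G/\partial t$ be continuous on $(0,\infty)\times S^{n-1}$, where $G_t<0$ and where $G_t(t,u)=G_t(t,-u)$ for $(t,u)\in(0,\infty)\times S^{n-1}$. Suppose that there is some $0<\varepsilon_0<1$ such that for every $v\in S^{n-1}$, $$\lim_{t\to0+}\int_{\Sigma_{\varepsilon_0}(v)}G(t,u)\,du=\infty,$$ where $\Sigma_{\varepsilon_0}(v)=\{u\in S^{n-1}:\langle u,v\rangle\ge\varepsilon_0\}$. Let $\psi:(0,\infty)\to(0,\infty)$ be continuous and suppose that $\overline{\varphi}(t)=\int_t^\infty\frac{\psi(s)}{s}\,ds$ is finite for all $t>0$. Then there exists a $K\in\mathcal{K}_{(o)s}^n$ such that $$\frac{\mu}{\mu(S^{n-1})}=\frac{\widetilde{C}_{G,\psi}(K,\cdot)}{\widetilde{C}_{G,\psi}(K,S^{n-1})}.$$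
   Context: Let $n\ge2$, let $o$ be the origin of $\mathbb{R}^n$ and $S^{n-1}$ the unit sphere; $du$ denotes integration with respect to $(n-1)$-dimensional Hausdorff measure $\mathcal{H}^{n-1}$. $\mathcal{K}_{(o)}^n$ is the class of compact convex subsets of $\mathbb{R}^n$ containing $o$ in their interiors, and $\mathcal{K}_{(o)s}^n$ the class of those $K\in\mathcal{K}_{(o)}^n$ with $K=-K$ (origin symmetric). A Borel measure $\mu$ on $S^{n-1}$ is even if $\mu(E)=\mu(-E)$ for all Borel $E$. A great subsphere is a set $S^{n-1}\cap v^\perp$ with $v\in S^{n-1}$, where $v^\perp$ is the hyperplane through $o$ orthogonal to $v$. For $K\in\mathcal{K}_{(o)}^n$ and $u\in S^{n-1}$, $h_K(u)=\max\{\langle u,x\rangle:x\in K\}$ and $\rho_K(u)=\max\{\lambda\ge0:\lambda u\in K\}$. For $K\in\mathcal{K}_{(o)}^n$ and a Borel set $E\subset S^{n-1}$, let $\boldsymbol{\alpha}_K^*(E)$ be the set of $u\in S^{n-1}$ such that some $v\in E$ is an outer unit normal vector of $K$ at the boundary point $\rho_K(u)u$, i.e. $\langle v,\rho_K(u)u\rangle=h_K(v)$. For $\mathcal{H}^{n-1}$-almost all $u\in S^{n-1}$ there is exactly one outer unit normal vector of $K$ at $\rho_K(u)u$, denoted by $\alpha_K(u)$. The general dual Orlicz curvature measure is the finite signed Borel measure $$\widetilde{C}_{G,\psi}(K,E)=\frac1n\int_{\boldsymbol{\alpha}_K^*(E)}\frac{\rho_K(u)\,G_t(\rho_K(u),u)}{\psi(h_K(\alpha_K(u)))}\,du,\qquad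 E\subset S^{n-1}\text{ Borel}.$$ *)

theory Defs
  imports "HOL-Analysis.Analysis"
begin

text \<open>
  Hausdorff measure of integer dimension, obtained by the Caratheodory construction. A countable
  cover may contain empty sets, which contribute nothing; they are singled out since
  \<open>diameter {} ^ 0 = 1\<close>. Boundedness is required because \<open>diameter\<close> is unspecified on
  unbounded sets. With the constant \<open>unit_ball_vol k / 2 ^ k\<close>, the \<open>k\<close>-dimensional measure
  agrees with Lebesgue measure on \<open>k\<close>-dimensional Euclidean space.
\<close>

definition hausdorff_premeasure :: "nat \<Rightarrow> real \<Rightarrow> 'a::metric_space set \<Rightarrow> ennreal" where
  "hausdorff_premeasure k \<delta> A =
     (INF U \<in> {U :: nat \<Rightarrow> 'a set. A \<subseteq> (\<Union>i. U i) \<and> (\<forall>i. bounded (U i) \<and> diameter (U i) \<le> \<delta>)}.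
        \<Sum>i. if U i = {} then 0
            else ennreal (unit_ball_vol (real k) * (diameter (U i) / 2) ^ k))"

definition hausdorff_outer :: "nat \<Rightarrow> 'a::metric_space set \<Rightarrow> ennreal" where
  "hausdorff_outer k A = (SUP \<delta> \<in> {0<..}. hausdorff_premeasure k \<delta> A)"

text \<open>
  The sigma-algebra consists of all Caratheodory-measurable sets, so the measure is complete.
  This matters below: reverse radial Gauss images of Borel sets need not be Borel.
\<close>

definition hausdorff_measure :: "nat \<Rightarrow> 'a::metric_space measure" where
  "hausdorff_measure k =
     measure_of UNIV (lambda_system UNIV UNIV (hausdorff_outer k)) (hausdorff_outer k)"

definition sphere_measure :: "'a::euclidean_space measure" where
  "sphere_measure = restrict_space (hausdorff_measure (DIM('a) - 1)) (sphere 0 1)"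

definition convex_bodies_o :: "'a::euclidean_space set set" where
  "convex_bodies_o = {K. compact K \<and> convex K \<and> 0 \<in> interior K}"

definition convex_bodies_os :: "'a::euclidean_space set set" where
  "convex_bodies_os = {K \<in> convex_bodies_o. uminus ` K = K}"

definition support_fun :: "'a::euclidean_space set \<Rightarrow> 'a \<Rightarrow> real" where
  "support_fun K u = (SUP x\<in>K. u \<bullet> x)"

definition radial_fun :: "'a::euclidean_space set \<Rightarrow> 'a \<Rightarrow> real" where
  "radial_fun K u = Sup {r. 0 \<le> r \<and> r *\<^sub>R u \<in> K}"

text \<open>\<open>v\<close> is an outer unit normal vector of \<open>K\<close> at the boundary point in direction \<open>u\<close>.\<close>

definition outer_normal_at :: "'a::euclidean_space set \<Rightarrow> 'a \<Rightarrow> 'a \<Rightarrow> bool" where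
  "outer_normal_at K u v \<longleftrightarrow>
     v \<in> sphere 0 1 \<and> v \<bullet> (radial_fun K u *\<^sub>R u) = support_fun K v"

text \<open>The reverse radial Gauss image \<open>\<alpha>\<^sup>*\<^sub>K(E)\<close>.\<close>

definition reverse_radial_gauss_image :: "'a::euclidean_space set \<Rightarrow> 'a set \<Rightarrow> 'a set" where
  "reverse_radial_gauss_image K E = {u \<in> sphere 0 1. \<exists>v\<in>E. outer_normal_at K u v}"

text \<open>
  The radial Gauss map \<open>\<alpha>\<^sub>K\<close>. It is meaningful for almost every \<open>u\<close> on the sphere, namely where
  the outer unit normal is unique.
\<close>

definition radial_gauss_map :: "'a::euclidean_space set \<Rightarrow> 'a \<Rightarrow> 'a" where
  "radial_gauss_map K u = (THE v. outer_normal_at K u v)"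

definition partial_t :: "(real \<Rightarrow> 'a \<Rightarrow> real) \<Rightarrow> real \<Rightarrow> 'a \<Rightarrow> real" where
  "partial_t G t u = deriv (\<lambda>s. G s u) t"

text \<open>The general dual Orlicz curvature measure, a finite signed measure on Borel \<open>E\<close>.\<close>

definition dual_orlicz_curvature ::
    "(real \<Rightarrow> 'a::euclidean_space \<Rightarrow> real) \<Rightarrow> (real \<Rightarrow> real) \<Rightarrow> 'a set \<Rightarrow> 'a set \<Rightarrow> real" where
  "dual_orlicz_curvature G \<psi> K E =
     1 / real DIM('a) *
     (LINT u : reverse_radial_gauss_image K E | sphere_measure.
        radial_fun K u * partial_t G (radial_fun K u) u
          / \<psi> (support_fun K (radial_gauss_map K u)))"

end

theory Submission
  imports Defs "HOL-Complex_Analysis.Great_Picard"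
begin

text \<open>
  The body is a maximizer. Put \<open>\<phi>(t) = \<integral>\<^bsub>t\<^esub>\<^bsup>\<infinity>\<^esup> \<psi>(s)/s ds\<close> and, for a symmetric body \<open>K\<close>,
  \<open>\<Phi>(K) = \<integral> \<phi>(h\<^sub>K) d\<mu>\<close> and \<open>V(K) = \<integral> G(\<rho>\<^sub>K(u), u) du\<close>. Let \<open>K\<close> maximize \<open>\<Phi>\<close> under the
  constraint that \<open>V(K)\<close> does not exceed its value at the unit ball. If \<open>h = h\<^sub>K\<close> is deformed to
  \<open>h exp(t f)\<close> with \<open>f\<close> even, then \<open>\<Phi>\<close> changes at the rate \<open>- \<integral> \<psi>(h) f d\<mu>\<close>, while \<open>V\<close> changes at the
  rate \<open>\<integral> \<rho>\<^sub>K G\<^sub>t(\<rho>\<^sub>K, u) f(\<alpha>\<^sub>K(u)) du\<close>, because \<open>\<rho>\<^sub>K(u)\<close> is a minimum over \<open>v\<close> whose only minimizer is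
  \<open>\<alpha>\<^sub>K(u)\<close>. A deformation that lowers \<open>V\<close> must not raise \<open>\<Phi>\<close>, so the two linear functionals of \<open>f\<close>
  are proportional (\<open>euler_lagrange\<close>). With \<open>f = g / \<psi>(h)\<close> this says that \<open>\<mu>\<close> and the curvature measure
  of \<open>K\<close> integrate every even \<open>g\<close>, and by symmetry every continuous \<open>g\<close>, to the same number up to a
  constant factor (\<open>mu_as_push_forward\<close>).

  Bodies are handled through positive continuous functions on the sphere. Such an \<open>h\<close> has a Wulff
  shape \<open>{x. \<forall>v. v \<bullet> x \<le> h v}\<close>, whose gauge \<open>max\<^sub>v (v \<bullet> x) / h v\<close> is the reciprocal of the radial
  function. Replacing \<open>h\<close> by the support function of its Wulff shape keeps the gauge, hence \<open>V\<close>, and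
  can only raise \<open>\<Phi>\<close>. This makes deformations of \<open>h\<close> legitimate competitors although they leave the
  class of support functions.

  A maximizer exists because competitors cannot degenerate. A body that is thin in some direction
  \<open>v\<close> has small radial function on a cap around \<open>v\<close>, so the blow-up of the cap integrals of \<open>G\<close>
  makes \<open>V\<close> large (\<open>inradius_bound\<close>). A body that contains a long segment in direction \<open>w\<close> has large
  support function off the great subsphere orthogonal to \<open>w\<close>, which \<open>\<mu>\<close> does not charge, so \<open>\<Phi>\<close> is small
  (\<open>circumradius_bound\<close>). Between these bounds the support functions are uniformly Lipschitz, and
  the theorem of Arzela and Ascoli applies (\<open>maximizer_exists\<close>).

  The geometric measure theory concerns two facts. Borel sets of the sphere are measurable, since
  Hausdorff measure is a metric outer measure (\<open>metric_outer_measure_closed\<close>). And for almost every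
  \<open>u\<close> the normal at \<open>\<rho>\<^sub>K(u) u\<close> is unique (\<open>null_not_unique_touching\<close>): otherwise the gauge has a kink in some
  coordinate direction, a convex function has only countably many kinks on a line, so the bad
  directions span a Lebesgue null cone, and a Lebesgue null cone meets the sphere in a Hausdorff
  null set (\<open>hausdorff_null_of_negligible_cone\<close>).
\<close>

section \<open>Hausdorff measure as a metric outer measure\<close>

definition hausdorff_weight :: "nat \<Rightarrow> 'a::metric_space set \<Rightarrow> ennreal" where
  "hausdorff_weight k U =
     (if U = {} then 0 else ennreal (unit_ball_vol (real k) * (diameter U / 2) ^ k))"

lemma hausdorff_premeasure_le:
  assumes "A \<subseteq> (\<Union>i. U i)" "\<And>i. bounded (U i)" "\<And>i. diameter (U i) \<le> \<delta>"
  shows "hausdorff_premeasure k \<delta> A \<le> (\<Sum>i. hausdorff_weight k (U i))"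
  unfolding hausdorff_premeasure_def hausdorff_weight_def
  by (rule INF_lower) (use assms in auto)

lemma hausdorff_premeasure_lessE:
  assumes "hausdorff_premeasure k \<delta> A < c"
  obtains U where "A \<subseteq> (\<Union>i::nat. U i)" "\<And>i. bounded (U i)" "\<And>i. diameter (U i) \<le> \<delta>"
    "(\<Sum>i. hausdorff_weight k (U i)) < c"
  using assms unfolding hausdorff_premeasure_def INF_less_iff hausdorff_weight_def[symmetric]
  by auto

lemma hausdorff_premeasure_greatest:
  assumes "\<And>U :: nat \<Rightarrow> _. A \<subseteq> (\<Union>i. U i) \<Longrightarrow> (\<And>i. bounded (U i)) \<Longrightarrow> (\<And>i. diameter (U i) \<le> \<delta>)
    \<Longrightarrow> c \<le> (\<Sum>i. hausdorff_weight k (U i))"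
  shows "c \<le> hausdorff_premeasure k \<delta> A"
  unfolding hausdorff_premeasure_def hausdorff_weight_def[symmetric]
  by (rule INF_greatest) (use assms in auto)

lemma hausdorff_premeasure_empty: "0 \<le> \<delta> \<Longrightarrow> hausdorff_premeasure k \<delta> {} = 0"
  using hausdorff_premeasure_le[of "{}" "\<lambda>_. {}" \<delta> k] by (simp add: hausdorff_weight_def)

lemma hausdorff_premeasure_mono:
  "A \<subseteq> B \<Longrightarrow> hausdorff_premeasure k \<delta> A \<le> hausdorff_premeasure k \<delta> B"
  by (rule hausdorff_premeasure_greatest, rule hausdorff_premeasure_le) auto

lemma hausdorff_premeasure_antimono:
  "\<delta> \<le> \<delta>' \<Longrightarrow> hausdorff_premeasure k \<delta>' A \<le> hausdorff_premeasure k \<delta> A"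
  by (rule hausdorff_premeasure_greatest) (rule hausdorff_premeasure_le, auto intro: order_trans)

lemma hausdorff_premeasure_UN:
  "hausdorff_premeasure k \<delta> (\<Union>i::nat. A i) \<le> (\<Sum>i. hausdorff_premeasure k \<delta> (A i))"
proof (rule ennreal_le_epsilon)
  let ?O = "hausdorff_premeasure k \<delta>"
  fix e :: real assume "0 < e" "(\<Sum>n. ?O (A n)) < top"
  then have *: "\<And>n. ?O (A n) < ?O (A n) + e * (1/2)^Suc n"
    by (auto simp add: less_top dest!: ennreal_suminf_lessD)
  have "\<exists>U. A n \<subseteq> (\<Union>i::nat. U i) \<and> (\<forall>i. bounded (U i)) \<and> (\<forall>i. diameter (U i) \<le> \<delta>)
      \<and> (\<Sum>i. hausdorff_weight k (U i)) \<le> ?O (A n) + e * (1/2)^Suc n" for n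
    using hausdorff_premeasure_lessE[OF *[of n]] by (metis less_imp_le)
  then obtain B where sbB: "\<And>n. A n \<subseteq> (\<Union>i::nat. B n i)" and bB: "\<And>n i. bounded (B n i)"
      and dB: "\<And>n i. diameter (B n i) \<le> \<delta>"
      and Ble: "\<And>n. (\<Sum>i. hausdorff_weight k (B n i)) \<le> ?O (A n) + e * (1/2)^(Suc n)"
    by metis
  define C where "C = case_prod B o prod_decode"
  have A_C: "(\<Union>i. A i) \<subseteq> (\<Union>i. C i)"
    using sbB by (auto simp add: C_def subset_eq) (metis prod.case prod_encode_inverse)
  have "?O (\<Union>i. A i) \<le> (\<Sum>i. hausdorff_weight k (C i))"
    using A_C bB dB by (intro hausdorff_premeasure_le) (auto simp: C_def split_def)
  also have "\<dots> = (\<Sum>n. \<Sum>i. hausdorff_weight k (B n i))"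
    unfolding C_def comp_def
    by (subst suminf_ennreal_2dimen[symmetric, where f = "\<lambda>(m, n). hausdorff_weight k (B m n)"])
       (auto simp: split_def)
  also have "\<dots> \<le> (\<Sum>n. ?O (A n) + e * (1/2) ^ Suc n)"
    by (intro suminf_le allI Ble) auto
  also have "... = (\<Sum>n. ?O (A n)) + (\<Sum>n. ennreal e * ennreal ((1/2) ^ Suc n))"
    using \<open>0 < e\<close> by (subst suminf_add[symmetric])
                     (auto simp del: ennreal_suminf_cmult simp add: ennreal_mult[symmetric])
  also have "\<dots> = (\<Sum>n. ?O (A n)) + e"
    unfolding ennreal_suminf_cmult
    by (subst suminf_ennreal_eq[OF zero_le_power power_half_series]) auto
  finally show "?O (\<Union>i. A i) \<le> (\<Sum>n. ?O (A n)) + e" .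
qed

lemma hausdorff_outer_upper: "0 < \<delta> \<Longrightarrow> hausdorff_premeasure k \<delta> A \<le> hausdorff_outer k A"
  unfolding hausdorff_outer_def by (rule SUP_upper) auto

lemma hausdorff_outer_mono: "A \<subseteq> B \<Longrightarrow> hausdorff_outer k A \<le> hausdorff_outer k B"
  unfolding hausdorff_outer_def by (rule SUP_mono) (auto intro: hausdorff_premeasure_mono)

lemma outer_measure_space_hausdorff:
  "outer_measure_space UNIV (hausdorff_outer k :: 'a::metric_space set \<Rightarrow> ennreal)"
  unfolding outer_measure_space_def
proof (intro conjI)
  show "positive UNIV (hausdorff_outer k :: 'a set \<Rightarrow> ennreal)"
    by (simp add: positive_def hausdorff_outer_def hausdorff_premeasure_empty)
  show "increasing UNIV (hausdorff_outer k :: 'a set \<Rightarrow> ennreal)"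
    by (simp add: increasing_def hausdorff_outer_mono)
  show "countably_subadditive UNIV (hausdorff_outer k :: 'a set \<Rightarrow> ennreal)"
    unfolding countably_subadditive_def
  proof (intro allI impI)
    fix A :: "nat \<Rightarrow> 'a set"
    show "hausdorff_outer k (\<Union>i. A i) \<le> (\<Sum>i. hausdorff_outer k (A i))"
      unfolding hausdorff_outer_def[of k "\<Union>i. A i"]
    proof (rule SUP_least)
      fix \<delta> :: real assume "\<delta> \<in> {0<..}"
      then show "hausdorff_premeasure k \<delta> (\<Union>i. A i) \<le> (\<Sum>i. hausdorff_outer k (A i))"
        by (intro order_trans[OF hausdorff_premeasure_UN] suminf_le allI hausdorff_outer_upper) auto
    qed
  qed
qed

text \<open>
  A covering set of diameter less than \<open>e\<close> cannot meet both \<open>A\<close> and \<open>B\<close>, so a fine cover of the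
  union splits into a cover of \<open>A\<close> and one of \<open>B\<close>.
\<close>

lemma hausdorff_outer_separated:
  assumes "0 < e" and sep: "\<And>x y. x \<in> A \<Longrightarrow> y \<in> B \<Longrightarrow> e \<le> dist x y"
  shows "hausdorff_outer k A + hausdorff_outer k B \<le> hausdorff_outer k (A \<union> B)"
proof -
  have *: "hausdorff_premeasure k \<delta> A + hausdorff_premeasure k \<delta> B \<le> hausdorff_premeasure k \<delta> (A \<union> B)"
    if \<delta>: "0 < \<delta>" "\<delta> < e" for \<delta>
  proof (rule hausdorff_premeasure_greatest)
    fix U :: "nat \<Rightarrow> _" assume U: "A \<union> B \<subseteq> (\<Union>i. U i)" "\<And>i. bounded (U i)" "\<And>i. diameter (U i) \<le> \<delta>"
    define V where "V i = (if U i \<inter> A = {} then {} else U i)" for i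
    define W where "W i = (if U i \<inter> B = {} then {} else U i)" for i
    have "A \<subseteq> (\<Union>i. V i)" "B \<subseteq> (\<Union>i. W i)"
      using U(1) by (fastforce simp: V_def W_def)+
    have "hausdorff_premeasure k \<delta> A \<le> (\<Sum>i. hausdorff_weight k (V i))"
      using \<open>A \<subseteq> (\<Union>i. V i)\<close> U \<delta> by (intro hausdorff_premeasure_le) (auto simp: V_def split: if_splits)
    moreover have "hausdorff_premeasure k \<delta> B \<le> (\<Sum>i. hausdorff_weight k (W i))"
      using \<open>B \<subseteq> (\<Union>i. W i)\<close> U \<delta> by (intro hausdorff_premeasure_le) (auto simp: W_def split: if_splits)
    moreover have "hausdorff_weight k (V i) + hausdorff_weight k (W i) \<le> hausdorff_weight k (U i)" for i
    proof -
      have "U i \<inter> A = {} \<or> U i \<inter> B = {}"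
      proof (rule ccontr)
        assume "\<not> ?thesis"
        then obtain x y where "x \<in> U i" "x \<in> A" "y \<in> U i" "y \<in> B" by auto
        then show False
          using diameter_bounded_bound[of "U i" x y] U(2,3)[of i] sep[of x y] \<delta> by auto
      qed
      then show ?thesis by (auto simp: V_def W_def hausdorff_weight_def)
    qed
    ultimately have "hausdorff_premeasure k \<delta> A + hausdorff_premeasure k \<delta> B
        \<le> (\<Sum>i. hausdorff_weight k (V i)) + (\<Sum>i. hausdorff_weight k (W i))"
      by (intro add_mono)
    also have "\<dots> = (\<Sum>i. hausdorff_weight k (V i) + hausdorff_weight k (W i))"
      by (intro suminf_add summableI)
    also have "\<dots> \<le> (\<Sum>i. hausdorff_weight k (U i))"
      by (intro suminf_le summableI) fact
    finally show "hausdorff_premeasure k \<delta> A + hausdorff_premeasure k \<delta> B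
        \<le> (\<Sum>i. hausdorff_weight k (U i))" .
  qed
  have dir: "\<exists>d\<in>{0<..}. hausdorff_premeasure k \<delta> A + hausdorff_premeasure k \<delta>' B
      \<le> hausdorff_premeasure k d A + hausdorff_premeasure k d B \<and> d < e"
    if "\<delta> \<in> {0<..}" "\<delta>' \<in> {0<..}" for \<delta> \<delta>'
  \<comment> \<open>\<open>e/2\<close> keeps the common mesh strictly below \<open>e\<close>.\<close>
  proof (intro bexI[of _ "min (e/2) (min \<delta> \<delta>')"] conjI)
    show "hausdorff_premeasure k \<delta> A + hausdorff_premeasure k \<delta>' B
      \<le> hausdorff_premeasure k (min (e/2) (min \<delta> \<delta>')) A + hausdorff_premeasure k (min (e/2) (min \<delta> \<delta>')) B"
      by (intro add_mono hausdorff_premeasure_antimono) auto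
  qed (use that \<open>0 < e\<close> in auto)
  have "hausdorff_outer k A + hausdorff_outer k B
      = (SUP \<delta>\<in>{0<..}. hausdorff_premeasure k \<delta> A + hausdorff_premeasure k \<delta> B)"
    unfolding hausdorff_outer_def using dir by (intro SUP_add_directed_ennreal[symmetric]) blast
  also have "\<dots> \<le> hausdorff_outer k (A \<union> B)"
  proof (rule SUP_least)
    fix \<delta> :: real assume "\<delta> \<in> {0<..}"
    then obtain d where "0 < d" "d < e" "hausdorff_premeasure k \<delta> A + hausdorff_premeasure k \<delta> B
      \<le> hausdorff_premeasure k d A + hausdorff_premeasure k d B" using dir[of \<delta> \<delta>] by auto
    then show "hausdorff_premeasure k \<delta> A + hausdorff_premeasure k \<delta> B \<le> hausdorff_outer k (A \<union> B)"
      using *[of d] hausdorff_outer_upper[of d k "A \<union> B"] by (meson order_trans)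
  qed
  finally show ?thesis .
qed

lemma sigma_algebra_UNIV: "sigma_algebra UNIV UNIV"
  using sigma_algebra_Pow[of UNIV] by simp

lemma in_lambda_system_UNIV:
  "A \<in> lambda_system UNIV UNIV f \<longleftrightarrow> (\<forall>X. f (X \<inter> A) + f (X - A) = f X)"
  by (subst algebra.lambda_system_eq[OF sigma_algebra.axioms(1)[OF sigma_algebra_UNIV]]) simp

lemma outer_measure_space_Un:
  assumes "outer_measure_space UNIV f"
  shows "f (A \<union> B) \<le> f A + f B"
proof -
  have "subadditive UNIV f"
    using ring_of_sets.countably_subadditive_subadditive[OF
        algebra.axioms(1)[OF sigma_algebra.axioms(1)[OF sigma_algebra_UNIV]]] assms
    unfolding outer_measure_space_def by blast
  then have "f (A \<union> (B - A)) \<le> f A + f (B - A)"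
    unfolding subadditive_def by blast
  also have "\<dots> \<le> f A + f B"
    using assms by (intro add_mono) (auto simp: outer_measure_space_def increasing_def)
  finally show ?thesis by simp
qed

text \<open>
  Caratheodory's criterion. The part of \<open>X\<close> at distance at least \<open>q n\<close> from \<open>F\<close> is separated
  from \<open>X \<inter> F\<close>. What remains of \<open>X - F\<close> is a union of rings \<open>R i\<close>, and the sum of their measures
  converges: rings whose indices have the same parity are separated from each other, so each of
  the two parity classes contributes at most \<open>f X\<close>.
\<close>

lemma metric_outer_measure_closed:
  fixes f :: "'a::metric_space set \<Rightarrow> ennreal"
  assumes oms: "outer_measure_space UNIV f"
    and sep: "\<And>A B e. 0 < e \<Longrightarrow> (\<And>x y. x \<in> A \<Longrightarrow> y \<in> B \<Longrightarrow> e \<le> dist x y) \<Longrightarrow> f A + f B \<le> f (A \<union> B)"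
    and "closed F"
  shows "F \<in> lambda_system UNIV UNIV f"
proof -
  have pos: "f {} = 0" and mono: "\<And>A B. A \<subseteq> B \<Longrightarrow> f A \<le> f B"
    and csub: "countably_subadditive UNIV f"
    using oms by (auto simp: outer_measure_space_def positive_def increasing_def)
  note sub = outer_measure_space_Un[OF oms]
  have subUN: "f (\<Union>i. A i) \<le> (\<Sum>i. f (A i))" for A :: "nat \<Rightarrow> 'a set"
  proof -
    have "(\<Union>i. A i) = (\<Union>i. disjointed A i)" by (simp add: UN_disjointed_eq)
    also have "f \<dots> \<le> (\<Sum>i. f (disjointed A i))"
      using csub disjoint_family_disjointed[of A] by (auto simp: countably_subadditive_def)
    also have "\<dots> \<le> (\<Sum>i. f (A i))"
      by (intro suminf_le summableI mono disjointed_subset)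
    finally show ?thesis .
  qed
  have main: "f (X \<inter> F) + f (X - F) \<le> f X" for X
  proof (cases "f X = top \<or> F = {}")
    case True
    then show ?thesis by (auto simp: pos)
  next
    case False
    then have fin: "f X < top" and ne: "F \<noteq> {}" by (auto simp: less_top)
    define q where "q n = 1 / real (Suc n)" for n
    define B where "B n = {x \<in> X. q n \<le> infdist x F}" for n
    define R where "R n = {x \<in> X. q (Suc n) \<le> infdist x F \<and> infdist x F \<le> q n}" for n
    have q: "0 < q n" "q (Suc n) < q n" for n by (auto simp: q_def field_simps)
    have gap: "\<epsilon> \<le> dist x y" if "infdist x F \<ge> s + \<epsilon>" "infdist y F \<le> s" for x y s \<epsilon>
      using infdist_triangle[of x F y] that by simp
    \<comment> \<open>The ring of \<open>x\<close> is found from the first \<open>m'\<close> with \<open>q m' < infdist x F\<close>.\<close>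
    have RB: "X - F \<subseteq> B n \<union> (\<Union>i. R (i + n))" for n
    proof
      fix x assume x: "x \<in> X - F"
      then have p: "0 < infdist x F"
        using \<open>closed F\<close> ne in_closed_iff_infdist_zero[of F x] infdist_nonneg[of x F] by fastforce
      show "x \<in> B n \<union> (\<Union>i. R (i + n))"
      proof (cases "q n \<le> infdist x F")
        case True then show ?thesis using x by (auto simp: B_def)
      next
        case False
        obtain m where m: "q m < infdist x F"
          using reals_Archimedean[OF p] by (auto simp: q_def inverse_eq_divide)
        define m' where "m' = (LEAST m. q m < infdist x F)"
        have m1: "q m' < infdist x F" unfolding m'_def by (rule LeastI[of _ m]) (rule m)
        have m2: "infdist x F \<le> q k" if "k < m'" for k
          using not_less_Least[of k "\<lambda>m. q m < infdist x F"] that m'_def by auto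
        have "\<not> m' \<le> n"
        proof
          assume "m' \<le> n"
          then have "q n \<le> q m'" by (auto simp: q_def field_simps)
          then show False using m1 False by simp
        qed
        then obtain j where j: "m' = Suc j" "n \<le> j" by (cases m') auto
        then have "x \<in> R ((j - n) + n)"
          using m1 m2[of j] x by (auto simp: R_def)
        then show ?thesis by blast
      qed
    qed
    \<comment> \<open>\<open>c\<close> is the parity. Between rings \<open>2 * i + c\<close> with \<open>i < N\<close> and ring \<open>2 * N + c\<close> lies
      the ring \<open>2 * N + c - 1\<close>, whose width is the separation.\<close>
    have alt: "(\<Sum>i<N. f (R (2 * i + c))) \<le> f (\<Union>i<N. R (2 * i + c))" for N c
    proof (induction N)
      case (Suc N)
      have "f (\<Union>i<N. R (2 * i + c)) + f (R (2 * N + c)) \<le> f ((\<Union>i<N. R (2 * i + c)) \<union> R (2 * N + c))"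
      proof (cases "N = 0")
        case False
        show ?thesis
        proof (rule sep[of "q (2 * N + c - 1) - q (2 * N + c)"])
          show "0 < q (2 * N + c - 1) - q (2 * N + c)"
            using q(2)[of "2 * N + c - 1"] False by simp
          fix x y assume x: "x \<in> (\<Union>i<N. R (2 * i + c))" and y: "y \<in> R (2 * N + c)"
          from x obtain i where i: "i < N" "q (Suc (2 * i + c)) \<le> infdist x F" by (auto simp: R_def)
          have "q (2 * N + c - 1) \<le> q (Suc (2 * i + c))"
            using i(1) by (auto simp: q_def field_simps)
          then show "q (2 * N + c - 1) - q (2 * N + c) \<le> dist x y"
            using i y by (intro gap[of "q (2 * N + c)"]) (auto simp: R_def)
        qed
      qed (simp add: pos)
      also have "(\<Union>i<N. R (2 * i + c)) \<union> R (2 * N + c) = (\<Union>i<Suc N. R (2 * i + c))"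
        by (auto simp: lessThan_Suc)
      finally show ?case
        unfolding sum.lessThan_Suc by (rule order_trans[OF add_right_mono[OF Suc.IH]])
    qed (simp add: pos)
    have alt2: "(\<Sum>i<N. f (R (2 * i + c))) \<le> f X" for N c
      by (rule order_trans[OF alt mono]) (auto simp: R_def)
    have part: "(\<Sum>i<N. f (R i)) \<le> f X + f X" for N
    proof -
      have "(\<Sum>i<N. f (R i)) \<le> (\<Sum>i<2*N. f (R i))" by (intro sum_mono2) auto
      also have "\<dots> = (\<Sum>i<N. f (R (2 * i + 0))) + (\<Sum>i<N. f (R (2 * i + 1)))"
        by (induction N) (auto simp: ac_simps)
      also have "\<dots> \<le> f X + f X" by (intro add_mono alt2)
      finally show ?thesis .
    qed
    have finR: "(\<Sum>i. f (R i)) < top"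
    proof -
      have "(\<Sum>i. f (R i)) \<le> f X + f X"
        by (subst suminf_eq_SUP) (auto intro!: SUP_least part)
      also have "\<dots> < top" using fin by simp
      finally show ?thesis .
    qed
    have fR: "f (R i) < top" for i
      by (rule le_less_trans[OF mono[of "R i" X] fin]) (auto simp: R_def)
    define r where "r i = enn2real (f (R i))" for i
    have r: "f (R i) = ennreal (r i)" "0 \<le> r i" for i
      using fR[of i] by (auto simp: r_def)
    have sr: "summable r"
      by (rule summable_suminf_not_top) (use finR r in auto)
    show ?thesis
    proof (rule ennreal_le_epsilon)
      fix e :: real assume "0 < e"
      obtain n where n: "norm (\<Sum>i. r (i + n)) < e"
        using suminf_exist_split[OF \<open>0 < e\<close> sr] by blast
      have s: "(\<Sum>i. f (R (i + n))) \<le> e"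
      proof -
        have "(\<Sum>i. f (R (i + n))) = ennreal (\<Sum>i. r (i + n))"
          unfolding r(1) by (rule suminf_ennreal2) (use r sr in auto)
        also have "\<dots> \<le> e" using n by (intro ennreal_leI) auto
        finally show ?thesis .
      qed
      have "f (X \<inter> F) + f (X - F) \<le> f (X \<inter> F) + (f (B n) + (\<Sum>i. f (R (i + n))))"
        by (intro add_left_mono order_trans[OF mono[OF RB[of n]]] order_trans[OF sub] add_left_mono subUN)
      also have "\<dots> = (f (B n) + f (X \<inter> F)) + (\<Sum>i. f (R (i + n)))"
        by (simp add: ac_simps)
      also have "f (B n) + f (X \<inter> F) \<le> f (B n \<union> X \<inter> F)"
      proof (rule sep[of "q n"])
        fix x y assume "x \<in> B n" "y \<in> X \<inter> F"
        then show "q n \<le> dist x y" by (intro gap[of 0]) (auto simp: B_def)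
      qed (rule q)
      also have "f (B n \<union> X \<inter> F) \<le> f X" by (rule mono) (auto simp: B_def)
      also note s
      finally show "f (X \<inter> F) + f (X - F) \<le> f X + ennreal e"
        by (simp add: add_mono)
    qed
  qed
  have "f (X \<inter> F) + f (X - F) = f X" for X
    using main[of X] sub[of "X \<inter> F" "X - F"] by (simp add: Int_Diff_Un antisym)
  then show ?thesis
    by (simp add: in_lambda_system_UNIV)
qed

lemma hausdorff_measure_space:
  "measure_space UNIV (lambda_system UNIV UNIV (hausdorff_outer k)) (hausdorff_outer k)"
  using sigma_algebra.caratheodory_lemma[OF sigma_algebra_UNIV outer_measure_space_hausdorff] .

lemma sets_hausdorff:
  "sets (hausdorff_measure k :: 'a::metric_space measure) = lambda_system UNIV UNIV (hausdorff_outer k)"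
  using hausdorff_measure_space[of k, where 'a='a]
  by (simp add: hausdorff_measure_def measure_space_def sigma_algebra.sigma_sets_eq)

lemma space_hausdorff [simp]: "space (hausdorff_measure k) = UNIV"
  by (simp add: hausdorff_measure_def space_measure_of_conv)

lemma emeasure_hausdorff:
  fixes A :: "'a::metric_space set"
  shows "A \<in> sets (hausdorff_measure k) \<Longrightarrow> emeasure (hausdorff_measure k) A = hausdorff_outer k A"
  using emeasure_measure_of_sigma[of UNIV "lambda_system UNIV UNIV (hausdorff_outer k)" "hausdorff_outer k" A]
    hausdorff_measure_space[of k, where 'a='a] sets_hausdorff[of k, where 'a='a]
  by (simp add: hausdorff_measure_def measure_space_def)

lemma closed_sets_hausdorff: "closed F \<Longrightarrow> F \<in> sets (hausdorff_measure k)"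
  unfolding sets_hausdorff
  using metric_outer_measure_closed[OF outer_measure_space_hausdorff[of k]] hausdorff_outer_separated
  by blast

lemma borel_sets_hausdorff: "A \<in> sets borel \<Longrightarrow> A \<in> sets (hausdorff_measure k)"
proof -
  have "sets borel \<subseteq> sets (hausdorff_measure k :: 'a measure)"
    unfolding borel_eq_closed
    using sets.sigma_sets_subset[of "Collect closed" "hausdorff_measure k"] closed_sets_hausdorff
    by (auto simp: sets_measure_of)
  then show "A \<in> sets borel \<Longrightarrow> A \<in> sets (hausdorff_measure k)" by blast
qed

text \<open>
  The measure is complete: it is defined on all Caratheodory measurable sets, and a set of outer
  measure zero is one of them.
\<close>

lemma null_sets_hausdorff:
  assumes "hausdorff_outer k A = 0"
  shows "A \<in> null_sets (hausdorff_measure k)"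
proof -
  have oms: "outer_measure_space UNIV (hausdorff_outer k :: 'a set \<Rightarrow> ennreal)"
    by (rule outer_measure_space_hausdorff)
  have "hausdorff_outer k (X \<inter> A) + hausdorff_outer k (X - A) = hausdorff_outer k X" for X
  proof -
    have 0: "hausdorff_outer k (X \<inter> A) = 0"
      using hausdorff_outer_mono[of "X \<inter> A" A k] assms by simp
    have "hausdorff_outer k ((X \<inter> A) \<union> (X - A)) \<le> hausdorff_outer k (X \<inter> A) + hausdorff_outer k (X - A)"
      by (rule outer_measure_space_Un[OF oms])
    then show ?thesis
      using 0 hausdorff_outer_mono[of "X - A" X k] by (simp add: Int_Diff_Un antisym)
  qed
  then have "A \<in> sets (hausdorff_measure k)"
    unfolding sets_hausdorff by (simp add: in_lambda_system_UNIV)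
  then show ?thesis using assms by (simp add: null_sets_def emeasure_hausdorff)
qed

text \<open>
  Reflection in the origin is an isometry. The resulting evenness of the surface measure makes
  the curvature measure of a symmetric body even.
\<close>

lemma bounded_diameter_uminus:
  fixes A :: "'a::real_normed_vector set"
  shows "bounded (uminus ` A) = bounded A" "diameter (uminus ` A) = diameter A"
proof -
  show "bounded (uminus ` A) = bounded A" by simp
  have "(SUP (x,y)\<in>uminus ` A \<times> uminus ` A. dist x y) = (SUP (x,y)\<in>A \<times> A. dist x y)"
  proof -
    have "(\<lambda>(x,y). dist x y) ` (uminus ` A \<times> uminus ` A) = (\<lambda>(x,y). dist x y) ` (A \<times> A)"
      by (force simp: dist_minus image_iff)
    then show ?thesis by simp
  qed
  then show "diameter (uminus ` A) = diameter A" by (simp add: diameter_def)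
qed

lemma hausdorff_outer_uminus:
  fixes A :: "'a::real_normed_vector set"
  shows "hausdorff_outer k (uminus ` A) = hausdorff_outer k A"
proof -
  have le: "hausdorff_premeasure k \<delta> (uminus ` A) \<le> hausdorff_premeasure k \<delta> A" for \<delta> and A :: "'a set"
  proof (rule hausdorff_premeasure_greatest)
    fix U :: "nat \<Rightarrow> 'a set"
    assume U: "A \<subseteq> (\<Union>i. U i)" "\<And>i. bounded (U i)" "\<And>i. diameter (U i) \<le> \<delta>"
    have "uminus ` A \<subseteq> (\<Union>i. uminus ` U i)" using U(1) by (auto simp flip: image_UN)
    then have "hausdorff_premeasure k \<delta> (uminus ` A) \<le> (\<Sum>i. hausdorff_weight k (uminus ` U i))"
      using U by (intro hausdorff_premeasure_le) (auto simp: bounded_diameter_uminus)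
    also have "\<dots> = (\<Sum>i. hausdorff_weight k (U i))"
      by (simp only: hausdorff_weight_def bounded_diameter_uminus image_is_empty)
    finally show "hausdorff_premeasure k \<delta> (uminus ` A) \<le> (\<Sum>i. hausdorff_weight k (U i))" .
  qed
  have "hausdorff_premeasure k \<delta> (uminus ` A) = hausdorff_premeasure k \<delta> A" for \<delta>
    using le[of \<delta> A] le[of \<delta> "uminus ` A"] by (simp add: image_image)
  then show ?thesis by (simp add: hausdorff_outer_def)
qed

lemma sets_hausdorff_uminus:
  fixes A :: "'a::real_normed_vector set"
  assumes "A \<in> sets (hausdorff_measure k)"
  shows "uminus ` A \<in> sets (hausdorff_measure k)"
proof -
  have A: "hausdorff_outer k (X \<inter> A) + hausdorff_outer k (X - A) = hausdorff_outer k X" for X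
    using assms unfolding sets_hausdorff by (simp add: in_lambda_system_UNIV)
  have "hausdorff_outer k (X \<inter> uminus ` A) + hausdorff_outer k (X - uminus ` A) = hausdorff_outer k X" for X
  proof -
    have "X \<inter> uminus ` A = uminus ` (uminus ` X \<inter> A)" "X - uminus ` A = uminus ` (uminus ` X - A)"
      by (force simp: image_iff)+
    then show ?thesis using A[of "uminus ` X"] by (simp only: hausdorff_outer_uminus)
  qed
  then show ?thesis
    unfolding sets_hausdorff by (simp add: in_lambda_system_UNIV)
qed

section \<open>Hausdorff null sets on the sphere\<close>

text \<open>
  A Lebesgue null set has a countable cover by almost disjoint cubes of small total volume. For
  cubes the volume is comparable with the power \<open>DIM('a)\<close> of the diameter, which is the quantity
  that Hausdorff measure sees.
\<close>

lemma negligible_cube_cover: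
  fixes N :: "'a::euclidean_space set"
  assumes "negligible N" "bounded N" "0 < \<epsilon>" "0 < \<delta>"
  obtains K :: "nat \<Rightarrow> 'a set" where "N \<subseteq> (\<Union>i. K i)" "\<And>i. bounded (K i)" "\<And>i. diameter (K i) \<le> \<delta>"
    "(\<Sum>i. ennreal (diameter (K i) ^ DIM('a))) \<le> ennreal \<epsilon>"
proof -
  define n where "n = DIM('a)"
  have n: "0 < n" by (simp add: n_def)
  \<comment> \<open>A cube of side \<open>s\<close> has diameter at most \<open>n * s\<close> and volume \<open>s ^ n\<close>. The first bound
    on the total volume controls the sum, the second each single diameter.\<close>
  define e where "e = min (\<epsilon> / real n ^ n) ((\<delta> / real n) ^ n)"
  have e: "0 < e" using assms n by (simp add: e_def)
  obtain c where c: "0 < c" "N \<subseteq> cbox (- c *\<^sub>R One) (c *\<^sub>R One)"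
  proof -
    obtain a where "N \<subseteq> cbox (-a) a" using bounded_subset_cbox_symmetric[OF assms(2)] by blast
    define c where "c = norm a + 1"
    have "cbox (-a) a \<subseteq> cbox (- c *\<^sub>R One) (c *\<^sub>R One)"
    proof
      fix x assume "x \<in> cbox (-a) a"
      moreover have "\<bar>a \<bullet> i\<bar> \<le> c" if "i \<in> Basis" for i
        using Basis_le_norm[OF that, of a] by (simp add: c_def)
      ultimately show "x \<in> cbox (- c *\<^sub>R One) (c *\<^sub>R One)"
        by (force simp: mem_box abs_le_iff)
    qed
    moreover have "0 < c" by (simp add: c_def add_nonneg_pos)
    ultimately show ?thesis using \<open>N \<subseteq> cbox (-a) a\<close> that by blast
  qed
  have lN: "N \<in> lmeasurable" "measure lebesgue N = 0"
    using \<open>negligible N\<close> by (simp_all add: negligible_imp_measurable negligible_imp_measure0)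
  obtain \<D> where D: "countable \<D>"
    and D1: "\<And>K. K \<in> \<D> \<Longrightarrow> K \<noteq> {} \<and> (\<exists>c d. K = cbox c d)"
    and D2: "pairwise (\<lambda>A B. interior A \<inter> interior B = {}) \<D>"
    and D3: "\<And>u v. cbox u v \<in> \<D> \<Longrightarrow> \<exists>m. \<forall>i \<in> Basis. v \<bullet> i - u \<bullet> i = ((c *\<^sub>R One) \<bullet> i - (- c *\<^sub>R One) \<bullet> i)/2^m"
    and D4: "N \<subseteq> \<Union>\<D>" "\<Union>\<D> \<in> lmeasurable" "measure lebesgue (\<Union>\<D>) \<le> measure lebesgue N + e"
    using measurable_outer_intervals_bounded[OF lN(1) c(2) e] by metis
  define K where "K i = (if i \<in> to_nat_on \<D> ` \<D> then from_nat_into \<D> i else {})" for i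
  have KD: "K i = {} \<or> K i \<in> \<D>" for i
    using D by (auto simp: K_def)
  have UK: "(\<Union>i. K i) = \<Union>\<D>"
  proof
    show "\<Union>\<D> \<subseteq> (\<Union>i. K i)"
    proof
      fix x assume "x \<in> \<Union>\<D>"
      then obtain Q where "Q \<in> \<D>" "x \<in> Q" by blast
      then have "x \<in> K (to_nat_on \<D> Q)" using D by (simp add: K_def)
      then show "x \<in> (\<Union>i. K i)" by blast
    qed
  qed (use KD in blast)
  \<comment> \<open>The cubes overlap in faces only; their volumes are added through the disjoint
    interiors.\<close>
  have dK: "disjoint_family (\<lambda>i. interior (K i))"
  proof -
    have "interior (K i) \<inter> interior (K j) = {}" if ij: "i \<noteq> j" for i j
    proof (cases "K i = {} \<or> K j = {}")
      case False
      then obtain P Q where PQ: "P \<in> \<D>" "i = to_nat_on \<D> P" "Q \<in> \<D>" "j = to_nat_on \<D> Q"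
        by (auto simp: K_def split: if_splits)
      then have "K i = P" "K j = Q" "P \<noteq> Q" using ij D by (auto simp: K_def)
      then show ?thesis using D2 PQ by (auto simp: pairwise_def)
    qed auto
    then show ?thesis by (auto simp: disjoint_family_on_def)
  qed
  have cube: "bounded (K i) \<and> ennreal (diameter (K i) ^ n) \<le> ennreal (real n ^ n) * emeasure lborel (interior (K i))" for i
  proof (cases "K i = {}")
    case True
    then show ?thesis using n by simp
  next
    case False
    then obtain u v where uv: "K i = cbox u v" and KiD: "cbox u v \<in> \<D>" using KD D1 by metis
    obtain m where m: "\<And>j. j \<in> Basis \<Longrightarrow> v \<bullet> j - u \<bullet> j = 2 * c / 2 ^ m"
      using D3[OF KiD] by (auto simp: inner_sum_left_Basis)
    define s where "s = 2 * c / 2 ^ m"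
    have s: "0 < s" using c by (simp add: s_def)
    have le: "u \<bullet> j \<le> v \<bullet> j" if "j \<in> Basis" for j using m[OF that] s by (simp add: s_def)
    have "diameter (cbox u v) = dist u v" by (rule diameter_cbox) (use le in auto)
    also have "\<dots> \<le> (\<Sum>j\<in>Basis. \<bar>(u - v) \<bullet> j\<bar>)" unfolding dist_norm by (rule norm_le_l1)
    also have "\<dots> = (\<Sum>j\<in>(Basis::'a set). s)"
    proof (rule sum.cong)
      fix j :: 'a assume j: "j \<in> Basis"
      show "\<bar>(u - v) \<bullet> j\<bar> = s" using m[OF j] s by (simp add: inner_diff_left s_def)
    qed simp
    finally have d: "diameter (K i) \<le> real n * s" by (simp add: n_def uv)
    have "emeasure lborel (interior (K i)) = emeasure lborel (box u v)" by (simp add: uv)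
    also have "\<dots> = ennreal (\<Prod>j\<in>Basis. (v - u) \<bullet> j)"
      by (rule emeasure_lborel_box) (rule le)
    also have "(\<Prod>j\<in>Basis. (v - u) \<bullet> j) = (\<Prod>j\<in>(Basis::'a set). s)"
      by (rule prod.cong) (simp_all add: m inner_diff_left s_def)
    also have "\<dots> = s ^ n" by (simp add: n_def)
    finally have vol: "emeasure lborel (interior (K i)) = ennreal (s ^ n)" .
    have "diameter (K i) ^ n \<le> (real n * s) ^ n"
      by (rule power_mono[OF d]) (simp add: uv diameter_ge_0)
    then have "ennreal (diameter (K i) ^ n) \<le> ennreal (real n ^ n) * emeasure lborel (interior (K i))"
      using s by (simp add: vol ennreal_mult[symmetric] power_mult_distrib)
    then show ?thesis by (simp add: uv bounded_cbox)
  qed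
  have "(\<Sum>i. ennreal (diameter (K i) ^ n)) \<le> (\<Sum>i. ennreal (real n ^ n) * emeasure lborel (interior (K i)))"
    using cube n by (intro suminf_le summableI) auto
  also have "\<dots> = ennreal (real n ^ n) * emeasure lborel (\<Union>i. interior (K i))"
    using dK by (subst ennreal_suminf_cmult, subst suminf_emeasure) auto
  also have "\<dots> \<le> ennreal (real n ^ n) * ennreal e"
  proof (intro mult_left_mono)
    have "emeasure lborel (\<Union>i. interior (K i)) = emeasure lebesgue (\<Union>i. interior (K i))"
      by (subst emeasure_completion) (auto intro!: borel_open open_UN)
    also have "\<dots> \<le> emeasure lebesgue (\<Union>\<D>)"
      using D4(2) interior_subset by (intro emeasure_mono) (auto simp: UK[symmetric] fmeasurableD)
    also have "\<dots> \<le> ennreal e"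
      using D4(2,3) lN(2) by (simp add: emeasure_eq_measure2 ennreal_leI)
    finally show "emeasure lborel (\<Union>i. interior (K i)) \<le> ennreal e" .
  qed simp
  also have "\<dots> = ennreal (real n ^ n * e)" using e by (simp add: ennreal_mult)
  finally have sum: "(\<Sum>i. ennreal (diameter (K i) ^ n)) \<le> ennreal (real n ^ n * e)" .
  have "real n ^ n * e \<le> real n ^ n * (\<epsilon> / real n ^ n)" "real n ^ n * e \<le> real n ^ n * (\<delta> / real n) ^ n"
    unfolding e_def by (intro mult_left_mono; simp)+
  then have e12: "real n ^ n * e \<le> \<epsilon>" "real n ^ n * e \<le> \<delta> ^ n"
    using n by (simp_all add: power_divide)
  show ?thesis
  proof (rule that)
    show "N \<subseteq> (\<Union>i. K i)" using UK D4 by simp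
    show "bounded (K i)" for i using cube by blast
    show "diameter (K i) \<le> \<delta>" for i
    proof -
      have "ennreal (diameter (K i) ^ n) \<le> (\<Sum>i. ennreal (diameter (K i) ^ n))"
        using sum_le_suminf[of "\<lambda>i. ennreal (diameter (K i) ^ n)" "{i}"] by (simp add: summableI)
      also note sum
      also have "ennreal (real n ^ n * e) \<le> ennreal (\<delta> ^ n)" using e12 by (intro ennreal_leI)
      finally have "diameter (K i) ^ n \<le> \<delta> ^ n" using assms by (simp add: ennreal_le_iff)
      then show ?thesis using assms n by (simp add: power_mono_iff diameter_ge_0 cube)
    qed
    show "(\<Sum>i. ennreal (diameter (K i) ^ DIM('a))) \<le> ennreal \<epsilon>"
      using sum e12(1) unfolding n_def[symmetric] by (meson ennreal_leI order_trans)
  qed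
qed

text \<open>
  Cover the cone by sets \<open>K i\<close> of diameter \<open>d i\<close> with \<open>\<Sum>i. d i ^ DIM('a)\<close> small. The radii of
  the spheres that \<open>K i\<close> meets form a set of length at most \<open>2 * d i\<close>. Hence, averaged over
  \<open>r \<in> {1..2}\<close>, the sum of \<open>d i ^ (DIM('a) - 1)\<close> over those \<open>K i\<close> that meet the sphere of radius
  \<open>r\<close> is small, so it is small for some \<open>r\<close>. Scaling the traces on this sphere by \<open>1 / r\<close> gives
  a cover of \<open>A\<close>.
\<close>

lemma hausdorff_null_of_negligible_cone:
  fixes A :: "'a::euclidean_space set"
  assumes A: "A \<subseteq> sphere 0 1"
    and neg: "negligible {r *\<^sub>R u |r u. u \<in> A \<and> 1 \<le> r \<and> r \<le> 2}" (is "negligible ?N")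
  shows "hausdorff_outer (DIM('a) - 1) A = 0"
proof -
  define k where "k = DIM('a) - 1"
  have k: "DIM('a) = Suc k" by (simp add: k_def)
  have bN: "bounded ?N"
    by (rule bounded_subset[of "cball 0 2"]) (use A in auto)
  have small: "hausdorff_premeasure k \<delta> A \<le> ennreal (unit_ball_vol k * (3 * e))" if \<delta>: "0 < \<delta>" and e: "0 < e" for \<delta> e
  proof -
    obtain K :: "nat \<Rightarrow> 'a set" where K: "?N \<subseteq> (\<Union>i. K i)" "\<And>i. bounded (K i)" "\<And>i. diameter (K i) \<le> \<delta>"
      and sum: "(\<Sum>i. ennreal (diameter (K i) ^ DIM('a))) \<le> ennreal e"
      by (rule negligible_cube_cover[OF neg bN e \<delta>]) blast
    define d where "d i = diameter (K i)" for i
    have d: "0 \<le> d i" for i using K by (simp add: d_def diameter_ge_0)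
    define x where "x i = (SOME x. x \<in> K i)" for i
    define I where "I i = {norm (x i) - d i .. norm (x i) + d i}" for i
    define g where "g r = (\<Sum>i. ennreal (d i ^ k) * indicator (I i) r)" for r
    have hit: "norm y \<in> I i" if "y \<in> K i" for y i
    proof -
      have "x i \<in> K i" unfolding x_def by (rule someI) (rule that)
      then have "dist y (x i) \<le> d i" unfolding d_def using that K by (intro diameter_bounded_bound) auto
      then show ?thesis using norm_triangle_ineq3[of y "x i"] by (auto simp: I_def dist_norm abs_le_iff)
    qed
    \<comment> \<open>The integral of \<open>g\<close> is at most \<open>2 * e\<close>, so \<open>g\<close> is below \<open>3 * e\<close> somewhere on an
      interval of length 1.\<close>
    have "\<exists>r\<in>{1..2}. g r < ennreal (3 * e)"
    proof (rule ccontr)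
      assume "\<not> ?thesis"
      then have ge: "\<And>r. r \<in> {1..2} \<Longrightarrow> ennreal (3 * e) \<le> g r" by (auto simp: not_less)
      have "ennreal (3 * e) = (\<integral>\<^sup>+r. ennreal (3 * e) * indicator {1..2::real} r \<partial>lborel)"
        by (subst nn_integral_cmult_indicator) auto
      also have "\<dots> \<le> (\<integral>\<^sup>+r. g r \<partial>lborel)"
        using ge by (intro nn_integral_mono) (auto simp: indicator_def)
      also have "\<dots> = (\<Sum>i. \<integral>\<^sup>+r. ennreal (d i ^ k) * indicator (I i) r \<partial>lborel)"
        unfolding g_def by (rule nn_integral_suminf) (simp add: I_def)
      also have "\<dots> = (\<Sum>i. 2 * ennreal (d i ^ DIM('a)))"
      proof (rule suminf_cong)
        fix i
        have "(\<integral>\<^sup>+r. ennreal (d i ^ k) * indicator (I i) r \<partial>lborel) = ennreal (d i ^ k) * ennreal (2 * d i)"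
          by (subst nn_integral_cmult_indicator) (simp_all add: I_def d)
        also have "\<dots> = 2 * ennreal (d i ^ DIM('a))"
          using d[of i] by (simp add: k ennreal_mult[symmetric] ennreal_numeral[symmetric] del: ennreal_numeral)
        finally show "(\<integral>\<^sup>+r. ennreal (d i ^ k) * indicator (I i) r \<partial>lborel) = 2 * ennreal (d i ^ DIM('a))" .
      qed
      also have "\<dots> = 2 * (\<Sum>i. ennreal (d i ^ DIM('a)))" by simp
      also have "\<dots> \<le> 2 * ennreal e" using sum unfolding d_def by (rule mult_left_mono) simp
      also have "\<dots> = ennreal (2 * e)" using e by (simp add: ennreal_mult)
      finally show False using e by (simp add: ennreal_le_iff)
    qed
    then obtain r where r: "1 \<le> r" "r \<le> 2" "g r < ennreal (3 * e)" by auto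
    define U where "U i = (\<lambda>y. (1 / r) *\<^sub>R y) ` {y \<in> K i. norm y = r}" for i
    have bU: "bounded (U i)" for i
      unfolding U_def by (intro bounded_scaling bounded_subset[OF K(2)]) auto
    have dU: "diameter (U i) \<le> d i" for i
    proof (rule diameter_le)
      fix y z assume "y \<in> U i" "z \<in> U i"
      then obtain y' z' where yz: "y' \<in> K i" "z' \<in> K i" "y = (1/r) *\<^sub>R y'" "z = (1/r) *\<^sub>R z'" by (auto simp: U_def)
      have "norm (y - z) = (1/r) * dist y' z'"
        using r by (simp add: yz dist_norm flip: scaleR_diff_right)
      also have "\<dots> \<le> 1 * dist y' z'" using r by (intro mult_right_mono) auto
      also have "\<dots> \<le> d i" using diameter_bounded_bound[OF K(2) yz(1,2)] by (simp add: d_def)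
      finally show "norm (y - z) \<le> d i" .
    qed (use d in auto)
    have AU: "A \<subseteq> (\<Union>i. U i)"
    proof
      fix u assume u: "u \<in> A"
      then have "r *\<^sub>R u \<in> ?N" using r by blast
      then obtain i where "r *\<^sub>R u \<in> K i" using K(1) by blast
      moreover have "norm (r *\<^sub>R u) = r" using u A r by auto
      ultimately have "(1/r) *\<^sub>R (r *\<^sub>R u) \<in> U i" unfolding U_def by blast
      then show "u \<in> (\<Union>i. U i)" using r by auto
    qed
    have "hausdorff_premeasure k \<delta> A \<le> (\<Sum>i. hausdorff_weight k (U i))"
      using AU bU order_trans[OF dU K(3)[folded d_def]] by (rule hausdorff_premeasure_le)
    also have "\<dots> \<le> (\<Sum>i. ennreal (unit_ball_vol k) * (ennreal (d i ^ k) * indicator (I i) r))"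
    proof (intro suminf_le summableI)
      fix i
      show "hausdorff_weight k (U i) \<le> ennreal (unit_ball_vol k) * (ennreal (d i ^ k) * indicator (I i) r)"
      proof (cases "U i = {}")
        case False
        then have "r \<in> I i" using hit by (auto simp: U_def)
        moreover have "(diameter (U i) / 2) ^ k \<le> d i ^ k"
          using dU[of i] diameter_ge_0[OF bU[of i]] by (intro power_mono) auto
        ultimately show ?thesis
          using False d[of i] by (auto simp: hausdorff_weight_def ennreal_mult[symmetric] intro!: ennreal_leI mult_left_mono)
      qed (simp add: hausdorff_weight_def)
    qed
    also have "\<dots> = ennreal (unit_ball_vol k) * g r" by (simp add: g_def)
    also have "\<dots> \<le> ennreal (unit_ball_vol k) * ennreal (3 * e)"
      using r by (intro mult_left_mono) auto
    also have "\<dots> = ennreal (unit_ball_vol k * (3 * e))" using e by (simp add: ennreal_mult)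
    finally show ?thesis .
  qed
  have "hausdorff_premeasure k \<delta> A \<le> 0" if "0 < \<delta>" for \<delta>
  proof (rule ennreal_le_epsilon)
    fix e :: real assume "0 < e"
    have "unit_ball_vol (real k) \<noteq> 0" using unit_ball_vol_pos[of "real k"] by linarith
    then show "hausdorff_premeasure k \<delta> A \<le> 0 + ennreal e"
      using small[OF that, of "e / (3 * unit_ball_vol k)"] \<open>0 < e\<close> by simp
  qed
  then have "hausdorff_outer k A \<le> 0"
    unfolding hausdorff_outer_def by (intro SUP_least) simp
  then show ?thesis by (simp add: k_def)
qed

section \<open>The measure on the sphere\<close>

lemma space_sphere_measure [simp]: "space (sphere_measure :: 'a::euclidean_space measure) = sphere 0 1"
  by (simp add: sphere_measure_def space_restrict_space)

lemma sets_sphere_measure: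
  "A \<in> sets (sphere_measure :: 'a::euclidean_space measure) \<longleftrightarrow>
     A \<subseteq> sphere 0 1 \<and> A \<in> sets (hausdorff_measure (DIM('a) - 1))"
  unfolding sphere_measure_def
  by (subst sets_restrict_space_iff) (auto simp: closed_sets_hausdorff)

lemma emeasure_sphere_measure:
  assumes "A \<in> sets (sphere_measure :: 'a::euclidean_space measure)"
  shows "emeasure sphere_measure A = hausdorff_outer (DIM('a) - 1) A"
  using assms unfolding sets_sphere_measure
  by (simp add: sphere_measure_def emeasure_restrict_space closed_sets_hausdorff emeasure_hausdorff)

lemma borel_sets_sphere_measure:
  "A \<in> sets borel \<Longrightarrow> A \<subseteq> sphere 0 1 \<Longrightarrow> A \<in> sets (sphere_measure :: 'a::euclidean_space measure)"
  by (simp add: sets_sphere_measure borel_sets_hausdorff)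

lemma measurable_sphere_measure:
  assumes "f \<in> measurable (restrict_space borel (sphere 0 1)) M"
  shows "f \<in> measurable (sphere_measure :: 'a::euclidean_space measure) M"
proof (rule measurableI)
  fix A assume A: "A \<in> sets M"
  have "f -` A \<inter> sphere 0 1 \<in> sets (restrict_space borel (sphere (0::'a) 1))"
    using measurable_sets[OF assms A] by (simp add: space_restrict_space)
  then show "f -` A \<inter> space sphere_measure \<in> sets (sphere_measure :: 'a measure)"
    by (simp add: sets_restrict_space_iff borel_closed borel_sets_sphere_measure)
qed (use measurable_space[OF assms] in \<open>simp add: space_restrict_space\<close>)

lemma continuous_on_measurable_sphere:
  "continuous_on (sphere 0 1) f \<Longrightarrow> f \<in> borel_measurable (sphere_measure :: 'a::euclidean_space measure)"
  by (intro measurable_sphere_measure borel_measurable_continuous_on_restrict)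

lemma null_sets_sphere_measure_subset:
  assumes "N \<in> null_sets (sphere_measure :: 'a::euclidean_space measure)" "A \<subseteq> N"
  shows "A \<in> null_sets sphere_measure"
proof -
  have "hausdorff_outer (DIM('a) - 1) A = 0" "A \<subseteq> sphere 0 1"
    using assms hausdorff_outer_mono[OF assms(2), of "DIM('a) - 1"]
    by (auto simp: null_sets_def emeasure_sphere_measure sets_sphere_measure)
  then show ?thesis
    using null_sets_hausdorff[of "DIM('a) - 1" A]
    by (simp add: null_sets_def sets_sphere_measure emeasure_sphere_measure)
qed

lemma null_sets_sphere_measure_cone:
  fixes A :: "'a::euclidean_space set"
  assumes "A \<subseteq> sphere 0 1" "negligible {r *\<^sub>R u |r u. u \<in> A \<and> 1 \<le> r \<and> r \<le> 2}"
  shows "A \<in> null_sets sphere_measure"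
  using null_sets_hausdorff[OF hausdorff_null_of_negligible_cone[OF assms]] assms(1)
    hausdorff_null_of_negligible_cone[OF assms]
  by (simp add: null_sets_def sets_sphere_measure emeasure_sphere_measure)

text \<open>
  Completeness in the form in which it is applied to reverse radial Gauss images, which agree up
  to a null set with preimages of a measurable map.
\<close>

lemma sphere_measure_sets_modulo_null:
  assumes "N \<in> null_sets (sphere_measure :: 'a::euclidean_space measure)"
    and "A \<in> sets sphere_measure" "A - N = B - N" "B \<subseteq> sphere 0 1"
  shows "B \<in> sets sphere_measure"
proof -
  have "B \<inter> N \<in> null_sets sphere_measure"
    by (rule null_sets_sphere_measure_subset[OF assms(1)]) auto
  moreover have "A - N \<in> sets sphere_measure"
    using assms(1,2) by (intro sets.Diff) (auto simp: null_sets_def)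
  ultimately have "(A - N) \<union> (B \<inter> N) \<in> sets sphere_measure"
    by (intro sets.Un) (auto simp: null_sets_def)
  moreover have "(A - N) \<union> (B \<inter> N) = B" using assms(3) by blast
  ultimately show ?thesis by simp
qed

lemma uminus_measurable_sphere:
  "uminus \<in> measurable (sphere_measure :: 'a::euclidean_space measure) sphere_measure"
proof (rule measurableI)
  fix A assume A: "A \<in> sets (sphere_measure :: 'a measure)"
  have "uminus -` A \<inter> sphere 0 1 = uminus ` A"
    using A by (force simp: sets_sphere_measure image_iff)
  then show "uminus -` A \<inter> space sphere_measure \<in> sets (sphere_measure :: 'a measure)"
    using A sets_hausdorff_uminus by (auto simp: sets_sphere_measure)
qed simp

lemma distr_sphere_measure_uminus:
  "distr sphere_measure sphere_measure uminus = (sphere_measure :: 'a::euclidean_space measure)"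
proof (rule measure_eqI)
  fix A assume "A \<in> sets (distr sphere_measure sphere_measure (uminus :: 'a \<Rightarrow> 'a))"
  then have A: "A \<in> sets (sphere_measure :: 'a measure)" by simp
  have "uminus -` A \<inter> sphere 0 1 = uminus ` A"
    using A by (force simp: sets_sphere_measure image_iff)
  moreover have "uminus ` A \<in> sets sphere_measure"
    using A sets_hausdorff_uminus by (auto simp: sets_sphere_measure)
  ultimately show "emeasure (distr sphere_measure sphere_measure uminus) A = emeasure sphere_measure A"
    using A by (simp add: emeasure_distr uminus_measurable_sphere emeasure_sphere_measure hausdorff_outer_uminus)
qed simp

lemma measurable_sphere_measure_AE:
  fixes f g :: "'a::euclidean_space \<Rightarrow> real"
  assumes g: "g \<in> borel_measurable sphere_measure" and ae: "AE u in sphere_measure. f u = g u"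
  shows "f \<in> borel_measurable sphere_measure"
proof -
  obtain N where N: "{u \<in> space sphere_measure. f u \<noteq> g u} \<subseteq> N" "N \<in> null_sets (sphere_measure :: 'a measure)"
    using ae unfolding eventually_ae_filter by blast
  show ?thesis
  proof (rule measurableI)
    fix B :: "real set" assume B: "B \<in> sets borel"
    show "f -` B \<inter> space sphere_measure \<in> sets sphere_measure"
    proof (rule sphere_measure_sets_modulo_null[OF N(2) measurable_sets[OF g B]])
      show "g -` B \<inter> space sphere_measure - N = f -` B \<inter> space sphere_measure - N" using N(1) by auto
    qed auto
  qed simp
qed

lemma integral_sphere_measure_uminus:
  fixes f :: "'a::euclidean_space \<Rightarrow> real"
  assumes "f \<in> borel_measurable sphere_measure"
  shows "(LINT u|sphere_measure. f (- u)) = (LINT u|sphere_measure. f u)"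
  using integral_distr[OF uminus_measurable_sphere assms] by (simp add: distr_sphere_measure_uminus)

section \<open>Wulff shapes, gauges and support functions\<close>

definition pos_cont :: "('a::euclidean_space \<Rightarrow> real) \<Rightarrow> bool" where
  "pos_cont h \<longleftrightarrow> continuous_on (sphere 0 1) h \<and> (\<forall>v\<in>sphere 0 1. 0 < h v)"

definition wulff :: "('a::euclidean_space \<Rightarrow> real) \<Rightarrow> 'a set" where
  "wulff h = {x. \<forall>v\<in>sphere 0 1. v \<bullet> x \<le> h v}"

definition wulff_gauge :: "('a::euclidean_space \<Rightarrow> real) \<Rightarrow> 'a \<Rightarrow> real" where
  "wulff_gauge h x = (SUP v\<in>sphere 0 1. (v \<bullet> x) / h v)"

text \<open>
  For \<open>u\<close> on the sphere, \<open>v\<close> is touching when the half-space \<open>{x. v \<bullet> x \<le> h v}\<close> is active at the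
  boundary point of the Wulff shape in direction \<open>u\<close>. When \<open>h\<close> is a support function this means
  that \<open>v\<close> is an outer normal there.
\<close>

definition touching :: "('a::euclidean_space \<Rightarrow> real) \<Rightarrow> 'a \<Rightarrow> 'a \<Rightarrow> bool" where
  "touching h x v \<longleftrightarrow> v \<in> sphere 0 1 \<and> (v \<bullet> x) / h v = wulff_gauge h x"

lemma sphere_nonempty: "sphere (0::'a::euclidean_space) 1 \<noteq> {}"
  using norm_Basis[OF SOME_Basis, where 'a='a] by (auto intro!: exI[of _ "SOME i. i \<in> Basis"])

lemma pos_cont_bounds:
  assumes "pos_cont (h :: 'a::euclidean_space \<Rightarrow> real)"
  obtains a b where "0 < a" "\<And>v. v \<in> sphere 0 1 \<Longrightarrow> a \<le> h v" "\<And>v. v \<in> sphere 0 1 \<Longrightarrow> h v \<le> b"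
  using continuous_attains_inf[OF compact_sphere sphere_nonempty, of h]
    continuous_attains_sup[OF compact_sphere sphere_nonempty, of h] assms
  unfolding pos_cont_def by metis

context
  fixes h :: "'a::euclidean_space \<Rightarrow> real"
  assumes h: "pos_cont h"
begin

lemma pos_cont_pos: "v \<in> sphere 0 1 \<Longrightarrow> 0 < h v"
  using h by (simp add: pos_cont_def)

text \<open>
  The supremum is attained by compactness of the sphere.
\<close>

lemma gauge_attained: "\<exists>v. touching h x v \<and> (\<forall>w\<in>sphere 0 1. (w \<bullet> x) / h w \<le> wulff_gauge h x)"
proof -
  have "continuous_on (sphere 0 1) (\<lambda>v. (v \<bullet> x) / h v)"
    using h pos_cont_pos by (intro continuous_intros) (auto simp: pos_cont_def less_imp_neq[THEN not_sym])
  then obtain v where v: "v \<in> sphere 0 1" "\<And>w. w \<in> sphere 0 1 \<Longrightarrow> (w \<bullet> x) / h w \<le> (v \<bullet> x) / h v"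
    using continuous_attains_sup[OF compact_sphere sphere_nonempty, of "\<lambda>v. (v \<bullet> x) / h v"] by blast
  have "wulff_gauge h x = (v \<bullet> x) / h v"
    unfolding wulff_gauge_def using v by (intro cSup_eq_maximum) auto
  then show ?thesis using v by (auto simp: touching_def)
qed

lemma touching_exists: "\<exists>v. touching h x v"
  using gauge_attained by blast

lemma gauge_upper: "w \<in> sphere 0 1 \<Longrightarrow> (w \<bullet> x) / h w \<le> wulff_gauge h x"
  using gauge_attained by blast

lemma gauge_upper_mult: "w \<in> sphere 0 1 \<Longrightarrow> w \<bullet> x \<le> h w * wulff_gauge h x"
  using gauge_upper[of w x] pos_cont_pos[of w] by (simp add: divide_le_eq mult.commute)

lemma gauge_le_iff: "wulff_gauge h x \<le> c \<longleftrightarrow> (\<forall>v\<in>sphere 0 1. v \<bullet> x \<le> c * h v)"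
proof
  assume c: "wulff_gauge h x \<le> c"
  show "\<forall>v\<in>sphere 0 1. v \<bullet> x \<le> c * h v"
  proof
    fix v :: 'a assume v: "v \<in> sphere 0 1"
    have "(v \<bullet> x) / h v \<le> c" using gauge_upper[OF v, of x] c by simp
    then show "v \<bullet> x \<le> c * h v" using pos_cont_pos[OF v] by (simp add: divide_le_eq)
  qed
next
  assume r: "\<forall>v\<in>sphere 0 1. v \<bullet> x \<le> c * h v"
  obtain v where "touching h x v" using touching_exists by blast
  then have v: "v \<in> sphere 0 1" "(v \<bullet> x) / h v = wulff_gauge h x" by (auto simp: touching_def)
  then have "v \<bullet> x \<le> c * h v" "0 < h v" using r pos_cont_pos by auto
  then have "(v \<bullet> x) / h v \<le> c" by (simp add: divide_le_eq)
  then show "wulff_gauge h x \<le> c" using v by simp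
qed

lemma gauge_scale: "0 \<le> c \<Longrightarrow> wulff_gauge h (c *\<^sub>R x) = c * wulff_gauge h x"
proof -
  assume c: "0 \<le> c"
  obtain v where v: "touching h x v" using touching_exists by blast
  then have "c * wulff_gauge h x \<le> wulff_gauge h (c *\<^sub>R x)"
    using gauge_upper[of v "c *\<^sub>R x"] unfolding touching_def by (metis inner_scaleR_right times_divide_eq_right)
  moreover have "wulff_gauge h (c *\<^sub>R x) \<le> c * wulff_gauge h x"
    unfolding gauge_le_iff using gauge_upper_mult[of _ x] c by (auto simp: mult_left_mono mult_ac)
  ultimately show ?thesis by simp
qed

lemma gauge_lower_norm:
  assumes "\<And>v. v \<in> sphere 0 1 \<Longrightarrow> h v \<le> b" shows "norm x \<le> b * wulff_gauge h x"
proof (cases "x = 0")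
  case True
  then show ?thesis using gauge_scale[of 0 0] by simp
next
  case False
  define u where "u = x /\<^sub>R norm x"
  have u: "u \<in> sphere 0 1" "u \<bullet> x = norm x" using False by (auto simp: u_def power2_eq_square dot_square_norm)
  have "norm x \<le> h u * wulff_gauge h x" using gauge_upper_mult[OF u(1), of x] u by simp
  also have "\<dots> \<le> b * wulff_gauge h x"
    using assms[OF u(1)] \<open>norm x \<le> h u * wulff_gauge h x\<close> pos_cont_pos[OF u(1)] False
    by (intro mult_right_mono) (auto simp: zero_less_mult_iff dest!: less_le_trans[rotated, of "norm x" _ 0])
  finally show ?thesis .
qed

lemma gauge_upper_norm:
  assumes "0 < a" "\<And>v. v \<in> sphere 0 1 \<Longrightarrow> a \<le> h v" shows "wulff_gauge h x \<le> norm x / a"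
proof -
  have "v \<bullet> x \<le> norm x / a * h v" if "v \<in> sphere 0 1" for v
  proof -
    have "v \<bullet> x \<le> norm x" using norm_cauchy_schwarz[of v x] that by simp
    also have "\<dots> = norm x / a * a" using assms by simp
    also have "\<dots> \<le> norm x / a * h v" using assms that by (intro mult_left_mono) auto
    finally show ?thesis .
  qed
  then show ?thesis by (simp add: gauge_le_iff)
qed

lemma gauge_nonneg: "0 \<le> wulff_gauge h x"
proof -
  obtain a b where ab: "0 < a" "\<And>v. v \<in> sphere 0 1 \<Longrightarrow> a \<le> h v" "\<And>v. v \<in> sphere 0 1 \<Longrightarrow> h v \<le> b"
    by (rule pos_cont_bounds[OF h]) blast
  obtain v :: 'a where "v \<in> sphere 0 1" using sphere_nonempty by blast
  then have "0 < b" using ab by (meson less_le_trans order_trans)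
  have "0 \<le> norm x" by simp
  also have "\<dots> \<le> b * wulff_gauge h x" by (rule gauge_lower_norm) (rule ab)
  finally show ?thesis using \<open>0 < b\<close> by (simp add: zero_le_mult_iff)
qed

lemma gauge_pos: "x \<noteq> 0 \<Longrightarrow> 0 < wulff_gauge h x"
proof -
  assume "x \<noteq> 0"
  obtain b where ab: "\<And>v. v \<in> sphere 0 1 \<Longrightarrow> h v \<le> b"
    by (rule pos_cont_bounds[OF h]) blast
  have "norm x \<le> b * wulff_gauge h x" by (rule gauge_lower_norm) (rule ab)
  then show ?thesis using \<open>x \<noteq> 0\<close> gauge_nonneg[of x] by (cases "wulff_gauge h x = 0") auto
qed

lemma gauge_triangle: "wulff_gauge h (x + y) \<le> wulff_gauge h x + wulff_gauge h y"
  unfolding gauge_le_iff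
proof
  fix v :: 'a assume "v \<in> sphere 0 1"
  then show "v \<bullet> (x + y) \<le> (wulff_gauge h x + wulff_gauge h y) * h v"
    using gauge_upper_mult[of v x] gauge_upper_mult[of v y] by (simp add: algebra_simps inner_add_right)
qed

lemma continuous_gauge: "continuous_on A (wulff_gauge h)"
proof -
  obtain a b where ab: "0 < a" "\<And>v. v \<in> sphere 0 1 \<Longrightarrow> a \<le> h v" "\<And>v. v \<in> sphere 0 1 \<Longrightarrow> h v \<le> b"
    by (rule pos_cont_bounds[OF h]) blast
  have *: "wulff_gauge h x - wulff_gauge h y \<le> norm (x - y) / a" for x y
    using gauge_triangle[of y "x - y"] gauge_upper_norm[of a "x - y"] ab by simp
  have "\<bar>wulff_gauge h x - wulff_gauge h y\<bar> \<le> norm (x - y) / a" for x y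
    using *[of x y] *[of y x] by (simp add: norm_minus_commute abs_le_iff)
  then have "(1/a)-lipschitz_on A (wulff_gauge h)"
    using ab by (intro lipschitz_onI) (auto simp: dist_norm)
  then show ?thesis by (rule lipschitz_on_continuous_on)
qed

lemma wulff_iff: "x \<in> wulff h \<longleftrightarrow> wulff_gauge h x \<le> 1"
  by (simp add: gauge_le_iff wulff_def)

lemma radial_wulff: "u \<in> sphere 0 1 \<Longrightarrow> radial_fun (wulff h) u = 1 / wulff_gauge h u"
proof -
  assume "u \<in> sphere 0 1"
  then have p: "0 < wulff_gauge h u" by (intro gauge_pos) auto
  have "{r. 0 \<le> r \<and> r *\<^sub>R u \<in> wulff h} = {0..1 / wulff_gauge h u}"
    using p by (auto simp: wulff_iff gauge_scale field_simps)
  then show ?thesis using p by (simp add: radial_fun_def)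
qed

lemma wulff_convex_body: "wulff h \<in> convex_bodies_o"
proof -
  obtain a b where ab: "0 < a" "\<And>v. v \<in> sphere 0 1 \<Longrightarrow> a \<le> h v" "\<And>v. v \<in> sphere 0 1 \<Longrightarrow> h v \<le> b"
    by (rule pos_cont_bounds[OF h]) blast
  have eq: "wulff h = (\<Inter>v\<in>sphere 0 1. {x. v \<bullet> x \<le> h v})" by (auto simp: wulff_def)
  have "closed (wulff h)" "convex (wulff h)"
    unfolding eq by (auto intro!: closed_INT convex_INT closed_halfspace_le convex_halfspace_le)
  moreover have "bounded (wulff h)"
  proof (rule boundedI)
    fix x assume "x \<in> wulff h"
    then have g: "wulff_gauge h x \<le> 1" by (simp add: wulff_iff)
    have "norm x \<le> b * wulff_gauge h x" by (rule gauge_lower_norm) (rule ab)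
    also have "\<dots> \<le> \<bar>b\<bar> * 1" using g gauge_nonneg[of x] by (intro mult_mono) auto
    finally show "norm x \<le> \<bar>b\<bar>" by simp
  qed
  moreover have "ball 0 a \<subseteq> wulff h"
  proof
    fix x :: 'a assume "x \<in> ball 0 a"
    then have "wulff_gauge h x \<le> 1"
      using gauge_upper_norm[OF ab(1,2), of x] ab(1) by (auto simp: divide_le_eq intro: order_trans)
    then show "x \<in> wulff h" by (simp add: wulff_iff)
  qed
  then have "0 \<in> interior (wulff h)" using ab(1) by (auto simp: mem_interior)
  ultimately show ?thesis by (auto simp: convex_bodies_o_def compact_eq_bounded_closed)
qed

lemma support_wulff_le: "v \<in> sphere 0 1 \<Longrightarrow> support_fun (wulff h) v \<le> h v"
  unfolding support_fun_def
proof (rule cSUP_least)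
  show "wulff h \<noteq> {}" using wulff_convex_body interior_subset by (fastforce simp: convex_bodies_o_def)
qed (auto simp: wulff_def)

end

lemma support_upper:
  assumes "K \<in> convex_bodies_o" "x \<in> K" shows "v \<bullet> x \<le> support_fun K v"
proof -
  have "bounded ((\<lambda>x. v \<bullet> x) ` K)"
    using assms(1) by (intro bounded_linear_image bounded_linear_inner_right)
      (auto simp: convex_bodies_o_def compact_imp_bounded)
  then show ?thesis
    unfolding support_fun_def using assms(2) by (intro cSUP_upper bounded_imp_bdd_above)
qed

lemma support_least:
  assumes "K \<in> convex_bodies_o" "\<And>x. x \<in> K \<Longrightarrow> v \<bullet> x \<le> c" shows "support_fun K v \<le> c"
  unfolding support_fun_def
  by (rule cSUP_least) (use assms interior_subset in \<open>fastforce simp: convex_bodies_o_def\<close>)+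

lemma support_lipschitz:
  assumes "K \<in> convex_bodies_o" "\<And>x. x \<in> K \<Longrightarrow> norm x \<le> R"
  shows "\<bar>support_fun K v - support_fun K w\<bar> \<le> R * norm (v - w)"
proof -
  have *: "support_fun K v \<le> support_fun K w + R * norm (v - w)" for v w
  proof (rule support_least[OF assms(1)])
    fix x assume x: "x \<in> K"
    have "v \<bullet> x = w \<bullet> x + (v - w) \<bullet> x" by (simp add: inner_diff_left)
    also have "\<dots> \<le> support_fun K w + norm (v - w) * norm x"
      by (intro add_mono support_upper[OF assms(1) x] norm_cauchy_schwarz)
    also have "norm (v - w) * norm x \<le> norm (v - w) * R" by (intro mult_left_mono assms(2) x) simp
    finally show "v \<bullet> x \<le> support_fun K w + R * norm (v - w)" by (simp add: mult.commute)
  qed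
  show ?thesis using *[of v w] *[of w v] by (simp add: norm_minus_commute abs_le_iff)
qed

lemma pos_cont_support:
  assumes K: "K \<in> convex_bodies_o" shows "pos_cont (support_fun K)"
proof -
  obtain R where R: "\<And>x. x \<in> K \<Longrightarrow> norm x \<le> R"
    using K compact_imp_bounded[of K] unfolding convex_bodies_o_def bounded_iff by blast
  obtain e where e: "0 < e" "ball 0 e \<subseteq> K"
    using K by (auto simp: convex_bodies_o_def mem_interior)
  have "R-lipschitz_on (sphere 0 1) (support_fun K)"
  proof (rule lipschitz_onI)
    have "0 \<in> K" using e by auto
    then show "0 \<le> R" using R by (metis norm_zero)
  qed (use support_lipschitz[OF K R] in \<open>simp add: dist_norm\<close>)
  moreover have "0 < support_fun K v" if "v \<in> sphere 0 1" for v
  proof -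
    have "(e/2) *\<^sub>R v \<in> K" using e that by auto
    from support_upper[OF K this, of v] show ?thesis using e that by (simp add: dot_square_norm)
  qed
  ultimately show ?thesis by (simp add: pos_cont_def lipschitz_on_continuous_on)
qed

text \<open>
  \<open>h\<close> may be strictly larger than the support function of its Wulff shape; the shape does not
  notice, and the gauge is determined by the shape.
\<close>

lemma wulff_support_wulff:
  assumes h: "pos_cont h"
  shows "wulff (support_fun (wulff h)) = wulff h"
    and "wulff_gauge (support_fun (wulff h)) x = wulff_gauge h x"
proof -
  have K: "wulff h \<in> convex_bodies_o" by (rule wulff_convex_body[OF h])
  note s = pos_cont_support[OF K]
  show eq: "wulff (support_fun (wulff h)) = wulff h"
    using support_wulff_le[OF h] support_upper[OF K] by (force simp: wulff_def)
  have "wulff_gauge h1 x \<le> wulff_gauge h2 x" if "pos_cont h1" "pos_cont h2" "wulff h1 = wulff h2" for h1 h2 :: "'a \<Rightarrow> real"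
  proof (cases "x = 0")
    case True then show ?thesis using gauge_scale[OF that(1), of 0 0] gauge_scale[OF that(2), of 0 0] by simp
  next
    case False
    then have p: "0 < wulff_gauge h2 x" by (rule gauge_pos[OF that(2)])
    then have "wulff_gauge h2 ((1 / wulff_gauge h2 x) *\<^sub>R x) = 1"
      by (subst gauge_scale[OF that(2)]) auto
    then have "(1 / wulff_gauge h2 x) *\<^sub>R x \<in> wulff h1" by (simp add: that(3) wulff_iff[OF that(2)])
    then have "wulff_gauge h1 ((1 / wulff_gauge h2 x) *\<^sub>R x) \<le> 1" by (simp add: wulff_iff[OF that(1)])
    then show ?thesis using p by (subst (asm) gauge_scale[OF that(1)]) (auto simp: field_simps)
  qed
  then show "wulff_gauge (support_fun (wulff h)) x = wulff_gauge h x"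
    using s h eq by (intro antisym) auto
qed

lemma outer_normal_iff_touching:
  assumes h: "pos_cont h" and supp: "\<And>v. v \<in> sphere 0 1 \<Longrightarrow> support_fun (wulff h) v = h v"
    and u: "u \<in> sphere 0 1"
  shows "outer_normal_at (wulff h) u v \<longleftrightarrow> touching h u v"
proof -
  have "0 < wulff_gauge h u" using u by (intro gauge_pos[OF h]) auto
  then show ?thesis
    using u supp[of v] pos_cont_pos[OF h, of v]
    by (auto simp: outer_normal_at_def touching_def radial_wulff[OF h] field_simps)
qed

lemma uminus_image_wulff:
  assumes "\<And>v. v \<in> sphere 0 1 \<Longrightarrow> h (- v) = h v"
  shows "uminus ` wulff h = wulff h"
proof -
  have *: "- x \<in> wulff h" if x: "x \<in> wulff h" for x
  proof -
    have "v \<bullet> - x \<le> h v" if v: "v \<in> sphere 0 1" for v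
    proof -
      have "- v \<in> sphere 0 1" using v by simp
      then have "- v \<bullet> x \<le> h (- v)" using x unfolding wulff_def by blast
      then show ?thesis using assms[OF v] by simp
    qed
    then show ?thesis by (simp add: wulff_def)
  qed
  then show ?thesis by (force simp: image_iff)
qed

lemma support_uminus:
  assumes "uminus ` K = K" shows "support_fun K (- v) = support_fun K v"
proof -
  have "(\<lambda>x. - v \<bullet> x) ` K = (\<lambda>x. v \<bullet> x) ` (uminus ` K)" by (simp add: image_image)
  then show ?thesis unfolding support_fun_def by (simp add: assms)
qed

lemma gauge_comparison:
  assumes h1: "pos_cont h1" and h2: "pos_cont h2"
    and le: "\<And>v. v \<in> sphere 0 1 \<Longrightarrow> h1 v \<le> c * h2 v"
  shows "wulff_gauge h2 x \<le> c * wulff_gauge h1 x"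
  unfolding gauge_le_iff[OF h2]
proof
  fix v :: 'a assume v: "v \<in> sphere 0 1"
  have "v \<bullet> x \<le> h1 v * wulff_gauge h1 x" by (rule gauge_upper_mult[OF h1 v])
  also have "\<dots> \<le> c * h2 v * wulff_gauge h1 x"
    by (intro mult_right_mono le v gauge_nonneg[OF h1])
  finally show "v \<bullet> x \<le> c * wulff_gauge h1 x * h2 v" by (simp add: mult_ac)
qed

text \<open>
  \<open>\<bar>h1 - h2\<bar> \<le> e\<close> gives \<open>h1 \<le> (1 + e / r) h2\<close> and conversely; such multiplicative bounds pass to
  the gauges.
\<close>

lemma gauge_diff_bound:
  assumes h1: "pos_cont h1" and h2: "pos_cont h2" and r: "0 < r"
    and r1: "\<And>v. v \<in> sphere 0 1 \<Longrightarrow> r \<le> h1 v" and r2: "\<And>v. v \<in> sphere 0 1 \<Longrightarrow> r \<le> h2 v"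
    and e: "\<And>v. v \<in> sphere 0 1 \<Longrightarrow> \<bar>h1 v - h2 v\<bar> \<le> e" and u: "u \<in> sphere 0 1"
  shows "\<bar>wulff_gauge h1 u - wulff_gauge h2 u\<bar> \<le> e / r\<^sup>2"
proof -
  have *: "wulff_gauge k2 u - wulff_gauge k1 u \<le> e / r\<^sup>2"
    if k1: "pos_cont k1" and k2: "pos_cont k2" and rk1: "\<And>v. v \<in> sphere 0 1 \<Longrightarrow> r \<le> k1 v"
      and rk2: "\<And>v. v \<in> sphere 0 1 \<Longrightarrow> r \<le> k2 v"
      and ek: "\<And>v. v \<in> sphere 0 1 \<Longrightarrow> \<bar>k1 v - k2 v\<bar> \<le> e" for k1 k2
  proof -
    have e0: "0 \<le> e" using ek[OF u] by simp
    have "k1 v \<le> (1 + e / r) * k2 v" if v: "v \<in> sphere 0 1" for v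
    proof -
      have "k1 v \<le> k2 v + e" using ek[OF v] by (simp add: abs_le_iff)
      also have "e = e / r * r" using r by simp
      also have "\<dots> \<le> e / r * k2 v" using e0 r by (intro mult_left_mono rk2 v) simp
      finally show ?thesis by (simp add: algebra_simps)
    qed
    then have "wulff_gauge k2 u \<le> (1 + e / r) * wulff_gauge k1 u" by (rule gauge_comparison[OF k1 k2])
    then have "wulff_gauge k2 u - wulff_gauge k1 u \<le> e / r * wulff_gauge k1 u"
      by (simp add: distrib_right)
    also have "\<dots> \<le> e / r * (norm u / r)"
      using e0 r by (intro mult_left_mono gauge_upper_norm[OF k1 r rk1]) auto
    also have "\<dots> = e / r\<^sup>2" using u by (simp add: power2_eq_square)
    finally show ?thesis .
  qed
  have e': "\<bar>h2 v - h1 v\<bar> \<le> e" if "v \<in> sphere 0 1" for v using e[OF that] by (simp add: abs_minus_commute)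
  have "wulff_gauge h2 u - wulff_gauge h1 u \<le> e / r\<^sup>2" by (rule *[OF h1 h2 r1 r2 e])
  moreover have "wulff_gauge h1 u - wulff_gauge h2 u \<le> e / r\<^sup>2" by (rule *[OF h2 h1 r2 r1 e'])
  ultimately show ?thesis by (simp add: abs_le_iff)
qed

lemma gauge_pos_sphere: "pos_cont h \<Longrightarrow> u \<in> sphere 0 1 \<Longrightarrow> 0 < wulff_gauge h u"
  by (rule gauge_pos) auto

lemma radial_pos: "pos_cont h \<Longrightarrow> u \<in> sphere 0 1 \<Longrightarrow> 0 < 1 / wulff_gauge h u"
  using gauge_pos_sphere[of h u] by simp

lemma continuous_radial: "pos_cont h \<Longrightarrow> continuous_on (sphere 0 1) (\<lambda>u. 1 / wulff_gauge h u)"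
  using gauge_pos_sphere[of h] by (intro continuous_intros continuous_gauge) fastforce+

lemma radial_in_Icc:
  assumes h: "pos_cont h" and "0 < a" "\<And>v. v \<in> sphere 0 1 \<Longrightarrow> a \<le> h v" "\<And>v. v \<in> sphere 0 1 \<Longrightarrow> h v \<le> b"
    and u: "u \<in> sphere 0 1"
  shows "1 / wulff_gauge h u \<in> {a..b}"
proof -
  have p: "0 < wulff_gauge h u" using radial_pos[OF h u] by simp
  have "wulff_gauge h u \<le> norm u / a" by (rule gauge_upper_norm[OF h assms(2,3)])
  moreover have "norm u \<le> b * wulff_gauge h u" by (rule gauge_lower_norm[OF h assms(4)])
  ultimately show ?thesis using u p \<open>0 < a\<close> by (simp add: field_simps)
qed

text \<open>
  \<open>R\<close> bounds the norm on the Wulff shape, which is the Lipschitz constant of the support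
  function; it is what makes bounded families of support functions equicontinuous.
\<close>

lemma support_wulff_lipschitz:
  fixes h :: "'a::euclidean_space \<Rightarrow> real"
  assumes h: "pos_cont h" "\<And>v. v \<in> sphere 0 1 \<Longrightarrow> h v \<le> R"
  shows "\<bar>support_fun (wulff h) v - support_fun (wulff h) w\<bar> \<le> R * norm (v - w)"
proof (rule support_lipschitz[OF wulff_convex_body[OF h(1)]])
  fix x assume "x \<in> wulff h"
  then have g: "wulff_gauge h x \<le> 1" by (simp add: wulff_iff[OF h(1)])
  obtain u :: 'a where u: "u \<in> sphere 0 1" using sphere_nonempty by blast
  have "0 < R" using pos_cont_pos[OF h(1) u] h(2)[OF u] by simp
  have "norm x \<le> R * wulff_gauge h x" by (rule gauge_lower_norm[OF h])
  also have "\<dots> \<le> R * 1" using g \<open>0 < R\<close> by (intro mult_left_mono) auto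
  finally show "norm x \<le> R" by simp
qed

lemma gauge_even:
  assumes h: "pos_cont h" and ev: "\<And>v. h (- v) = h v"
  shows "wulff_gauge h (- x) = wulff_gauge h x"
proof -
  have *: "wulff_gauge h (- x) \<le> wulff_gauge h x" for x
    unfolding gauge_le_iff[OF h]
  proof
    fix v :: 'a assume "v \<in> sphere 0 1"
    then have "- v \<in> sphere 0 1" by simp
    from gauge_upper_mult[OF h this, of x] show "v \<bullet> - x \<le> wulff_gauge h x * h v" by (simp add: ev mult.commute)
  qed
  show ?thesis using *[of x] *[of "- x"] by simp
qed

lemma touching_even:
  assumes h: "pos_cont h" and ev: "\<And>v. h (- v) = h v" and "touching h x v"
  shows "touching h (- x) (- v)"
  using assms(3) by (simp add: touching_def ev gauge_even[OF h ev])

section \<open>Almost everywhere uniqueness of normals\<close>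

text \<open>
  By Tonelli, the average of the measures of the translates \<open>T - s e\<close> over \<open>0 \<le> s \<le> 1\<close> is the
  integral over \<open>x\<close> of the length of \<open>{s. x + s e \<in> T}\<close>, which is zero. All translates have the
  measure of \<open>T\<close>.
\<close>

lemma negligible_of_countable_lines:
  fixes T :: "'a::euclidean_space set"
  assumes T: "closed T" and lines: "\<And>x. countable {s::real. x + s *\<^sub>R e \<in> T}"
  shows "negligible T"
proof -
  have [measurable]: "T \<in> sets borel" using T by simp
  have meas: "(\<lambda>(s, x). indicator {0..1::real} s * indicator T (x + s *\<^sub>R e) :: ennreal) \<in> borel_measurable (lborel \<Otimes>\<^sub>M lborel)"
    by measurable
  have "emeasure lborel T = (\<integral>\<^sup>+s. indicator {0..1::real} s * emeasure lborel T \<partial>lborel)"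
    by (subst nn_integral_multc) auto
  also have "\<dots> = (\<integral>\<^sup>+s. \<integral>\<^sup>+x. indicator {0..1::real} s * indicator T (x + s *\<^sub>R e) \<partial>lborel \<partial>lborel)"
  proof (rule nn_integral_cong)
    fix s :: real
    have "emeasure lborel T = (\<integral>\<^sup>+x. indicator T x \<partial>distr lborel borel ((+) (s *\<^sub>R e)))"
      by (simp add: lborel_distr_plus)
    also have "\<dots> = (\<integral>\<^sup>+x. indicator T (x + s *\<^sub>R e) \<partial>lborel)"
      by (subst nn_integral_distr) (auto simp: add.commute)
    finally show "indicator {0..1} s * emeasure lborel T = (\<integral>\<^sup>+x. indicator {0..1} s * indicator T (x + s *\<^sub>R e) \<partial>lborel)"
      by (subst nn_integral_cmult) auto
  qed
  also have "\<dots> = (\<integral>\<^sup>+x. \<integral>\<^sup>+s. indicator {0..1::real} s * indicator T (x + s *\<^sub>R e) \<partial>lborel \<partial>lborel)"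
    using lborel_pair.Fubini'[OF meas] by simp
  also have "\<dots> = (\<integral>\<^sup>+(x::'a). 0 \<partial>lborel)"
  proof (rule nn_integral_cong)
    fix x :: 'a
    have "(\<integral>\<^sup>+s. indicator {0..1::real} s * indicator T (x + s *\<^sub>R e) \<partial>lborel) = (\<integral>\<^sup>+(s::real). 0 \<partial>lborel)"
    proof (rule nn_integral_cong_AE)
      have "AE s in lborel. s \<notin> {s. x + s *\<^sub>R e \<in> T}"
        by (rule AE_not_in) (rule countable_imp_null_set_lborel[OF lines])
      then show "AE s in lborel. indicator {0..1::real} s * indicator T (x + s *\<^sub>R e) = (0::ennreal)"
        by (rule AE_mp) auto
    qed
    then show "(\<integral>\<^sup>+s. indicator {0..1::real} s * indicator T (x + s *\<^sub>R e) \<partial>lborel) = 0" by simp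
  qed
  finally have "T \<in> null_sets lborel" by (simp add: null_sets_def)
  then show ?thesis by (simp add: negligible_iff_null_sets null_sets_completionI)
qed

text \<open>
  The set is the projection along the compact factor \<open>C\<close> of a closed set of triples. The
  diagonal gives the statement for a single touching direction, and sets of pairs with distinct
  slopes describe the kinks of the gauge.
\<close>

lemma closed_touching_pairs:
  fixes h :: "'a::euclidean_space \<Rightarrow> real"
  assumes h: "pos_cont h" "closed C" "C \<subseteq> sphere 0 1 \<times> sphere 0 1"
  shows "closed {x. \<exists>p\<in>C. touching h x (fst p) \<and> touching h x (snd p)}"
proof -
  have hc: "continuous_on (sphere 0 1) h" and hp: "\<And>v. v \<in> sphere 0 1 \<Longrightarrow> h v \<noteq> 0"
    using h(1) by (auto simp: pos_cont_def less_imp_neq[THEN not_sym])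
  let ?D = "C \<times> (UNIV :: 'a set)"
  let ?f = "\<lambda>z :: ('a \<times> 'a) \<times> 'a. (fst (fst z) \<bullet> snd z) / h (fst (fst z)) - wulff_gauge h (snd z)"
  let ?g = "\<lambda>z :: ('a \<times> 'a) \<times> 'a. (snd (fst z) \<bullet> snd z) / h (snd (fst z)) - wulff_gauge h (snd z)"
  have D: "closed ?D" using h by (intro closed_Times) auto
  have im: "(\<lambda>z. fst (fst z)) ` ?D \<subseteq> sphere 0 1" "(\<lambda>z. snd (fst z)) ` ?D \<subseteq> sphere 0 1"
    using h(3) by auto
  have cg: "continuous_on ?D (\<lambda>z. wulff_gauge h (snd z))"
    by (rule continuous_on_compose2[OF continuous_gauge[OF h(1), of UNIV]]) (auto intro!: continuous_intros)
  have c1: "continuous_on ?D (\<lambda>z. h (fst (fst z)))" and c2: "continuous_on ?D (\<lambda>z. h (snd (fst z)))"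
    by (rule continuous_on_compose2[OF hc _ im(1)] continuous_on_compose2[OF hc _ im(2)]; intro continuous_intros)+
  have fg: "continuous_on ?D ?f" "continuous_on ?D ?g"
    using h(3) hp by (intro continuous_intros cg c1 c2; force)+
  have "closed ({z \<in> ?D. ?f z = 0} \<inter> {z \<in> ?D. ?g z = 0})"
    by (intro closed_Int continuous_closed_preimage_constant fg D)
  moreover have "compact C"
    using compact_Int_closed[OF compact_Times[OF compact_sphere compact_sphere] h(2), of 0 1 0 1] h(3)
    by (simp add: Int_absorb1)
  ultimately have "closed {y. \<exists>x. x \<in> C \<and> (x, y) \<in> {z \<in> ?D. ?f z = 0} \<inter> {z \<in> ?D. ?g z = 0}}"
    by (intro closed_compact_projection)
  also have "{y. \<exists>x. x \<in> C \<and> (x, y) \<in> {z \<in> ?D. ?f z = 0} \<inter> {z \<in> ?D. ?g z = 0}}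
      = {x. \<exists>p\<in>C. touching h x (fst p) \<and> touching h x (snd p)}"
  proof -
    have "fst p \<in> sphere 0 1 \<and> snd p \<in> sphere 0 1" if "p \<in> C" for p using h(3) that by auto
    then show ?thesis unfolding touching_def Bex_def by (intro Collect_cong ex_cong1) auto
  qed
  finally show ?thesis .
qed

lemma closed_touching_set:
  fixes h :: "'a::euclidean_space \<Rightarrow> real"
  assumes "pos_cont h" "closed F" "F \<subseteq> sphere 0 1"
  shows "closed {x. \<exists>v\<in>F. touching h x v}"
proof -
  have "compact F" using compact_Int_closed[OF compact_sphere assms(2), of 0 1] assms(3) by (simp add: Int_absorb1)
  then have "closed ((\<lambda>v. (v, v)) ` F)"
    by (intro compact_imp_closed compact_continuous_image continuous_intros)
  from closed_touching_pairs[OF assms(1) this] show ?thesis using assms(3) by auto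
qed

text \<open>
  On the line the gauge is a convex function of \<open>s\<close>, and each touching \<open>v\<close> gives it a
  subgradient \<open>(v \<bullet> e) / h v\<close>. Subgradients increase with \<open>s\<close>, and at each of the points in
  question they increase by at least \<open>d\<close>. Hence \<open>\<lfloor>b s / d\<rfloor>\<close> takes different values at different
  points.
\<close>

lemma countable_kinks_on_line:
  fixes h :: "'a::euclidean_space \<Rightarrow> real"
  assumes h: "pos_cont h" and "0 < d"
  shows "countable {s. \<exists>v w. touching h (x + s *\<^sub>R e) v \<and> touching h (x + s *\<^sub>R e) w \<and>
     d \<le> (w \<bullet> e) / h w - (v \<bullet> e) / h v}" (is "countable ?S")
proof -
  have "\<forall>s\<in>?S. \<exists>p. touching h (x + s *\<^sub>R e) (fst p) \<and> touching h (x + s *\<^sub>R e) (snd p) \<and>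
     d \<le> (snd p \<bullet> e) / h (snd p) - (fst p \<bullet> e) / h (fst p)" by simp
  from bchoice[OF this] obtain p where p: "\<forall>s\<in>?S. touching h (x + s *\<^sub>R e) (fst (p s)) \<and>
     touching h (x + s *\<^sub>R e) (snd (p s)) \<and>
     d \<le> (snd (p s) \<bullet> e) / h (snd (p s)) - (fst (p s) \<bullet> e) / h (fst (p s))" ..
  define v where "v s = fst (p s)" for s
  define w where "w s = snd (p s)" for s
  have vw: "touching h (x + s *\<^sub>R e) (v s)" "touching h (x + s *\<^sub>R e) (w s)"
    "d \<le> (w s \<bullet> e) / h (w s) - (v s \<bullet> e) / h (v s)" if "s \<in> ?S" for s
    using bspec[OF p that] by (simp_all only: v_def w_def)
  define q where "q s = wulff_gauge h (x + s *\<^sub>R e)" for s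
  define b where "b s = (v s \<bullet> e) / h (v s)" for s
  have sub: "q s + (t - s) * ((u \<bullet> e) / h u) \<le> q t" if "touching h (x + s *\<^sub>R e) u" for s t u
  proof -
    have u: "u \<in> sphere 0 1" "(u \<bullet> (x + s *\<^sub>R e)) / h u = q s" using that by (auto simp: touching_def q_def)
    have "x + t *\<^sub>R e = (x + s *\<^sub>R e) + (t - s) *\<^sub>R e" by (simp add: algebra_simps)
    then have "u \<bullet> (x + t *\<^sub>R e) = u \<bullet> (x + s *\<^sub>R e) + (t - s) * (u \<bullet> e)"
      by (simp only: inner_add_right inner_scaleR_right)
    then have "(u \<bullet> (x + t *\<^sub>R e)) / h u = q s + (t - s) * ((u \<bullet> e) / h u)"
      by (simp only: add_divide_distrib u(2) times_divide_eq_right)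
    then show ?thesis using gauge_upper[OF h u(1), of "x + t *\<^sub>R e"] by (simp add: q_def)
  qed
  have step: "b s + d \<le> b t" if "s \<in> ?S" "t \<in> ?S" "s < t" for s t
  proof -
    have "q s + (t - s) * (b s + d) \<le> q s + (t - s) * ((w s \<bullet> e) / h (w s))"
      using vw(3)[OF that(1)] that(3) by (intro add_left_mono mult_left_mono) (auto simp: b_def)
    also have "\<dots> \<le> q t" by (rule sub[OF vw(2)[OF that(1)]])
    also have "q t \<le> q s - (s - t) * b t" using sub[OF vw(1)[OF that(2)], of s] by (simp add: b_def)
    finally have "(t - s) * (b s + d) \<le> (t - s) * b t" by (simp add: algebra_simps)
    then show ?thesis using that(3) by simp
  qed
  have "inj_on (\<lambda>s. \<lfloor>b s / d\<rfloor>) ?S"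
  proof (rule linorder_inj_onI)
    fix s t assume "s \<in> ?S" "t \<in> ?S" "s < t"
    then have "(b s + d) / d \<le> b t / d" using \<open>0 < d\<close> by (intro divide_right_mono step) auto
    then have "b s / d + 1 \<le> b t / d" using \<open>0 < d\<close> by (simp add: add_divide_distrib)
    then show "\<lfloor>b s / d\<rfloor> \<noteq> \<lfloor>b t / d\<rfloor>" by linarith
  qed auto
  then show ?thesis by (rule countable_image_inj_on[OF countableI_type])
qed

definition unique_touching :: "('a::euclidean_space \<Rightarrow> real) \<Rightarrow> 'a \<Rightarrow> bool" where
  "unique_touching h u \<longleftrightarrow> (\<exists>!v. touching h u v)"

text \<open>
  Two touching directions \<open>v \<noteq> w\<close> give different points \<open>v / h v\<close> and \<open>w / h w\<close>, because \<open>v\<close> and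
  \<open>w\<close> have norm 1. So they differ in a coordinate \<open>e\<close>, and the gauge has a kink in direction \<open>e\<close>
  at every point of the ray. The set \<open>T e n\<close> collects the kinks of size at least \<open>1 / (n + 1)\<close>;
  it is closed, which gives the measurability needed for Tonelli.
\<close>

lemma null_not_unique_touching:
  fixes h :: "'a::euclidean_space \<Rightarrow> real"
  assumes h: "pos_cont h"
  shows "{u \<in> sphere 0 1. \<not> unique_touching h u} \<in> null_sets sphere_measure"
proof (rule null_sets_sphere_measure_cone)
  define C where "C e n = {p \<in> sphere 0 1 \<times> sphere (0::'a) 1.
     1 / real (Suc n) \<le> (snd p \<bullet> e) / h (snd p) - (fst p \<bullet> e) / h (fst p)}" for e n
  define T where "T e n = {x. \<exists>p\<in>C e n. touching h x (fst p) \<and> touching h x (snd p)}" for e n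
  have hc: "continuous_on (sphere 0 1) h" and hp: "\<And>v. v \<in> sphere 0 1 \<Longrightarrow> h v \<noteq> 0"
    using h by (auto simp: pos_cont_def less_imp_neq[THEN not_sym])
  have clC: "closed (C e n)" for e n
  proof -
    let ?D = "sphere 0 1 \<times> sphere (0::'a) 1"
    have c1: "continuous_on ?D (\<lambda>z. h (fst z))" and c2: "continuous_on ?D (\<lambda>z. h (snd z))"
      by (rule continuous_on_compose2[OF hc]; auto intro!: continuous_intros)+
    have "continuous_on ?D (\<lambda>p. (snd p \<bullet> e) / h (snd p) - (fst p \<bullet> e) / h (fst p))"
      using hp by (intro continuous_intros c1 c2) auto
    from continuous_closed_preimage[OF this closed_Times[OF closed_sphere closed_sphere]
        closed_atLeast[of "1 / real (Suc n)"]]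
    have "closed (?D \<inter> (\<lambda>p. (snd p \<bullet> e) / h (snd p) - (fst p \<bullet> e) / h (fst p)) -` {1 / real (Suc n)..})" .
    also have "?D \<inter> (\<lambda>p. (snd p \<bullet> e) / h (snd p) - (fst p \<bullet> e) / h (fst p)) -` {1 / real (Suc n)..} = C e n"
      unfolding C_def vimage_def Int_def by (intro Collect_cong) (simp only: mem_Collect_eq atLeast_iff)
    finally show ?thesis .
  qed
  have neg: "negligible (T e n)" for e n
  proof (rule negligible_of_countable_lines[of _ e])
    have "C e n \<subseteq> sphere 0 1 \<times> sphere 0 1" unfolding C_def by blast
    then show "closed (T e n)" unfolding T_def by (rule closed_touching_pairs[OF h clC])
    fix x
    show "countable {s. x + s *\<^sub>R e \<in> T e n}"
      by (rule countable_subset[OF _ countable_kinks_on_line[OF h, of "1 / real (Suc n)" x e]])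
         (auto simp: T_def C_def)
  qed
  have "negligible (\<Union>e\<in>Basis. \<Union>n. T e n)"
    by (intro negligible_Union_nat negligible_Union) (auto intro!: negligible_Union_nat neg)
  then show "negligible {r *\<^sub>R u |r u. u \<in> {u \<in> sphere 0 1. \<not> unique_touching h u} \<and> 1 \<le> r \<and> r \<le> 2}"
  proof (rule negligible_subset, safe)
    fix r :: real and u :: 'a assume u: "u \<in> sphere 0 1" "\<not> unique_touching h u" "1 \<le> r"
    then obtain v w where vw: "touching h u v" "touching h u w" "v \<noteq> w"
      using touching_exists[OF h] unfolding unique_touching_def by metis
    then have sph: "v \<in> sphere 0 1" "w \<in> sphere 0 1" by (auto simp: touching_def)
    have "v /\<^sub>R h v \<noteq> w /\<^sub>R h w"
    proof
      assume eq: "v /\<^sub>R h v = w /\<^sub>R h w"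
      then have "norm (v /\<^sub>R h v) = norm (w /\<^sub>R h w)" by simp
      then have "h v = h w" using sph pos_cont_pos[OF h sph(1)] pos_cont_pos[OF h sph(2)] by simp
      then show False using eq vw(3) hp[OF sph(1)] by simp
    qed
    then obtain e :: 'a where e: "e \<in> Basis" "(v \<bullet> e) / h v \<noteq> (w \<bullet> e) / h w"
      by (auto simp: euclidean_eq_iff[where 'a='a] divide_inverse_commute)
    have tr: "touching h (r *\<^sub>R u) v" if "touching h u v" for v
      using that u(3) unfolding touching_def
      by (simp add: gauge_scale[OF h] flip: times_divide_eq_right)
    have in_T: "r *\<^sub>R u \<in> (\<Union>n. T e n)" if tv: "touching h u v" and tw: "touching h u w" and lt: "(v \<bullet> e) / h v < (w \<bullet> e) / h w" for v w
    proof -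
      obtain n where "1 / real (Suc n) < (w \<bullet> e) / h w - (v \<bullet> e) / h v"
        using reals_Archimedean[of "(w \<bullet> e) / h w - (v \<bullet> e) / h v"] lt by (auto simp: inverse_eq_divide)
      then have "(v, w) \<in> C e n" using tv tw by (auto simp: C_def touching_def)
      then have "r *\<^sub>R u \<in> T e n" using tr[OF tv] tr[OF tw] by (force simp: T_def)
      then show ?thesis by blast
    qed
    have "r *\<^sub>R u \<in> (\<Union>n. T e n)"
      using e(2) in_T[OF vw(1,2)] in_T[OF vw(2,1)] by (meson linorder_neq_iff)
    then show "r *\<^sub>R u \<in> (\<Union>e\<in>Basis. \<Union>n. T e n)" using e(1) by blast
  qed
qed auto

text \<open>
  A total version of the radial Gauss map. On the null set of non-unique normals it takes a
  fixed value on the sphere, so that it maps into the sphere everywhere and stays measurable.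
\<close>

definition normal_map :: "('a::euclidean_space \<Rightarrow> real) \<Rightarrow> 'a \<Rightarrow> 'a" where
  "normal_map h u = (if unique_touching h u then (THE v. touching h u v) else (SOME v. v \<in> sphere 0 1))"

lemma touching_normal_map: "unique_touching h u \<Longrightarrow> touching h u v \<longleftrightarrow> v = normal_map h u"
  unfolding normal_map_def unique_touching_def by (auto intro: the1_equality[symmetric] theI')

lemma normal_map_in_sphere: "normal_map h u \<in> sphere 0 1"
proof (cases "unique_touching h u")
  case True
  then show ?thesis using touching_normal_map[OF True, of "normal_map h u"] by (simp add: touching_def)
next
  case False
  moreover have "(SOME v. v \<in> sphere (0::'a) 1) \<in> sphere 0 1"
    by (rule someI_ex) (use sphere_nonempty in blast)
  ultimately show ?thesis by (simp only: normal_map_def if_False)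
qed

lemma AE_unique_touching:
  "pos_cont h \<Longrightarrow> AE u in sphere_measure. unique_touching (h :: 'a::euclidean_space \<Rightarrow> real) u"
  by (rule AE_I'[OF null_not_unique_touching]) auto

text \<open>
  Up to a null set the preimage of a closed set is a closed set of touching points.
\<close>

lemma measurable_normal_map:
  fixes h :: "'a::euclidean_space \<Rightarrow> real"
  assumes h: "pos_cont h"
  shows "normal_map h \<in> borel_measurable sphere_measure"
proof (rule borel_measurableI)
  have closed_case: "normal_map h -` F \<inter> sphere 0 1 \<in> sets sphere_measure" if F: "closed F" for F
  proof (rule sphere_measure_sets_modulo_null[OF null_not_unique_touching[OF h]])
    have "closed {u. \<exists>v\<in>F \<inter> sphere 0 1. touching h u v}"
      by (rule closed_touching_set[OF h]) (use F in auto)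
    then show "sphere 0 1 \<inter> {u. \<exists>v\<in>F \<inter> sphere 0 1. touching h u v} \<in> sets sphere_measure"
      by (intro borel_sets_sphere_measure borel_closed closed_Int) auto
    show "sphere 0 1 \<inter> {u. \<exists>v\<in>F \<inter> sphere 0 1. touching h u v} - {u \<in> sphere 0 1. \<not> unique_touching h u} =
      normal_map h -` F \<inter> sphere 0 1 - {u \<in> sphere 0 1. \<not> unique_touching h u}"
      using touching_normal_map[of h] normal_map_in_sphere[of h] by auto
  qed auto
  fix U :: "'a set" assume "open U"
  then have "sphere 0 1 - (normal_map h -` (- U) \<inter> sphere 0 1) \<in> sets sphere_measure"
    by (intro sets.Diff closed_case borel_sets_sphere_measure) auto
  also have "sphere 0 1 - (normal_map h -` (- U) \<inter> sphere 0 1) = normal_map h -` U \<inter> space sphere_measure"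
    by auto
  finally show "normal_map h -` U \<inter> space sphere_measure \<in> sets sphere_measure" .
qed

lemma measurable_continuous_normal_map:
  fixes f :: "'a::euclidean_space \<Rightarrow> real"
  assumes h: "pos_cont h" and f: "continuous_on (sphere 0 1) f"
  shows "(\<lambda>u. f (normal_map h u)) \<in> borel_measurable sphere_measure"
proof (rule measurable_compose[OF _ borel_measurable_continuous_on_restrict[OF f]])
  show "normal_map h \<in> measurable sphere_measure (restrict_space borel (sphere 0 1))"
    by (rule measurable_restrict_space2[OF _ measurable_normal_map[OF h]]) (use normal_map_in_sphere in blast)
qed

lemma normal_map_uminus:
  assumes h: "pos_cont h" and ev: "\<And>v. h (- v) = h v" and u: "unique_touching h u"
  shows "normal_map h (- u) = - normal_map h u"
proof -
  have t: "touching h (- u) (- normal_map h u)"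
    by (rule touching_even[OF h ev]) (simp add: touching_normal_map[OF u])
  have "unique_touching h (- u)"
    unfolding unique_touching_def
  proof (rule ex1I[of _ "- normal_map h u"], rule t)
    fix v assume "touching h (- u) v"
    from touching_even[OF h ev this] have "touching h u (- v)" by simp
    then have "- v = normal_map h u" by (simp only: touching_normal_map[OF u])
    then show "v = - normal_map h u" by (metis minus_minus)
  qed
  from iffD1[OF touching_normal_map[OF this] t] show ?thesis by (rule sym)
qed

section \<open>First variation of the radial function\<close>

text \<open>
  Off a ball around the unique maximizer the maximum of \<open>\<phi>\<close> is strictly smaller.
\<close>

lemma maximizing_sequence_tendsto:
  fixes \<phi> :: "'a::metric_space \<Rightarrow> real"
  assumes C: "compact C" "continuous_on C \<phi>" and a: "a \<in> C" "\<And>v. v \<in> C \<Longrightarrow> v \<noteq> a \<Longrightarrow> \<phi> v < \<phi> a"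
    and v: "\<And>n. v n \<in> C" "\<And>n. b n \<le> \<phi> (v n)" "b \<longlonglongrightarrow> \<phi> a"
  shows "v \<longlonglongrightarrow> a"
proof (rule tendstoI)
  fix e :: real assume "0 < e"
  have c: "compact (C - ball a e)" using C by (intro compact_diff) auto
  show "\<forall>\<^sub>F n in sequentially. dist (v n) a < e"
  proof (cases "C - ball a e = {}")
    case True
    then have "dist (v n) a < e" for n using v(1)[of n] by (auto simp: dist_commute)
    then show ?thesis by simp
  next
    case False
    then obtain w where w: "w \<in> C - ball a e" "\<And>x. x \<in> C - ball a e \<Longrightarrow> \<phi> x \<le> \<phi> w"
      using continuous_attains_sup[OF c False continuous_on_subset[OF C(2)]] by blast
    have "w \<in> C" "w \<noteq> a" using w(1) \<open>0 < e\<close> by auto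
    then have "\<phi> w < \<phi> a" by (rule a(2))
    then have "\<forall>\<^sub>F n in sequentially. \<phi> w < b n" using v(3) by (rule order_tendstoD(1)[rotated])
    then show ?thesis
    proof eventually_elim
      case (elim n)
      then have "v n \<notin> C - ball a e" using w(2)[of "v n"] v(2)[of n] by fastforce
      then show ?case using v(1) by (auto simp: dist_commute)
    qed
  qed
qed

lemma exp_minus_one_bound:
  fixes t x :: real
  assumes "0 \<le> t" "t \<le> 1" "\<bar>x\<bar> \<le> M"
  shows "\<bar>exp (t * x) - 1\<bar> \<le> M * exp M * t"
proof -
  have M: "0 \<le> M" using assms(3) by simp
  have tx: "\<bar>t * x\<bar> \<le> t * M" using assms by (simp add: abs_mult mult_left_mono)
  have tM: "t * M \<le> M" using mult_right_mono[OF assms(2) M] by simp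
  have one: "1 \<le> exp M" using M by simp
  have "exp (t * x) - 1 \<le> M * exp M * t"
  proof -
    have "1 - t * x \<le> exp (- (t * x))" using exp_ge_add_one_self[of "- (t * x)"] by simp
    then have "exp (t * x) * (1 - t * x) \<le> exp (t * x) * exp (- (t * x))" by (intro mult_left_mono) auto
    also have "\<dots> = 1" by (simp flip: exp_add)
    finally have "exp (t * x) - 1 \<le> exp (t * x) * (t * x)" by (simp add: algebra_simps)
    also have "\<dots> \<le> exp (t * x) * (t * M)" by (rule mult_left_mono) (use tx in auto)
    also have "\<dots> \<le> exp M * (t * M)" by (rule mult_right_mono) (use tx tM assms(1) M in auto)
    finally show ?thesis by (simp add: mult_ac)
  qed
  moreover have "1 - exp (t * x) \<le> M * exp M * t"
  proof -
    have "1 - exp (t * x) \<le> t * M" using exp_ge_add_one_self[of "t * x"] tx by linarith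
    also have "\<dots> \<le> exp M * (t * M)" using mult_right_mono[OF one, of "t * M"] assms(1) M by simp
    finally show ?thesis by (simp add: mult_ac)
  qed
  ultimately show ?thesis by (simp add: abs_le_iff)
qed

lemma continuous_on_sphere_bounded:
  fixes f :: "'a::euclidean_space \<Rightarrow> real"
  assumes "continuous_on (sphere 0 1) f"
  obtains B where "\<And>v. v \<in> sphere 0 1 \<Longrightarrow> \<bar>f v\<bar> \<le> B"
proof -
  have "bounded (f ` sphere 0 1)"
    by (rule compact_imp_bounded[OF compact_continuous_image[OF assms compact_sphere]])
  then obtain B where "\<forall>x\<in>f ` sphere 0 1. norm x \<le> B" unfolding bounded_iff by blast
  then show thesis by (intro that[of B]) (auto simp del: mem_sphere mem_sphere_0)
qed

lemma pos_cont_exp: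
  assumes "pos_cont h" "continuous_on (sphere 0 1) f"
  shows "pos_cont (\<lambda>v. h v * exp (t * f v))"
  using assms by (auto simp: pos_cont_def intro!: continuous_intros)

text \<open>
  The factor \<open>exp (t * f v)\<close> lies between \<open>exp (- (t * M))\<close> and \<open>exp (t * M)\<close>, and the gauge is
  antitone and homogeneous of degree \<open>-1\<close> in \<open>h\<close>.
\<close>

lemma gauge_exp_bounds:
  assumes h: "pos_cont h" and f: "continuous_on (sphere 0 1) f" and M: "\<And>v. v \<in> sphere 0 1 \<Longrightarrow> \<bar>f v\<bar> \<le> M" and t: "0 \<le> t"
  shows "wulff_gauge (\<lambda>v. h v * exp (t * f v)) u \<le> exp (t * M) * wulff_gauge h u"
    and "exp (- (t * M)) * wulff_gauge h u \<le> wulff_gauge (\<lambda>v. h v * exp (t * f v)) u"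
proof -
  let ?h = "\<lambda>v. h v * exp (t * f v)"
  note ht = pos_cont_exp[OF h f, of t]
  have b: "exp (- (t * M)) \<le> exp (t * f v)" "exp (t * f v) \<le> exp (t * M)" if "v \<in> sphere 0 1" for v
    using M[OF that] t mult_left_mono[of "- M" "f v" t] mult_left_mono[of "f v" M t] by (auto simp: abs_le_iff)
  show "wulff_gauge ?h u \<le> exp (t * M) * wulff_gauge h u"
    unfolding gauge_le_iff[OF ht]
  proof
    fix v :: 'a assume v: "v \<in> sphere 0 1"
    have "v \<bullet> u \<le> h v * wulff_gauge h u * 1" using gauge_upper_mult[OF h v] by simp
    also have "\<dots> \<le> h v * wulff_gauge h u * (exp (t * M) * exp (t * f v))"
    proof (intro mult_left_mono)
      have "1 = exp (t * M) * exp (- (t * M))" by (simp flip: exp_add)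
      also have "\<dots> \<le> exp (t * M) * exp (t * f v)" using b(1)[OF v] by (intro mult_left_mono) auto
      finally show "1 \<le> exp (t * M) * exp (t * f v)" .
      show "0 \<le> h v * wulff_gauge h u" using pos_cont_pos[OF h v] gauge_nonneg[OF h] by simp
    qed
    finally show "v \<bullet> u \<le> exp (t * M) * wulff_gauge h u * ?h v" by (simp add: mult_ac)
  qed
  have "wulff_gauge h u \<le> exp (t * M) * wulff_gauge ?h u"
    unfolding gauge_le_iff[OF h]
  proof
    fix v :: 'a assume v: "v \<in> sphere 0 1"
    have "v \<bullet> u \<le> (h v * wulff_gauge ?h u) * exp (t * f v)" using gauge_upper_mult[OF ht v] by (simp add: mult_ac)
    also have "\<dots> \<le> (h v * wulff_gauge ?h u) * exp (t * M)"
      using b(2)[OF v] pos_cont_pos[OF h v] gauge_nonneg[OF ht] by (intro mult_left_mono) auto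
    finally show "v \<bullet> u \<le> exp (t * M) * wulff_gauge ?h u * h v" by (simp add: mult_ac)
  qed
  then have "exp (- (t * M)) * wulff_gauge h u \<le> exp (- (t * M)) * (exp (t * M) * wulff_gauge ?h u)"
    by (intro mult_left_mono) auto
  then show "exp (- (t * M)) * wulff_gauge h u \<le> wulff_gauge ?h u"
    by (simp flip: mult.assoc exp_add)
qed

text \<open>
  Bounds that are uniform in \<open>u\<close> and linear in \<open>t\<close>. They provide the dominating function when
  the derivative is taken under the integral sign.
\<close>

lemma radial_exp_bound:
  assumes h: "pos_cont h" and f: "continuous_on (sphere 0 1) f" and M: "\<And>v. v \<in> sphere 0 1 \<Longrightarrow> \<bar>f v\<bar> \<le> M"
    and t: "0 \<le> t" "t \<le> 1" and u: "u \<in> sphere 0 1"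
  shows "\<bar>1 / wulff_gauge (\<lambda>v. h v * exp (t * f v)) u - 1 / wulff_gauge h u\<bar> \<le> 1 / wulff_gauge h u * (M * exp M) * t"
    and "exp (- M) * (1 / wulff_gauge h u) \<le> 1 / wulff_gauge (\<lambda>v. h v * exp (t * f v)) u"
    and "1 / wulff_gauge (\<lambda>v. h v * exp (t * f v)) u \<le> exp M * (1 / wulff_gauge h u)"
proof -
  have "0 \<le> M" using M[OF u] by simp
  define p where "p = wulff_gauge h u"
  define q where "q = wulff_gauge (\<lambda>v. h v * exp (t * f v)) u"
  have "u \<noteq> 0" using u by auto
  have p: "0 < p" unfolding p_def by (rule gauge_pos[OF h \<open>u \<noteq> 0\<close>])
  have q: "0 < q" unfolding q_def by (rule gauge_pos[OF pos_cont_exp[OF h f] \<open>u \<noteq> 0\<close>])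
  define E where "E = exp (t * M)"
  have E: "1 \<le> E" "E \<le> exp M" "E - 1 \<le> M * exp M * t"
  proof -
    show "1 \<le> E" using t \<open>0 \<le> M\<close> by (simp add: E_def)
    show "E \<le> exp M" using t \<open>0 \<le> M\<close> mult_right_mono[of t 1 M] by (simp add: E_def)
    have "1 - t * M \<le> exp (- (t * M))" using exp_ge_add_one_self[of "- (t * M)"] by simp
    then have "E * (1 - t * M) \<le> E * exp (- (t * M))" by (intro mult_left_mono) (auto simp: E_def)
    also have "\<dots> = 1" by (simp add: E_def flip: exp_add)
    finally have "E - 1 \<le> E * (t * M)" by (simp add: algebra_simps)
    also have "\<dots> \<le> exp M * (t * M)" using \<open>E \<le> exp M\<close> t \<open>0 \<le> M\<close> by (intro mult_right_mono) auto
    finally show "E - 1 \<le> M * exp M * t" by (simp add: mult_ac)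
  qed
  have "q \<le> E * p" "p \<le> E * q"
  proof -
    show "q \<le> E * p" using gauge_exp_bounds(1)[OF h f M t(1), of u] by (simp add: p_def q_def E_def)
    have "E * (exp (- (t * M)) * p) \<le> E * q"
      using gauge_exp_bounds(2)[OF h f M t(1), of u] by (intro mult_left_mono) (auto simp: p_def q_def E_def)
    then show "p \<le> E * q" by (simp add: E_def flip: mult.assoc exp_add)
  qed
  then have r: "1 / q \<le> E * (1 / p)" "1 / p \<le> E * (1 / q)"
    using p q by (auto simp: field_simps)
  have rM: "1 / q \<le> exp M * (1 / p)" "1 / p \<le> exp M * (1 / q)"
    by (rule order_trans[OF r(1)] order_trans[OF r(2)]; use E p q in \<open>intro mult_right_mono; simp\<close>)+
  show "1 / wulff_gauge (\<lambda>v. h v * exp (t * f v)) u \<le> exp M * (1 / wulff_gauge h u)"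
    using rM by (simp add: p_def q_def)
  have "exp (- M) * (1 / p) \<le> exp (- M) * (exp M * (1 / q))" using rM(2) by (intro mult_left_mono) auto
  then show "exp (- M) * (1 / wulff_gauge h u) \<le> 1 / wulff_gauge (\<lambda>v. h v * exp (t * f v)) u"
    by (simp add: p_def q_def flip: mult.assoc exp_add)
  have up: "1 / q - 1 / p \<le> (1 / p) * (E - 1)" using r(1) by (simp add: right_diff_distrib)
  have lo: "1 / p - 1 / q \<le> (1 / p) * (E - 1)"
  proof -
    have "1 / p * (1 / E) \<le> E * (1 / q) * (1 / E)" using r(2) E(1) by (intro mult_right_mono) auto
    then have "1 / p * (1 / E) \<le> 1 / q" using E(1) by simp
    then have "1 / p - 1 / q \<le> 1 / p * (1 - 1 / E)" by (simp only: right_diff_distrib)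
    also have "\<dots> \<le> 1 / p * (E - 1)"
    proof (intro mult_left_mono)
      have "0 \<le> (E - 1)^2 / E" using E by simp
      also have "\<dots> = (E - 1) - (1 - 1 / E)" using E by (simp add: field_simps power2_eq_square)
      finally show "1 - 1 / E \<le> E - 1" by simp
    qed (use p in auto)
    finally show ?thesis .
  qed
  have "\<bar>1 / q - 1 / p\<bar> \<le> (1 / p) * (E - 1)" using up lo by (simp add: abs_le_iff)
  also have "\<dots> \<le> (1 / p) * (M * exp M * t)" using E p by (intro mult_left_mono) auto
  finally show "\<bar>1 / wulff_gauge (\<lambda>v. h v * exp (t * f v)) u - 1 / wulff_gauge h u\<bar> \<le> 1 / wulff_gauge h u * (M * exp M) * t"
    by (simp add: p_def q_def mult_ac)
qed

lemma exp_quotient_tendsto: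
  assumes "t \<longlonglongrightarrow> 0" "\<And>n. 0 < t n"
  shows "(\<lambda>n. (exp (t n * c) - 1) / t n) \<longlonglongrightarrow> (c::real)"
proof -
  have "((\<lambda>s. exp (s * c)) has_real_derivative c) (at 0)"
    by (auto intro!: derivative_eq_intros)
  then have "((\<lambda>h. (exp (h * c) - 1) / h) \<longlongrightarrow> c) (at 0)"
    by (simp add: has_field_derivative_iff)
  moreover have "filterlim t (at 0) sequentially"
    using assms(1) by (rule filterlim_atI) (use assms(2) in \<open>auto simp: less_imp_neq[THEN not_sym]\<close>)
  ultimately show ?thesis by (rule filterlim_compose)
qed

text \<open>
  An envelope argument. Testing the gauge of \<open>h * exp (t * f)\<close> with the touching direction \<open>a\<close>
  of \<open>h\<close> bounds the new radial function above by \<open>exp (t * f a)\<close> times the old one; testing the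
  gauge of \<open>h\<close> with the touching direction \<open>v n\<close> of the deformed function bounds it below by
  \<open>exp (t * f (v n))\<close> times the old one. Since \<open>v n\<close> maximizes \<open>(v \<bullet> u) / h v\<close> asymptotically,
  uniqueness of \<open>a\<close> forces \<open>v n\<close> to converge to \<open>a\<close>, and the two bounds have the same
  derivative.
\<close>

lemma radial_first_variation:
  assumes h: "pos_cont h" and f: "continuous_on (sphere 0 1) f"
    and uniq: "unique_touching h u" and u: "u \<in> sphere 0 1"
    and t: "t \<longlonglongrightarrow> 0" "\<And>n. 0 < t n"
  shows "(\<lambda>n. (1 / wulff_gauge (\<lambda>v. h v * exp (t n * f v)) u - 1 / wulff_gauge h u) / t n)
    \<longlonglongrightarrow> 1 / wulff_gauge h u * f (normal_map h u)"
proof -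
  define a where "a = normal_map h u"
  define p where "p = wulff_gauge h u"
  define P where "P n = wulff_gauge (\<lambda>v. h v * exp (t n * f v)) u" for n
  note ht = pos_cont_exp[OF h f]
  have "u \<noteq> 0" using u by auto
  have p: "0 < p" unfolding p_def by (rule gauge_pos[OF h \<open>u \<noteq> 0\<close>])
  have P: "0 < P n" for n unfolding P_def by (rule gauge_pos[OF ht \<open>u \<noteq> 0\<close>])
  have a: "a \<in> sphere 0 1" "(a \<bullet> u) / h a = p"
    using iffD2[OF touching_normal_map[OF uniq] refl] by (simp_all only: touching_def a_def p_def)
  have amax: "(v \<bullet> u) / h v < (a \<bullet> u) / h a" if "v \<in> sphere 0 1" "v \<noteq> a" for v
  proof -
    have "\<not> touching h u v" using touching_normal_map[OF uniq, of v] that by (simp add: a_def)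
    then show ?thesis using gauge_upper[OF h that(1), of u] that a by (auto simp: touching_def p_def)
  qed
  define v where "v n = (SOME w. touching (\<lambda>v. h v * exp (t n * f v)) u w)" for n
  have v: "touching (\<lambda>v. h v * exp (t n * f v)) u (v n)" for n
    unfolding v_def by (rule someI_ex[OF touching_exists[OF ht]])
  have vS: "v n \<in> sphere 0 1" for n using v[of n] by (simp add: touching_def)
  have vP: "(v n \<bullet> u) / h (v n) = P n * exp (t n * f (v n))" for n
    using v[of n] pos_cont_pos[OF h vS[of n]] by (auto simp: touching_def P_def field_simps)
  have vp: "(v n \<bullet> u) / h (v n) \<le> p" for n
    using gauge_upper[OF h vS] by (simp add: p_def)
  have Pa: "p \<le> P n * exp (t n * f a)" for n
  proof -
    have "(a \<bullet> u) / (h a * exp (t n * f a)) \<le> P n" using gauge_upper[OF ht a(1)] by (simp add: P_def)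
    then have "p / exp (t n * f a) \<le> P n" using a(2) by (simp flip: divide_divide_eq_left)
    then show ?thesis by (simp add: divide_le_eq)
  qed
  obtain B where B: "\<And>w. w \<in> sphere 0 1 \<Longrightarrow> \<bar>f w\<bar> \<le> B"
    by (rule continuous_on_sphere_bounded[OF f]) blast
  have lim: "v \<longlonglongrightarrow> a"
  proof (rule maximizing_sequence_tendsto[where \<phi> = "\<lambda>v. (v \<bullet> u) / h v" and C = "sphere 0 1"])
    show "continuous_on (sphere 0 1) (\<lambda>v. (v \<bullet> u) / h v)"
      using h by (intro continuous_intros) (auto simp: pos_cont_def less_imp_neq[THEN not_sym])
    show "p * exp (- (2 * B * t n)) \<le> (v n \<bullet> u) / h (v n)" for n
    proof -
      have "\<bar>f (v n) - f a\<bar> \<le> 2 * B" using B[OF vS[of n]] B[OF a(1)] by linarith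
      then have "t n * (- (2 * B)) \<le> t n * (f (v n) - f a)" using t(2)[of n] by (intro mult_left_mono) auto
      then have "p * exp (- (2 * B * t n)) \<le> p * exp (t n * (f (v n) - f a))"
        using p by (simp add: mult_ac)
      also have "\<dots> \<le> P n * exp (t n * f a) * exp (t n * (f (v n) - f a))"
        using Pa by (intro mult_right_mono) auto
      also have "\<dots> = P n * exp (t n * f (v n))" by (simp add: mult.assoc algebra_simps flip: exp_add)
      finally show ?thesis by (simp add: vP)
    qed
    have "(\<lambda>n. p * exp (- (2 * B * t n))) \<longlonglongrightarrow> p * exp (- (2 * B * 0))"
      by (intro tendsto_intros t)
    then show "(\<lambda>n. p * exp (- (2 * B * t n))) \<longlonglongrightarrow> (a \<bullet> u) / h a" using a by simp
  qed (use a(1) vS in \<open>auto intro: amax\<close>)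
  have fl: "(\<lambda>n. f (v n)) \<longlonglongrightarrow> f a"
    using continuous_on_tendsto_compose[OF f lim a(1)] vS by simp
  have lower: "1 / p * f (v n) \<le> (1 / P n - 1 / p) / t n" for n
  proof -
    have "P n * exp (t n * f (v n)) \<le> p" using vp[of n] vP[of n] by simp
    then have "1 / p * exp (t n * f (v n)) \<le> 1 / P n" using p P[of n] by (simp add: field_simps)
    moreover have "1 / p * (1 + t n * f (v n)) \<le> 1 / p * exp (t n * f (v n))"
      using p by (intro mult_left_mono) auto
    ultimately have "1 / p * (t n * f (v n)) \<le> 1 / P n - 1 / p" by (simp only: distrib_left)
    then show ?thesis using t(2)[of n] by (simp add: pos_le_divide_eq mult_ac)
  qed
  have upper: "(1 / P n - 1 / p) / t n \<le> 1 / p * ((exp (t n * f a) - 1) / t n)" for n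
  proof -
    have "1 / P n \<le> 1 / p * exp (t n * f a)" using Pa[of n] p P[of n] by (simp add: field_simps)
    then have "(1 / P n - 1 / p) / t n \<le> (1 / p * (exp (t n * f a) - 1)) / t n"
      using t(2)[of n] by (intro divide_right_mono) (auto simp: right_diff_distrib)
    then show ?thesis by simp
  qed
  have "(\<lambda>n. (1 / P n - 1 / p) / t n) \<longlonglongrightarrow> 1 / p * f a"
  proof (rule tendsto_sandwich)
    show "(\<lambda>n. 1 / p * f (v n)) \<longlonglongrightarrow> 1 / p * f a" by (intro tendsto_intros fl)
    show "(\<lambda>n. 1 / p * ((exp (t n * f a) - 1) / t n)) \<longlonglongrightarrow> 1 / p * f a"
      by (intro tendsto_intros exp_quotient_tendsto t)
  qed (use lower upper in auto)
  then show ?thesis by (simp add: P_def p_def a_def)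
qed

section \<open>Integrals of continuous functions on the sphere\<close>

text \<open>
  What the surface measure and \<open>\<mu>\<close> have in common. Their sigma-algebras differ: \<open>\<mu>\<close> is defined
  on the Borel sets, the surface measure on all Caratheodory measurable sets.
\<close>

definition sphere_borel :: "'a::euclidean_space measure \<Rightarrow> bool" where
  "sphere_borel M \<longleftrightarrow> finite_measure M \<and> space M = sphere 0 1 \<and>
     (\<forall>f :: 'a \<Rightarrow> real. continuous_on (sphere 0 1) f \<longrightarrow> f \<in> borel_measurable M)"

lemma sphere_borel_integrable_bounded:
  assumes "sphere_borel M" "f \<in> borel_measurable M" "\<And>x. x \<in> sphere 0 1 \<Longrightarrow> \<bar>f x\<bar> \<le> B"
  shows "integrable M (f :: 'a::euclidean_space \<Rightarrow> real)"
proof -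
  interpret finite_measure M using assms(1) by (simp add: sphere_borel_def)
  have "AE x in M. norm (f x) \<le> B"
    using assms(1,3) by (intro AE_I2) (auto simp: sphere_borel_def)
  then show ?thesis using assms(2) by (intro integrable_const_bound[of f B])
qed

lemma sphere_borel_integrable:
  assumes "sphere_borel M" "continuous_on (sphere 0 1) (f :: 'a::euclidean_space \<Rightarrow> real)"
  shows "integrable M f"
proof -
  obtain B where B: "\<And>v. v \<in> sphere 0 1 \<Longrightarrow> \<bar>f v\<bar> \<le> B"
    by (rule continuous_on_sphere_bounded[OF assms(2)]) blast
  show ?thesis
  proof (rule sphere_borel_integrable_bounded[OF assms(1) _ B])
    show "f \<in> borel_measurable M" using assms unfolding sphere_borel_def by blast
  qed
qed

lemma continuous_on_superposition:
  fixes F :: "real \<Rightarrow> 'a::euclidean_space \<Rightarrow> real"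
  assumes F: "continuous_on ({0<..} \<times> sphere 0 1) (\<lambda>(t, x). F t x)"
    and y: "continuous_on (sphere 0 1) y" "\<And>x. x \<in> sphere 0 1 \<Longrightarrow> 0 < y x"
  shows "continuous_on (sphere 0 1) (\<lambda>x. F (y x) x)"
proof -
  have "continuous_on (sphere 0 1) (\<lambda>x. (\<lambda>(t, x). F t x) (y x, x))"
    by (rule continuous_on_compose2[OF F continuous_on_Pair[OF y(1) continuous_on_id]]) (use y(2) in blast)
  then show ?thesis by simp
qed

lemma bounded_on_strip:
  fixes F :: "real \<Rightarrow> 'a::euclidean_space \<Rightarrow> real"
  assumes F: "continuous_on ({0<..} \<times> sphere 0 1) (\<lambda>(t, x). F t x)" and "0 < a"
  obtains B where "0 \<le> B" "\<And>t x. t \<in> {a..b} \<Longrightarrow> x \<in> sphere 0 1 \<Longrightarrow> \<bar>F t x\<bar> \<le> B"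
proof -
  have "compact ((\<lambda>(t, x). F t x) ` ({a..b} \<times> sphere 0 1))"
  proof (rule compact_continuous_image)
    have "{a..b} \<times> sphere 0 1 \<subseteq> {0<..} \<times> sphere (0::'a) 1" using \<open>0 < a\<close> by auto
    then show "continuous_on ({a..b} \<times> sphere 0 1) (\<lambda>(t, x). F t x)" by (rule continuous_on_subset[OF F])
    show "compact ({a..b} \<times> sphere (0::'a) 1)" by (intro compact_Times compact_Icc compact_sphere)
  qed
  then have "bounded ((\<lambda>(t, x). F t x) ` ({a..b} \<times> sphere 0 1))" by (rule compact_imp_bounded)
  then obtain B where B: "\<forall>z\<in>(\<lambda>(t, x). F t x) ` ({a..b} \<times> sphere 0 1). norm z \<le> B"
    unfolding bounded_iff by blast
  show thesis
  proof (rule that[of "\<bar>B\<bar>"])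
    fix t and x :: 'a assume "t \<in> {a..b}" "x \<in> sphere 0 1"
    then have "(\<lambda>(t, x). F t x) (t, x) \<in> (\<lambda>(t, x). F t x) ` ({a..b} \<times> sphere 0 1)"
      by (intro imageI) simp
    then have "F t x \<in> (\<lambda>(t, x). F t x) ` ({a..b} \<times> sphere 0 1)" by simp
    then have "norm (F t x) \<le> B" by (rule bspec[OF B])
    then show "\<bar>F t x\<bar> \<le> \<bar>B\<bar>" by simp
  qed simp
qed

lemma integral_superposition_tendsto:
  fixes F :: "real \<Rightarrow> 'a::euclidean_space \<Rightarrow> real"
  assumes M: "sphere_borel M"
    and F: "continuous_on ({0<..} \<times> sphere 0 1) (\<lambda>(t, x). F t x)" and "0 < a"
    and yn: "\<And>n::nat. continuous_on (sphere 0 1) (yn n)" "\<And>n x. x \<in> sphere 0 1 \<Longrightarrow> yn n x \<in> {a..b}"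
    and y: "continuous_on (sphere 0 1) y" "\<And>x. x \<in> sphere 0 1 \<Longrightarrow> y x \<in> {a..b}"
    and lim: "\<And>x. x \<in> sphere 0 1 \<Longrightarrow> (\<lambda>n. yn n x) \<longlonglongrightarrow> y x"
  shows "(\<lambda>n. LINT x|M. F (yn n x) x) \<longlonglongrightarrow> (LINT x|M. F (y x) x)"
proof -
  have cm: "\<And>f :: 'a \<Rightarrow> real. continuous_on (sphere 0 1) f \<Longrightarrow> f \<in> borel_measurable M" and sp: "space M = sphere 0 1"
    using M by (auto simp: sphere_borel_def)
  interpret finite_measure M using M by (simp add: sphere_borel_def)
  obtain B where B: "\<And>t x. t \<in> {a..b} \<Longrightarrow> x \<in> sphere 0 1 \<Longrightarrow> \<bar>F t x\<bar> \<le> B"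
    by (rule bounded_on_strip[OF F \<open>0 < a\<close>]) blast
  have pos: "0 < z" if "z \<in> {a..b}" for z using that \<open>0 < a\<close> by simp
  show ?thesis
  proof (rule integral_dominated_convergence[where w = "\<lambda>_. B"])
    show "(\<lambda>x. F (y x) x) \<in> borel_measurable M"
      by (rule cm[OF continuous_on_superposition[OF F y(1) pos[OF y(2)]]])
    show "(\<lambda>x. F (yn n x) x) \<in> borel_measurable M" for n
      by (rule cm[OF continuous_on_superposition[OF F yn(1) pos[OF yn(2)]]])
    show "AE x in M. (\<lambda>n. F (yn n x) x) \<longlonglongrightarrow> F (y x) x"
    proof (rule AE_I2)
      fix x assume "x \<in> space M"
      then have x: "x \<in> sphere 0 1" by (simp only: sp)
      have "(\<lambda>n. (\<lambda>(t, x). F t x) (yn n x, x)) \<longlonglongrightarrow> (\<lambda>(t, x). F t x) (y x, x)"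
      proof (rule continuous_on_tendsto_compose[OF F])
        show "(\<lambda>n. (yn n x, x)) \<longlonglongrightarrow> (y x, x)" by (intro tendsto_Pair lim x tendsto_const)
        show "(y x, x) \<in> {0<..} \<times> sphere 0 1" using x pos[OF y(2)[OF x]] by blast
        have "(yn n x, x) \<in> {0<..} \<times> sphere 0 1" for n using x pos[OF yn(2)[OF x]] by blast
        then show "\<forall>\<^sub>F n in sequentially. (yn n x, x) \<in> {0<..} \<times> sphere 0 1" by (intro always_eventually allI)
      qed
      then show "(\<lambda>n. F (yn n x) x) \<longlonglongrightarrow> F (y x) x" by simp
    qed
    show "AE x in M. norm (F (yn n x) x) \<le> B" for n
      using B yn(2) by (intro AE_I2) (simp add: sp)
  qed simp
qed

text \<open>
  Differentiation under the integral sign along a sequence \<open>t n\<close>. The mean value theorem on the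
  compact strip gives a constant dominating function, and Caratheodory's form of
  differentiability gives the pointwise limit of the quotients also where \<open>yn n x = y x\<close>.
\<close>

lemma integral_superposition_derivative:
  fixes F F' :: "real \<Rightarrow> 'a::euclidean_space \<Rightarrow> real"
  assumes M: "sphere_borel M"
    and F: "continuous_on ({0<..} \<times> sphere 0 1) (\<lambda>(t, x). F t x)"
    and F': "continuous_on ({0<..} \<times> sphere 0 1) (\<lambda>(t, x). F' t x)"
    and deriv: "\<And>t x. 0 < t \<Longrightarrow> x \<in> sphere 0 1 \<Longrightarrow> ((\<lambda>s. F s x) has_real_derivative F' t x) (at t)"
    and "0 < a"
    and yn: "\<And>n::nat. continuous_on (sphere 0 1) (yn n)" "\<And>n x. x \<in> sphere 0 1 \<Longrightarrow> yn n x \<in> {a..b}"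
    and y: "continuous_on (sphere 0 1) y" "\<And>x. x \<in> sphere 0 1 \<Longrightarrow> y x \<in> {a..b}"
    and t: "\<And>n. 0 < t n" "t \<longlonglongrightarrow> 0"
    and bound: "\<And>n x. x \<in> sphere 0 1 \<Longrightarrow> \<bar>yn n x - y x\<bar> \<le> C * t n"
    and d: "d \<in> borel_measurable M" "AE x in M. (\<lambda>n. (yn n x - y x) / t n) \<longlonglongrightarrow> d x"
  shows "(\<lambda>n. ((LINT x|M. F (yn n x) x) - (LINT x|M. F (y x) x)) / t n) \<longlonglongrightarrow> (LINT x|M. F' (y x) x * d x)"
proof -
  have cm: "\<And>f :: 'a \<Rightarrow> real. continuous_on (sphere 0 1) f \<Longrightarrow> f \<in> borel_measurable M" and sp: "space M = sphere 0 1"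
    using M by (auto simp: sphere_borel_def)
  interpret finite_measure M using M by (simp add: sphere_borel_def)
  obtain B where B: "0 \<le> B" "\<And>t x. t \<in> {a..b} \<Longrightarrow> x \<in> sphere 0 1 \<Longrightarrow> \<bar>F' t x\<bar> \<le> B"
    by (rule bounded_on_strip[OF F' \<open>0 < a\<close>]) blast
  have pos: "0 < z" if "z \<in> {a..b}" for z using that \<open>0 < a\<close> by simp
  have cF: "continuous_on (sphere 0 1) (\<lambda>x. F (y x) x)" "\<And>n. continuous_on (sphere 0 1) (\<lambda>x. F (yn n x) x)"
    by (rule continuous_on_superposition[OF F y(1) pos[OF y(2)]] continuous_on_superposition[OF F yn(1) pos[OF yn(2)]]; assumption)+
  have cF': "continuous_on (sphere 0 1) (\<lambda>x. F' (y x) x)"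
    by (rule continuous_on_superposition[OF F' y(1) pos[OF y(2)]])
  have "(\<lambda>n. LINT x|M. (F (yn n x) x - F (y x) x) / t n) \<longlonglongrightarrow> (LINT x|M. F' (y x) x * d x)"
  proof (rule integral_dominated_convergence[where w = "\<lambda>_. B * C"])
    show "(\<lambda>x. F' (y x) x * d x) \<in> borel_measurable M"
      by (intro borel_measurable_times cm cF' d)
    show "(\<lambda>x. (F (yn n x) x - F (y x) x) / t n) \<in> borel_measurable M" for n
      by (intro borel_measurable_divide borel_measurable_diff cm cF borel_measurable_const)
    have sph: "AE x in M. x \<in> sphere 0 1" using sp by (intro AE_I2) simp
    show "AE x in M. (\<lambda>n. (F (yn n x) x - F (y x) x) / t n) \<longlonglongrightarrow> F' (y x) x * d x"
      using d(2) sph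
    proof eventually_elim
      case (elim x)
      obtain g where g: "\<And>z. F z x - F (y x) x = g z * (z - y x)" "isCont g (y x)" "g (y x) = F' (y x) x"
        using deriv[OF pos[OF y(2)[OF elim(2)]] elim(2)] unfolding CARAT_DERIV by blast
      have "(\<lambda>n. yn n x - y x) \<longlonglongrightarrow> 0"
      proof (rule Lim_null_comparison)
        show "\<forall>\<^sub>F n in sequentially. norm (yn n x - y x) \<le> C * t n" using bound[OF elim(2)] by simp
        show "(\<lambda>n. C * t n) \<longlonglongrightarrow> 0" using tendsto_mult_right_zero[OF t(2)] .
      qed
      then have "(\<lambda>n. yn n x) \<longlonglongrightarrow> y x" by (rule LIM_zero_cancel)
      then have "(\<lambda>n. g (yn n x)) \<longlonglongrightarrow> F' (y x) x"
        using isCont_tendsto_compose[OF g(2)] g(3) by simp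
      from tendsto_mult[OF this elim(1)]
      show ?case by (simp add: g(1))
    qed
    show "AE x in M. norm ((F (yn n x) x - F (y x) x) / t n) \<le> B * C" for n
      using sph
    proof eventually_elim
      case (elim x)
      have "norm (F (yn n x) x - F (y x) x) \<le> B * norm (yn n x - y x)"
      proof (rule field_differentiable_bound[where S = "{a..b}" and f' = "\<lambda>z. F' z x"])
        show "((\<lambda>s. F s x) has_field_derivative F' z x) (at z within {a..b})" if "z \<in> {a..b}" for z
          using deriv[OF pos[OF that] elim] by (rule has_field_derivative_at_within)
        show "norm (F' z x) \<le> B" if "z \<in> {a..b}" for z using B(2)[OF that elim] by simp
      qed (use yn(2)[OF elim] y(2)[OF elim] in auto)
      also have "\<dots> \<le> B * (C * t n)" using bound[OF elim, of n] B(1) by (intro mult_left_mono) auto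
      finally show ?case using t(1)[of n] by (simp add: divide_le_eq mult.assoc)
    qed
  qed simp
  then show ?thesis
    by (simp only: integral_divide_zero Bochner_Integration.integral_diff[OF sphere_borel_integrable[OF M cF(2)] sphere_borel_integrable[OF M cF(1)]])
qed

text \<open>
  Indicators of closed sets are decreasing limits of continuous functions, and the closed sets
  are an intersection-stable generator of the Borel sets.
\<close>

lemma sphere_measure_eqI_continuous:
  fixes M N :: "'a::euclidean_space measure"
  assumes M: "sphere_borel M" "sets M = sets (restrict_space borel (sphere 0 1))"
    and N: "finite_measure N" "sets N = sets (restrict_space borel (sphere 0 1))"
    and eq: "\<And>g :: 'a \<Rightarrow> real. continuous_on (sphere 0 1) g \<Longrightarrow> (LINT x|M. g x) = (LINT x|N. g x)"
  shows "M = N"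
proof -
  interpret M: finite_measure M using M(1) by (simp add: sphere_borel_def)
  interpret N: finite_measure N by (rule N(1))
  have sp: "space M = sphere 0 1" "space N = sphere 0 1"
    using sets_eq_imp_space_eq[OF M(2)] sets_eq_imp_space_eq[OF N(2)] by (simp_all add: space_restrict_space)
  have NN: "sphere_borel N"
    using N sp by (auto simp: sphere_borel_def measurable_cong_sets[OF N(2) refl] borel_measurable_continuous_on_restrict)
  have closed_eq: "emeasure M F = emeasure N F" if F: "closed F" "F \<subseteq> sphere 0 1" for F
  proof (cases "F = {}")
    case False
    define g where "g n x = max 0 (1 - real n * infdist x F)" for n x
    have gc: "continuous_on (sphere 0 1) (g n)" for n
      unfolding g_def by (intro continuous_intros)
    have lim: "(\<lambda>n. g n x) \<longlonglongrightarrow> indicator F x" for x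
    proof (cases "x \<in> F")
      case True
      then show ?thesis by (simp add: g_def)
    next
      case nx: False
      then have p: "0 < infdist x F"
        using F(1) False in_closed_iff_infdist_zero[of F x] infdist_nonneg[of x F] by fastforce
      obtain k where k: "1 / infdist x F < real k" using reals_Archimedean2 by blast
      have "g n x = 0" if "n \<ge> k" for n
      proof -
        have "1 / infdist x F < real n" using k that by linarith
        then show ?thesis using p by (simp add: g_def field_simps)
      qed
      then show ?thesis using nx by (auto intro!: tendsto_eventually eventually_sequentiallyI[of k])
    qed
    have setF: "F \<in> sets M" "F \<in> sets N"
      using F by (auto simp: M(2) N(2) sets_restrict_space_iff)
    have conv: "(\<lambda>n. LINT x|P. g n x) \<longlonglongrightarrow> measure P F" if P: "sphere_borel P" "F \<in> sets P" for P
    proof -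
      interpret P: finite_measure P using P by (simp add: sphere_borel_def)
      have "(\<lambda>n. LINT x|P. g n x) \<longlonglongrightarrow> (LINT x|P. indicator F x)"
      proof (rule integral_dominated_convergence[where w = "\<lambda>_. 1"])
        show "g n \<in> borel_measurable P" for n using P(1) gc by (simp add: sphere_borel_def)
        show "AE x in P. norm (g n x) \<le> 1" for n
          by (intro AE_I2) (auto simp: g_def infdist_nonneg max_def)
      qed (use P lim in auto)
      then show ?thesis using P by simp
    qed
    have "measure M F = measure N F"
      using conv[OF M(1) setF(1)] conv[OF NN setF(2)] eq[OF gc] by (simp add: LIMSEQ_unique)
    then show ?thesis by (simp add: M.emeasure_eq_measure N.emeasure_eq_measure)
  qed simp
  show ?thesis
  proof (rule measure_eqI_generator_eq[where E = "{F. closed F \<and> F \<subseteq> sphere 0 1}" and \<Omega> = "sphere 0 1" and A = "\<lambda>_. sphere 0 1"])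
    have gen: "sets (restrict_space borel (sphere (0::'a) 1)) = sigma_sets (sphere 0 1) {F. closed F \<and> F \<subseteq> sphere 0 1}"
    proof -
      have "sphere (0::'a) 1 \<in> sigma_sets UNIV (Collect closed)"
        by (rule sigma_sets.Basic) simp
      then have "sets (restrict_space borel (sphere (0::'a) 1)) = sigma_sets (sphere 0 1) ((\<inter>) (sphere 0 1) ` Collect closed)"
        unfolding borel_eq_closed sets_restrict_space
        by (subst sets_measure_of, simp) (rule sigma_sets_Int, simp_all)
      also have "(\<inter>) (sphere 0 1) ` Collect closed = {F. closed F \<and> F \<subseteq> sphere (0::'a) 1}"
      proof (intro equalityI subsetI)
        fix F assume "F \<in> {F. closed F \<and> F \<subseteq> sphere (0::'a) 1}"
        then have "F = sphere 0 1 \<inter> F" "F \<in> Collect closed" by auto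
        then show "F \<in> (\<inter>) (sphere 0 1) ` Collect closed" by (rule image_eqI)
      qed auto
      finally show ?thesis .
    qed
    show "sets M = sigma_sets (sphere 0 1) {F. closed F \<and> F \<subseteq> sphere 0 1}"
      "sets N = sigma_sets (sphere 0 1) {F. closed F \<and> F \<subseteq> sphere 0 1}"
      using gen M(2) N(2) by auto
    show "Int_stable {F. closed F \<and> F \<subseteq> sphere 0 1}" by (auto simp: Int_stable_def)
  qed (use closed_eq in auto)
qed

section \<open>The variational problem\<close>

text \<open>
  The data of the problem, on an arbitrary Euclidean space.
\<close>

locale dual_orlicz =
  fixes \<mu> :: "'a::euclidean_space measure"
    and G :: "real \<Rightarrow> 'a \<Rightarrow> real"
    and \<psi> :: "real \<Rightarrow> real"
    and \<epsilon>\<^sub>0 :: real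
  assumes mu_sets: "sets \<mu> = sets (restrict_space borel (sphere 0 1))"
    and mu_finite: "finite_measure \<mu>"
    and mu_nonzero: "emeasure \<mu> (sphere 0 1) \<noteq> 0"
    and mu_even: "\<And>E. E \<in> sets \<mu> \<Longrightarrow> emeasure \<mu> (uminus ` E) = emeasure \<mu> E"
    and mu_subspheres: "\<And>v. v \<in> sphere 0 1 \<Longrightarrow> emeasure \<mu> {u \<in> sphere 0 1. v \<bullet> u = 0} = 0"
    and G_pos: "\<And>t u. t > 0 \<Longrightarrow> u \<in> sphere 0 1 \<Longrightarrow> G t u > 0"
    and G_cont: "continuous_on ({0<..} \<times> sphere 0 1) (\<lambda>(t, u). G t u)"
    and G_diff: "\<And>t u. t > 0 \<Longrightarrow> u \<in> sphere 0 1 \<Longrightarrow> (\<lambda>s. G s u) differentiable (at t)"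
    and Gt_cont: "continuous_on ({0<..} \<times> sphere 0 1) (\<lambda>(t, u). partial_t G t u)"
    and Gt_neg: "\<And>t u. t > 0 \<Longrightarrow> u \<in> sphere 0 1 \<Longrightarrow> partial_t G t u < 0"
    and Gt_even: "\<And>t u. t > 0 \<Longrightarrow> u \<in> sphere 0 1 \<Longrightarrow> partial_t G t u = partial_t G t (- u)"
    and eps: "0 < \<epsilon>\<^sub>0" "\<epsilon>\<^sub>0 < 1"
    and G_lim: "\<And>v. v \<in> sphere 0 1 \<Longrightarrow>
      filterlim (\<lambda>t. LINT u : {u \<in> sphere 0 1. u \<bullet> v \<ge> \<epsilon>\<^sub>0} | sphere_measure. G t u)
        at_top (at_right 0)"
    and psi_pos: "\<And>s. s > 0 \<Longrightarrow> \<psi> s > 0"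
    and psi_cont: "continuous_on {0<..} \<psi>"
    and phi_bar_finite: "\<And>t. t > 0 \<Longrightarrow> set_integrable lborel {t..} (\<lambda>s. \<psi> s / s)"
begin

definition cap :: "'a \<Rightarrow> 'a set" where "cap v = {u \<in> sphere 0 1. u \<bullet> v \<ge> \<epsilon>\<^sub>0}"

definition phi :: "real \<Rightarrow> real" where "phi t = (LINT s:{t..}|lborel. \<psi> s / s)"

definition Phi :: "('a \<Rightarrow> real) \<Rightarrow> real" where "Phi h = (LINT v|\<mu>. phi (h v))"

definition dual_volume :: "('a \<Rightarrow> real) \<Rightarrow> real" where
  "dual_volume h = (LINT u|sphere_measure. G (1 / wulff_gauge h u) u)"

lemma cap_measurable: "cap v \<in> sets sphere_measure"
proof (rule borel_sets_sphere_measure)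
  have "cap v = sphere 0 1 \<inter> {u. \<epsilon>\<^sub>0 \<le> u \<bullet> v}" by (auto simp: cap_def)
  also have "closed \<dots>" by (intro closed_Int closed_sphere closed_Collect_le continuous_intros)
  finally show "cap v \<in> sets borel" by simp
qed (auto simp: cap_def)

lemma G_continuous_sphere: "0 < t \<Longrightarrow> continuous_on (sphere 0 1) (G t)"
  using continuous_on_superposition[OF G_cont, of "\<lambda>_. t"] by simp

text \<open>
  The integrals over a cap tend to infinity, so each of them exceeds \<open>c\<close> at one fixed \<open>t\<close>; by
  monotonicity of \<open>G\<close> this \<open>t\<close> serves for all smaller values.
\<close>

lemma cap_integral_large:
  assumes "v \<in> sphere 0 1" obtains t where "0 < t" "c < (LINT u:cap v|sphere_measure. G t u)"
proof -
  have "eventually (\<lambda>t. c < (LINT u:cap v|sphere_measure. G t u)) (at_right 0)"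
    using G_lim[OF assms] unfolding filterlim_at_top_dense cap_def by blast
  moreover have "eventually (\<lambda>t::real. 0 < t) (at_right 0)" by (rule eventually_at_right_less)
  ultimately have "eventually (\<lambda>t. 0 < t \<and> c < (LINT u:cap v|sphere_measure. G t u)) (at_right 0)"
    by eventually_elim simp
  then have "\<exists>t. 0 < t \<and> c < (LINT u:cap v|sphere_measure. G t u)"
    by (rule eventually_happens'[OF trivial_limit_at_right_real])
  then show thesis using that by blast
qed

text \<open>
  A Bochner integral that is not zero belongs to an integrable function, and \<open>G t\<close> has a
  positive lower bound on the sphere.
\<close>

lemma cap_finite:
  assumes "v \<in> sphere 0 1" shows "emeasure sphere_measure (cap v) < \<infinity>"
proof -
  obtain t where t: "0 < t" "0 < (LINT u:cap v|sphere_measure. G t u)"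
    using cap_integral_large[OF assms] .
  have int: "integrable sphere_measure (\<lambda>u. indicator (cap v) u *\<^sub>R G t u)"
    using t(2) not_integrable_integral_eq unfolding set_lebesgue_integral_def by force
  obtain x where x: "x \<in> sphere 0 1" "\<And>u. u \<in> sphere 0 1 \<Longrightarrow> G t x \<le> G t u"
    using continuous_attains_inf[OF compact_sphere sphere_nonempty G_continuous_sphere[OF t(1)]] by blast
  have m: "0 < G t x" by (rule G_pos[OF t(1) x(1)])
  have "integrable sphere_measure (\<lambda>u. G t x * indicator (cap v) u)"
  proof (rule Bochner_Integration.integrable_bound[OF int])
    show "(\<lambda>u. G t x * indicator (cap v) u) \<in> borel_measurable sphere_measure"
      by (intro borel_measurable_times borel_measurable_const borel_measurable_indicator cap_measurable)
    have "norm (G t x * indicator (cap v) u) \<le> norm (indicator (cap v) u *\<^sub>R G t u)" for u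
      using x(2)[of u] m by (auto simp: indicator_def cap_def)
    then show "AE u in sphere_measure. norm (G t x * indicator (cap v) u) \<le> norm (indicator (cap v) u *\<^sub>R G t u)"
      by (intro AE_I2)
  qed
  then have "integrable sphere_measure (\<lambda>u. (1 / G t x) * (G t x * indicator (cap v) u))"
    by (rule integrable_mult_right)
  then have "integrable sphere_measure (indicator (cap v) :: 'a \<Rightarrow> real)" using m by simp
  moreover have "cap v \<inter> space sphere_measure = cap v" by (auto simp: cap_def)
  ultimately show ?thesis by (simp only: integrable_indicator_iff)
qed

text \<open>
  The open caps \<open>{u. \<epsilon>\<^sub>0 < u \<bullet> v}\<close> cover the compact sphere since \<open>\<epsilon>\<^sub>0 < 1\<close>, and each closed cap
  has finite measure.
\<close>

lemma finite_sphere_measure: "finite_measure (sphere_measure :: 'a measure)"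
proof
  have "sphere 0 1 \<subseteq> (\<Union>v\<in>sphere 0 1. {u::'a. \<epsilon>\<^sub>0 < u \<bullet> v})"
  proof
    fix u :: 'a assume u: "u \<in> sphere 0 1"
    then have "\<epsilon>\<^sub>0 < u \<bullet> u" using eps by (simp add: dot_square_norm)
    then show "u \<in> (\<Union>v\<in>sphere 0 1. {u. \<epsilon>\<^sub>0 < u \<bullet> v})" using u by blast
  qed
  moreover have "open {u::'a. \<epsilon>\<^sub>0 < u \<bullet> v}" for v by (intro open_Collect_less continuous_intros)
  ultimately obtain C where C: "C \<subseteq> sphere (0::'a) 1" "finite C" "sphere 0 1 \<subseteq> (\<Union>v\<in>C. {u. \<epsilon>\<^sub>0 < u \<bullet> v})"
    using compactE_image[OF compact_sphere, of "sphere 0 1" "\<lambda>v. {u::'a. \<epsilon>\<^sub>0 < u \<bullet> v}"] by metis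
  have "sphere 0 1 \<subseteq> (\<Union>v\<in>C. cap v)" using C(3) by (force simp: cap_def)
  then have "emeasure sphere_measure (sphere (0::'a) 1) \<le> emeasure sphere_measure (\<Union>v\<in>C. cap v)"
    using C(2) by (intro emeasure_mono sets.finite_UN cap_measurable)
  also have "\<dots> \<le> (\<Sum>v\<in>C. emeasure sphere_measure (cap v))"
    using C(2) by (intro emeasure_subadditive_finite) (auto simp: cap_measurable)
  also have "\<dots> < \<infinity>" using C(1,2) cap_finite unfolding infinity_ennreal_def
    by (subst ennreal_sum_less_top) blast+
  finally show "emeasure (sphere_measure :: 'a measure) (space sphere_measure) \<noteq> \<infinity>" by simp
qed

lemma sphere_borel_sphere_measure: "sphere_borel (sphere_measure :: 'a measure)"
  by (simp add: sphere_borel_def finite_sphere_measure continuous_on_measurable_sphere)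

lemma space_mu: "space \<mu> = sphere 0 1"
  using sets_eq_imp_space_eq[OF mu_sets] by (simp add: space_restrict_space)

lemma sphere_borel_mu: "sphere_borel \<mu>"
  unfolding sphere_borel_def
  using mu_finite space_mu measurable_cong_sets[OF mu_sets refl] borel_measurable_continuous_on_restrict by blast

text \<open>
  The cap integrals of \<open>G\<close> would vanish on a null sphere.
\<close>

lemma sphere_measure_pos: "0 < measure sphere_measure (sphere (0::'a) 1)"
proof (rule ccontr)
  interpret finite_measure "sphere_measure :: 'a measure" by (rule finite_sphere_measure)
  assume "\<not> ?thesis"
  then have "measure sphere_measure (sphere (0::'a) 1) = 0"
    using measure_nonneg[of sphere_measure "sphere (0::'a) 1"] by linarith
  then have z: "emeasure (sphere_measure :: 'a measure) (space sphere_measure) = 0"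
    by (simp add: emeasure_eq_measure)
  obtain v :: 'a where v: "v \<in> sphere 0 1" using sphere_nonempty by blast
  obtain t where t: "0 < t" "0 < (LINT u:cap v|sphere_measure. G t u)"
    using cap_integral_large[OF v] .
  have "(LINT u:cap v|sphere_measure. G t u) = 0"
    unfolding set_lebesgue_integral_def by (rule integral_eq_zero_AE) (rule emeasure_0_AE[OF z])
  then show False using t by simp
qed

lemma mu_pos: "0 < measure \<mu> (sphere 0 1)"
  using mu_nonzero mu_finite finite_measure.emeasure_eq_measure[OF mu_finite, of "sphere 0 1"]
  by (simp add: zero_less_measure_iff)

lemma G_deriv:
  "0 < t \<Longrightarrow> u \<in> sphere 0 1 \<Longrightarrow> ((\<lambda>s. G s u) has_real_derivative partial_t G t u) (at t)"
  using G_diff unfolding partial_t_def by (simp only: DERIV_deriv_iff_real_differentiable)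

lemma G_antimono:
  assumes "0 < s" "s \<le> t" "u \<in> sphere 0 1" shows "G t u \<le> G s u"
proof (rule DERIV_nonpos_imp_nonincreasing[OF assms(2)])
  fix x assume "s \<le> x" "x \<le> t"
  then have "0 < x" using assms by simp
  then show "\<exists>y. ((\<lambda>t. G t u) has_real_derivative y) (at x) \<and> y \<le> 0"
    using G_deriv[OF _ assms(3)] Gt_neg[OF _ assms(3)] by (meson less_imp_le)
qed

lemma phi_split:
  assumes "0 < a" "a \<le> b"
  shows "phi a = (LINT s:{a..b}|lborel. \<psi> s / s) + phi b"
proof -
  have i: "set_integrable lborel {a..} (\<lambda>s. \<psi> s / s)" by (rule phi_bar_finite[OF assms(1)])
  have un: "{a..} = {a..b} \<union> {b..}" using assms by auto
  have "AE s in lborel. s \<noteq> b" by (rule AE_lborel_singleton)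
  then have "AE s in lborel. \<not> (s \<in> {a..b} \<and> s \<in> {b..})" by eventually_elim auto
  then show ?thesis unfolding phi_def un
    by (rule set_integral_Un_AE) (use assms in \<open>auto intro!: set_integrable_subset[OF i]\<close>)
qed

text \<open>
  Near \<open>t\<close>, \<open>phi\<close> differs by a constant from minus the integral of \<open>\<psi>(s)/s\<close> over a compact
  interval starting at \<open>a = t / 2\<close>.
\<close>

lemma phi_deriv:
  assumes "0 < t" shows "(phi has_real_derivative - (\<psi> t / t)) (at t)"
proof -
  define a where "a = t / 2"
  have a: "0 < a" "a < t" using assms by (auto simp: a_def)
  have c: "continuous_on {a..2 * t} (\<lambda>s. \<psi> s / s)"
    by (intro continuous_intros continuous_on_subset[OF psi_cont]) (use a in auto)
  have eq: "phi x = phi a - integral {a..x} (\<lambda>s. \<psi> s / s)" if "a \<le> x" for x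
  proof -
    have "(LINT s:{a..x}|lborel. \<psi> s / s) = integral {a..x} (\<lambda>s. \<psi> s / s)"
      by (rule set_borel_integral_eq_integral(2))
         (rule set_integrable_subset[OF phi_bar_finite[OF a(1)]], auto)
    then show ?thesis using phi_split[OF a(1) that] by simp
  qed
  have "((\<lambda>x. integral {a..x} (\<lambda>s. \<psi> s / s)) has_real_derivative \<psi> t / t) (at t within {a..2 * t})"
    by (rule integral_has_real_derivative[OF c]) (use a in auto)
  then have "((\<lambda>x. integral {a..x} (\<lambda>s. \<psi> s / s)) has_real_derivative \<psi> t / t) (at t)"
    using a by (subst (asm) at_within_Icc_at) auto
  then have "((\<lambda>x. phi a - integral {a..x} (\<lambda>s. \<psi> s / s)) has_real_derivative 0 - \<psi> t / t) (at t)"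
    by (intro DERIV_diff DERIV_const)
  then have "(phi has_real_derivative 0 - \<psi> t / t) (at t)"
  proof (rule has_field_derivative_transform_within)
    show "0 < t - a" using a by simp
    fix x assume "dist x t < t - a"
    then show "phi a - integral {a..x} (\<lambda>s. \<psi> s / s) = phi x"
      using eq[of x] by (simp add: dist_real_def abs_less_iff)
  qed simp
  then show ?thesis by simp
qed

lemma phi_continuous: "continuous_on {0<..} phi"
  by (rule continuous_at_imp_continuous_on) (auto intro: DERIV_isCont phi_deriv)

lemma phi_nonneg: "0 < t \<Longrightarrow> 0 \<le> phi t"
  unfolding phi_def set_lebesgue_integral_def
  by (intro Bochner_Integration.integral_nonneg) (auto simp: indicator_def intro!: divide_nonneg_pos less_imp_le[OF psi_pos])

lemma phi_strict_antimono:
  assumes "0 < s" "s < t" shows "phi t < phi s"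
proof (rule DERIV_neg_imp_decreasing[OF assms(2)])
  fix x assume "s \<le> x" "x \<le> t"
  then have "0 < x" using assms by simp
  then show "\<exists>y. (phi has_real_derivative y) (at x) \<and> y < 0"
    using phi_deriv[of x] psi_pos[of x] by (intro exI[of _ "- (\<psi> x / x)"]) auto
qed

lemma phi_antimono: "0 < s \<Longrightarrow> s \<le> t \<Longrightarrow> phi t \<le> phi s"
  using phi_strict_antimono[of s t] by (cases "s = t") auto

lemma phi_pos: "0 < t \<Longrightarrow> 0 < phi t"
  using phi_strict_antimono[of t "t + 1"] phi_nonneg[of "t + 1"] by simp

lemma phi_tendsto_0: "(phi \<longlongrightarrow> 0) at_top"
proof -
  have "((\<lambda>b. LINT s:{1..b}|lborel. \<psi> s / s) \<longlongrightarrow> phi 1) at_top"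
    unfolding phi_def by (rule tendsto_set_lebesgue_integral_at_top) (auto intro: phi_bar_finite)
  then have "((\<lambda>b. phi 1 - (LINT s:{1..b}|lborel. \<psi> s / s)) \<longlongrightarrow> phi 1 - phi 1) at_top"
    by (intro tendsto_diff tendsto_const)
  then have "((\<lambda>b. phi 1 - (LINT s:{1..b}|lborel. \<psi> s / s)) \<longlongrightarrow> 0) at_top" by simp
  then show ?thesis
  proof (rule Lim_transform_eventually)
    show "\<forall>\<^sub>F b in at_top. phi 1 - (LINT s:{1..b}|lborel. \<psi> s / s) = phi b"
      using eventually_ge_at_top[of "1::real"] by eventually_elim (use phi_split[of 1] in simp)
  qed
qed

lemma phi_joint_continuous: "continuous_on ({0<..} \<times> sphere (0::'a) 1) (\<lambda>(t, x). phi t)"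
proof -
  have "continuous_on ({0<..} \<times> sphere (0::'a) 1) (\<lambda>z. phi (fst z))"
    by (rule continuous_on_compose2[OF phi_continuous continuous_on_fst[OF continuous_on_id]]) auto
  then show ?thesis by (simp add: case_prod_unfold)
qed

lemma Phi_integrable: "pos_cont h \<Longrightarrow> integrable \<mu> (\<lambda>v. phi (h v))"
  using continuous_on_superposition[OF phi_joint_continuous, of h] unfolding pos_cont_def
  by (intro sphere_borel_integrable[OF sphere_borel_mu]) blast

lemma dual_volume_integrable: "pos_cont h \<Longrightarrow> integrable sphere_measure (\<lambda>u. G (1 / wulff_gauge h u) u)"
  by (intro sphere_borel_integrable[OF sphere_borel_sphere_measure]
      continuous_on_superposition[OF G_cont continuous_radial radial_pos])

lemma Phi_antimono:
  assumes "pos_cont h1" "pos_cont h2" "\<And>v. v \<in> sphere 0 1 \<Longrightarrow> h1 v \<le> h2 v"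
  shows "Phi h2 \<le> Phi h1"
  unfolding Phi_def
proof (intro integral_mono Phi_integrable assms(1,2))
  fix v assume "v \<in> space \<mu>"
  then have "v \<in> sphere 0 1" by (simp only: space_mu)
  then show "phi (h2 v) \<le> phi (h1 v)" using pos_cont_pos[OF assms(1)] assms(3) by (intro phi_antimono)
qed

text \<open>
  Suppose \<open>h w\<close> is small for some \<open>w\<close> close to \<open>v\<close>. Every \<open>u\<close> in the cap around \<open>v\<close> has
  \<open>w \<bullet> u > \<epsilon>\<^sub>0 / 2\<close>, so the half-space \<open>{x. w \<bullet> x \<le> h w}\<close> makes the radial function at \<open>u\<close> small
  and \<open>G\<close> at least \<open>G (t v) u\<close>. This contradicts the bound on the volume. Finitely many such \<open>v\<close>
  serve for all \<open>w\<close> by compactness of the sphere.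
\<close>

lemma inradius_bound:
  obtains r where "0 < r" "\<And>h v. pos_cont h \<Longrightarrow> dual_volume h \<le> c \<Longrightarrow> v \<in> sphere 0 1 \<Longrightarrow> r \<le> h v"
proof -
  have "\<forall>v\<in>sphere 0 1. \<exists>t>0. c < (LINT u:cap v|sphere_measure. G t u)"
    using cap_integral_large by blast
  from bchoice[OF this] obtain t where t: "\<And>v. v \<in> sphere 0 1 \<Longrightarrow> 0 < t v"
    "\<And>v. v \<in> sphere 0 1 \<Longrightarrow> c < (LINT u:cap v|sphere_measure. G (t v) u)" by blast
  have loc: "t v * (\<epsilon>\<^sub>0 / 2) \<le> h w" if v: "v \<in> sphere 0 1" and w: "w \<in> sphere 0 1" "dist v w < \<epsilon>\<^sub>0 / 2"
    and h: "pos_cont h" "dual_volume h \<le> c" for v w h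
  proof (rule ccontr)
    assume "\<not> ?thesis"
    then have hw: "h w < t v * (\<epsilon>\<^sub>0 / 2)" by simp
    note hp = pos_cont_pos[OF h(1) w(1)]
    have ge: "G (t v) u \<le> G (1 / wulff_gauge h u) u" if u: "u \<in> cap v" for u
    proof -
      have uS: "u \<in> sphere 0 1" and uv: "\<epsilon>\<^sub>0 \<le> u \<bullet> v" using u by (auto simp: cap_def)
      have "(v - w) \<bullet> u \<le> norm (v - w) * norm u" by (rule norm_cauchy_schwarz)
      then have "v \<bullet> u - w \<bullet> u < \<epsilon>\<^sub>0 / 2" using w(2) uS by (simp add: inner_diff_left dist_norm)
      then have wu: "\<epsilon>\<^sub>0 / 2 < w \<bullet> u" using uv by (simp add: inner_commute)
      have "w \<bullet> u \<le> h w * wulff_gauge h u" by (rule gauge_upper_mult[OF h(1) w(1)])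
      also have "\<dots> \<le> t v * (\<epsilon>\<^sub>0 / 2) * wulff_gauge h u"
        using hw by (intro mult_right_mono gauge_nonneg[OF h(1)]) auto
      finally have "\<epsilon>\<^sub>0 / 2 * 1 \<le> \<epsilon>\<^sub>0 / 2 * (t v * wulff_gauge h u)" using wu by (simp add: mult_ac)
      then have "1 \<le> t v * wulff_gauge h u" using eps(1) by (simp only: mult_le_cancel_left_pos half_gt_zero)
      then have "1 / wulff_gauge h u \<le> t v" using radial_pos[OF h(1) uS] by (simp add: divide_le_eq)
      then show ?thesis by (rule G_antimono[OF radial_pos[OF h(1) uS] _ uS])
    qed
    have "(LINT u:cap v|sphere_measure. G (t v) u) \<le> dual_volume h"
      unfolding set_lebesgue_integral_def dual_volume_def
    proof (rule integral_mono)
      show "integrable sphere_measure (\<lambda>u. G (1 / wulff_gauge h u) u)" by (rule dual_volume_integrable[OF h(1)])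
      show "integrable sphere_measure (\<lambda>u. indicator (cap v) u *\<^sub>R G (t v) u)"
        by (intro integrable_mult_indicator cap_measurable
            sphere_borel_integrable[OF sphere_borel_sphere_measure] G_continuous_sphere t v)
      fix u :: 'a assume "u \<in> space sphere_measure"
      then have uS: "u \<in> sphere 0 1" by (simp only: space_sphere_measure)
      show "indicator (cap v) u *\<^sub>R G (t v) u \<le> G (1 / wulff_gauge h u) u"
        using ge[of u] G_pos[OF radial_pos[OF h(1) uS] uS] by (cases "u \<in> cap v") auto
    qed
    then show False using t(2)[OF v] h(2) by simp
  qed
  have "sphere 0 1 \<subseteq> (\<Union>v\<in>sphere 0 1. ball (v::'a) (\<epsilon>\<^sub>0 / 2))" using eps(1) by force
  then obtain C where C: "C \<subseteq> sphere (0::'a) 1" "finite C" "sphere 0 1 \<subseteq> (\<Union>v\<in>C. ball v (\<epsilon>\<^sub>0 / 2))"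
    using compactE_image[OF compact_sphere, of "sphere 0 1" "\<lambda>v. ball (v::'a) (\<epsilon>\<^sub>0 / 2)"] open_ball by metis
  have ne: "C \<noteq> {}" using C(3) sphere_nonempty by blast
  define r where "r = Min ((\<lambda>v. t v * (\<epsilon>\<^sub>0 / 2)) ` C)"
  show thesis
  proof (rule that)
    have "r \<in> (\<lambda>v. t v * (\<epsilon>\<^sub>0 / 2)) ` C" unfolding r_def using C(2) ne by (intro Min_in) auto
    then obtain v where "v \<in> C" and r_eq: "r = t v * (\<epsilon>\<^sub>0 / 2)" by blast
    moreover have "0 < t v" using t(1) \<open>v \<in> C\<close> C(1) by blast
    ultimately show "0 < r" unfolding r_eq using eps(1) by (intro mult_pos_pos) auto
    fix h :: "'a \<Rightarrow> real" and w :: 'a assume h: "pos_cont h" "dual_volume h \<le> c" and w: "w \<in> sphere 0 1"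
    then obtain v where v: "v \<in> C" "dist v w < \<epsilon>\<^sub>0 / 2" using C(3) by auto
    have "r \<le> t v * (\<epsilon>\<^sub>0 / 2)" unfolding r_def using C(2) v(1) by (intro Min_le) auto
    also have "\<dots> \<le> h w" using v C(1) w h by (intro loc) auto
    finally show "r \<le> h w" .
  qed
qed

section \<open>Existence of a maximizer\<close>

text \<open>
  Competitors are functions rather than bodies, so that a deformation \<open>h * exp (t * f)\<close> is a
  competitor as soon as it respects the bound on the volume.
\<close>

definition admissible :: "real \<Rightarrow> ('a \<Rightarrow> real) \<Rightarrow> bool" where
  "admissible c h \<longleftrightarrow> pos_cont h \<and> (\<forall>v\<in>sphere 0 1. h (- v) = h v) \<and> dual_volume h \<le> c"

text \<open>
  The hypothesis \<open>lower\<close> expresses that a symmetric body contains a segment of length \<open>2 * n\<close> in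
  direction \<open>w n\<close>. For \<open>v\<close> not orthogonal to the limit \<open>w0\<close> the support function at \<open>v\<close> tends to
  infinity, and the exceptional great subsphere is a null set of \<open>\<mu>\<close>. The lower bound \<open>r\<close>
  dominates the integrands by \<open>phi r\<close>.
\<close>

lemma Phi_tendsto_0_of_elongation:
  assumes hn: "\<And>n. pos_cont (h n)" and r: "0 < r" "\<And>n v. v \<in> sphere 0 1 \<Longrightarrow> r \<le> h n v"
    and lower: "\<And>n v. v \<in> sphere 0 1 \<Longrightarrow> real n * \<bar>v \<bullet> w n\<bar> \<le> h n v"
    and w: "w \<longlonglongrightarrow> w0" "w0 \<in> sphere 0 1"
  shows "(\<lambda>n. Phi (h n)) \<longlonglongrightarrow> 0"
proof -
  interpret finite_measure \<mu> by (rule mu_finite)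
  have "(\<lambda>n. LINT v|\<mu>. phi (h n v)) \<longlonglongrightarrow> (LINT v|\<mu>. 0)"
  proof (rule integral_dominated_convergence[where w = "\<lambda>_. phi r"])
    show "(\<lambda>v. phi (h n v)) \<in> borel_measurable \<mu>" for n
      using Phi_integrable[OF hn] by (rule borel_measurable_integrable)
    show "AE v in \<mu>. norm (phi (h n v)) \<le> phi r" for n
    proof (rule AE_I2)
      fix v assume "v \<in> space \<mu>"
      then have v: "v \<in> sphere 0 1" by (simp only: space_mu)
      show "norm (phi (h n v)) \<le> phi r"
        using phi_antimono[OF r(1) r(2)[OF v, of n]] phi_nonneg[OF pos_cont_pos[OF hn v, of n]] by simp
    qed
    have set: "{u \<in> sphere 0 1. w0 \<bullet> u = 0} \<in> sets \<mu>"
    proof -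
      have "closed (sphere 0 1 \<inter> {u. w0 \<bullet> u = 0})"
        by (intro closed_Int closed_sphere closed_Collect_eq continuous_intros)
      also have "sphere 0 1 \<inter> {u. w0 \<bullet> u = 0} = {u \<in> sphere 0 1. w0 \<bullet> u = 0}" by blast
      finally have "{u \<in> sphere 0 1. w0 \<bullet> u = 0} \<in> sets borel" by (rule borel_closed)
      then show ?thesis unfolding mu_sets
        by (subst sets_restrict_space_iff) (simp_all add: borel_closed, auto)
    qed
    then have "{u \<in> sphere 0 1. w0 \<bullet> u = 0} \<in> null_sets \<mu>"
      using mu_subspheres[OF w(2)] by (simp add: null_sets_def)
    then have "AE v in \<mu>. v \<notin> {u \<in> sphere 0 1. w0 \<bullet> u = 0}" by (rule AE_not_in)
    moreover have "AE v in \<mu>. v \<in> sphere 0 1" by (rule AE_I2) (simp only: space_mu)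
    ultimately show "AE v in \<mu>. (\<lambda>n. phi (h n v)) \<longlonglongrightarrow> 0"
    proof eventually_elim
      case (elim v)
      have "(\<lambda>n. \<bar>v \<bullet> w n\<bar>) \<longlonglongrightarrow> \<bar>v \<bullet> w0\<bar>" by (intro tendsto_intros w)
      moreover have "0 < \<bar>v \<bullet> w0\<bar>" using elim by (simp add: inner_commute)
      ultimately have "filterlim (\<lambda>n. \<bar>v \<bullet> w n\<bar> * real n) at_top sequentially"
        by (intro filterlim_tendsto_pos_mult_at_top[OF _ _ filterlim_real_sequentially])
      then have "filterlim (\<lambda>n. h n v) at_top sequentially"
        by (rule filterlim_at_top_mono) (use lower[OF elim(2)] in \<open>simp add: mult.commute\<close>)
      then show ?case by (rule filterlim_compose[OF phi_tendsto_0])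
    qed
  qed simp_all
  then show ?thesis by (simp add: Phi_def)
qed

text \<open>
  Otherwise there are competitors that contain points \<open>x n\<close> of norm larger than \<open>n\<close>. By symmetry
  \<open>h n v \<ge> \<bar>v \<bullet> x n\<bar>\<close>, and along a subsequence for which the directions of the \<open>x n\<close> converge,
  \<open>Phi\<close> would tend to zero.
\<close>

lemma circumradius_bound:
  assumes "0 < m"
  obtains R where "\<And>h v. admissible c h \<Longrightarrow> (\<And>v. v \<in> sphere 0 1 \<Longrightarrow> support_fun (wulff h) v = h v) \<Longrightarrow>
    m \<le> Phi h \<Longrightarrow> v \<in> sphere 0 1 \<Longrightarrow> h v \<le> R"
proof (rule ccontr)
  assume neg: "\<not> thesis"
  define good where "good h \<longleftrightarrow> admissible c h \<and> (\<forall>v\<in>sphere 0 1. support_fun (wulff h) v = h v) \<and> m \<le> Phi h" for h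
  have "\<exists>h x. good h \<and> x \<in> wulff h \<and> real n < norm x" for n :: nat
  proof (rule ccontr)
    assume c: "\<not> ?thesis"
    have "h v \<le> real n" if h: "good h" and v: "v \<in> sphere 0 1" for h v
    proof -
      have K: "wulff h \<in> convex_bodies_o"
        using h by (intro wulff_convex_body) (simp add: good_def admissible_def)
      have "support_fun (wulff h) v \<le> real n"
      proof (rule support_least[OF K])
        fix x assume x: "x \<in> wulff h"
        have "v \<bullet> x \<le> norm v * norm x" by (rule norm_cauchy_schwarz)
        also have "\<dots> \<le> real n" using c h x v by (force simp: not_less)
        finally show "v \<bullet> x \<le> real n" .
      qed
      then show ?thesis using h v by (simp add: good_def)
    qed
    then show False using neg that[of "real n"] unfolding good_def by blast
  qed
  then have "\<forall>n. \<exists>p. good (fst p) \<and> snd p \<in> wulff (fst p) \<and> real n < norm (snd p)" by auto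
  from choice[OF this] obtain p where p: "\<And>n. good (fst (p n))" "\<And>n. snd (p n) \<in> wulff (fst (p n))"
    "\<And>n. real n < norm (snd (p n))" by blast
  define h where "h n = fst (p n)" for n
  define x where "x n = snd (p n)" for n
  define w where "w n = x n /\<^sub>R norm (x n)" for n
  have hg: "good (h n)" and xh: "x n \<in> wulff (h n)" and xn: "real n < norm (x n)" for n
    using p by (auto simp: h_def x_def)
  have nz: "x n \<noteq> 0" for n using xn[of n] by auto
  have pc: "pos_cont (h n)" and ev: "v \<in> sphere 0 1 \<Longrightarrow> h n (- v) = h n v"
    and vol: "dual_volume (h n) \<le> c" and ph: "m \<le> Phi (h n)" for n v
    using hg[of n] unfolding good_def admissible_def by blast+
  have wS: "w n \<in> sphere 0 1" for n using nz by (simp add: w_def)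
  have low: "real n * \<bar>v \<bullet> w n\<bar> \<le> h n v" if v: "v \<in> sphere 0 1" for n v
  proof -
    have "- v \<in> sphere 0 1" using v by simp
    then have "- v \<bullet> x n \<le> h n (- v)" using xh unfolding wulff_def by blast
    moreover have "v \<bullet> x n \<le> h n v" using xh v unfolding wulff_def by blast
    ultimately have "\<bar>v \<bullet> x n\<bar> \<le> h n v" using ev[OF v] by (simp add: abs_le_iff)
    moreover have "real n * \<bar>v \<bullet> w n\<bar> \<le> norm (x n) * \<bar>v \<bullet> w n\<bar>"
      using xn[of n] by (intro mult_right_mono) auto
    moreover have "norm (x n) * \<bar>v \<bullet> w n\<bar> = \<bar>v \<bullet> x n\<bar>" using nz by (simp add: w_def abs_mult)
    ultimately show ?thesis by simp
  qed
  obtain r where r: "0 < r" "\<And>h v. pos_cont h \<Longrightarrow> dual_volume h \<le> c \<Longrightarrow> v \<in> sphere 0 1 \<Longrightarrow> r \<le> h v"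
    by (rule inradius_bound[of c]) blast
  obtain w0 k where k: "w0 \<in> sphere 0 1" "strict_mono k" "(w \<circ> k) \<longlonglongrightarrow> w0"
    by (rule seq_compactE[OF compact_imp_seq_compact[OF compact_sphere] allI[OF wS]])
  have "(\<lambda>n. Phi (h (k n))) \<longlonglongrightarrow> 0"
  proof (rule Phi_tendsto_0_of_elongation[OF pc r(1) _ _ k(3) k(1)])
    show "r \<le> h (k n) v" if "v \<in> sphere 0 1" for n v by (rule r(2)[OF pc vol that])
    show "real n * \<bar>v \<bullet> (w \<circ> k) n\<bar> \<le> h (k n) v" if "v \<in> sphere 0 1" for n v
    proof -
      have "real n * \<bar>v \<bullet> w (k n)\<bar> \<le> real (k n) * \<bar>v \<bullet> w (k n)\<bar>"
        using seq_suble[OF k(2), of n] by (intro mult_right_mono) auto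
      then show ?thesis using low[OF that, of "k n"] by simp
    qed
  qed
  then have "m \<le> 0" by (rule LIMSEQ_le_const) (use ph in auto)
  then show False using assms by simp
qed

text \<open>
  Passing to the support function keeps the Wulff shape and does not lower \<open>Phi\<close>, so maximizers
  may be sought among support functions.
\<close>

lemma support_normalization:
  assumes "admissible c h"
  defines "h' \<equiv> support_fun (wulff h)"
  shows "admissible c h'" "\<And>v. support_fun (wulff h') v = h' v" "Phi h \<le> Phi h'"
    "dual_volume h' = dual_volume h" "\<And>v. h' (- v) = h' v"
proof -
  have h: "pos_cont h" "\<And>v. v \<in> sphere 0 1 \<Longrightarrow> h (- v) = h v" "dual_volume h \<le> c"
    using assms(1) unfolding admissible_def by blast+
  have pc: "pos_cont h'" unfolding h'_def by (rule pos_cont_support[OF wulff_convex_body[OF h(1)]])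
  show vol: "dual_volume h' = dual_volume h"
    unfolding dual_volume_def h'_def wulff_support_wulff(2)[OF h(1)] ..
  show ev: "h' (- v) = h' v" for v
    unfolding h'_def by (rule support_uminus[OF uminus_image_wulff[of h, OF h(2)]])
  show "admissible c h'" using pc ev vol h(3) by (simp add: admissible_def)
  show "support_fun (wulff h') v = h' v" for v
    unfolding h'_def wulff_support_wulff(1)[OF h(1)] ..
  show "Phi h \<le> Phi h'"
    by (rule Phi_antimono[OF pc h(1) support_wulff_le[OF h(1), folded h'_def]])
qed

lemma limit_admissible:
  assumes hn: "\<And>n. admissible c (h n)" and r: "0 < r" "\<And>n v. v \<in> sphere 0 1 \<Longrightarrow> r \<le> h n v"
    and R: "\<And>n v. v \<in> sphere 0 1 \<Longrightarrow> h n v \<le> R"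
    and g: "continuous_on (sphere 0 1) g"
    and unif: "\<And>e. 0 < e \<Longrightarrow> \<exists>N. \<forall>n v. N \<le> n \<and> v \<in> sphere 0 1 \<longrightarrow> \<bar>h n v - g v\<bar> < e"
  shows "admissible c g" "(\<lambda>n. Phi (h n)) \<longlonglongrightarrow> Phi g"
proof -
  have pc: "pos_cont (h n)" and ev: "v \<in> sphere 0 1 \<Longrightarrow> h n (- v) = h n v"
    and vol: "dual_volume (h n) \<le> c" for n v
    using hn[of n] unfolding admissible_def by blast+
  have lim: "(\<lambda>n. h n v) \<longlonglongrightarrow> g v" if v: "v \<in> sphere 0 1" for v
    unfolding LIMSEQ_iff real_norm_def using unif v by blast
  have gr: "r \<le> g v" if "v \<in> sphere 0 1" for v
    using lim[OF that] by (rule LIMSEQ_le_const) (use r(2)[OF that] in auto)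
  have gR: "g v \<le> R" if "v \<in> sphere 0 1" for v
    using lim[OF that] by (rule LIMSEQ_le_const2) (use R[OF that] in auto)
  have "0 < g v" if "v \<in> sphere 0 1" for v using gr[OF that] r(1) by linarith
  then have pg: "pos_cont g" unfolding pos_cont_def using g by blast
  have evg: "g (- v) = g v" if v: "v \<in> sphere 0 1" for v
  proof (rule LIMSEQ_unique)
    have "- v \<in> sphere 0 1" using v by simp
    from lim[OF this] show "(\<lambda>n. h n v) \<longlonglongrightarrow> g (- v)" using ev[OF v] by simp
  qed (rule lim[OF v])
  have glim: "(\<lambda>n. wulff_gauge (h n) u) \<longlonglongrightarrow> wulff_gauge g u" if u: "u \<in> sphere 0 1" for u
    unfolding LIMSEQ_iff
  proof (intro allI impI)
    fix e :: real assume "0 < e"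
    then have "0 < e / 2 * r\<^sup>2" using r(1) by simp
    then obtain N where N: "\<And>n v. N \<le> n \<Longrightarrow> v \<in> sphere 0 1 \<Longrightarrow> \<bar>h n v - g v\<bar> < e / 2 * r\<^sup>2"
      using unif by blast
    have "norm (wulff_gauge (h n) u - wulff_gauge g u) < e" if n: "N \<le> n" for n
    proof -
      have "\<bar>wulff_gauge (h n) u - wulff_gauge g u\<bar> \<le> (e / 2 * r\<^sup>2) / r\<^sup>2"
        by (rule gauge_diff_bound[OF pc pg r(1) r(2) gr less_imp_le[OF N[OF n]] u])
      also have "\<dots> < e" using r(1) \<open>0 < e\<close> by simp
      finally show ?thesis by simp
    qed
    then show "\<exists>no. \<forall>n\<ge>no. norm (wulff_gauge (h n) u - wulff_gauge g u) < e" by blast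
  qed
  have "(\<lambda>n. dual_volume (h n)) \<longlonglongrightarrow> dual_volume g"
    unfolding dual_volume_def
  proof (rule integral_superposition_tendsto[OF sphere_borel_sphere_measure G_cont r(1)])
    show "1 / wulff_gauge (h n) u \<in> {r..R}" if "u \<in> sphere 0 1" for n u
      by (rule radial_in_Icc[OF pc r(1) r(2) R that])
    show "1 / wulff_gauge g u \<in> {r..R}" if "u \<in> sphere 0 1" for u
      by (rule radial_in_Icc[OF pg r(1) gr gR that])
    show "(\<lambda>n. 1 / wulff_gauge (h n) u) \<longlonglongrightarrow> 1 / wulff_gauge g u" if u: "u \<in> sphere 0 1" for u
      using gauge_pos_sphere[OF pg u] by (intro tendsto_divide tendsto_const glim u) simp
  qed (rule continuous_radial[OF pc] continuous_radial[OF pg])+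
  then have "dual_volume g \<le> c" by (rule LIMSEQ_le_const2) (use vol in auto)
  then show "admissible c g" using pg evg by (simp add: admissible_def)
  show "(\<lambda>n. Phi (h n)) \<longlonglongrightarrow> Phi g"
    unfolding Phi_def
    by (rule integral_superposition_tendsto[OF sphere_borel_mu phi_joint_continuous r(1), where b = R])
       (use pc pg r(2) R gr gR lim in \<open>simp_all add: pos_cont_def\<close>)
qed

text \<open>
  The direct method. A maximizing sequence is normalized to support functions, which lie between
  the inradius bound and the circumradius bound. A uniform limit is admissible and attains the
  supremum, and is normalized once more.
\<close>

lemma maximizer_exists:
  obtains h where "admissible (dual_volume (\<lambda>_. 1)) h"
    "\<And>v. support_fun (wulff h) v = h v" "\<And>v. h (- v) = h v"
    "\<And>h'. admissible (dual_volume (\<lambda>_. 1)) h' \<Longrightarrow> Phi h' \<le> Phi h"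
proof -
  define c where "c = dual_volume (\<lambda>_. 1)"
  have one: "admissible c (\<lambda>_. 1)" by (simp add: admissible_def c_def pos_cont_def)
  have Phi1: "0 < Phi (\<lambda>_. 1)"
    using mu_pos phi_pos[of 1] by (simp add: Phi_def space_mu)
  obtain r where r: "0 < r" "\<And>h v. pos_cont h \<Longrightarrow> dual_volume h \<le> c \<Longrightarrow> v \<in> sphere 0 1 \<Longrightarrow> r \<le> h v"
    by (rule inradius_bound[of c]) blast
  have bdd: "Phi h \<le> phi r * measure \<mu> (sphere 0 1)" if "admissible c h" for h
  proof -
    interpret finite_measure \<mu> by (rule mu_finite)
    have h: "pos_cont h" "dual_volume h \<le> c" using that unfolding admissible_def by blast+
    have "Phi h \<le> (LINT v|\<mu>. phi r)" unfolding Phi_def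
    proof (rule integral_mono[OF Phi_integrable[OF h(1)]])
      show "integrable \<mu> (\<lambda>v. phi r)" by simp
      fix v assume "v \<in> space \<mu>"
      then have "v \<in> sphere 0 1" by (simp only: space_mu)
      then show "phi (h v) \<le> phi r" by (intro phi_antimono r h)
    qed
    then show ?thesis by (simp add: space_mu mult.commute)
  qed
  define s where "s = Sup (Phi ` Collect (admissible c))"
  have ba: "bdd_above (Phi ` Collect (admissible c))" using bdd by (intro bdd_aboveI2) auto
  have le_s: "Phi h \<le> s" if "admissible c h" for h
    unfolding s_def using that by (intro cSUP_upper[OF _ ba]) simp
  have s: "0 < s" using le_s[OF one] Phi1 by simp
  \<comment> \<open>The defect \<open>s / (n + 2)\<close> tends to zero and is at most \<open>s / 2\<close>, so that \<open>Phi\<close> stays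
    above the positive level \<open>s / 2\<close> for which there is a circumradius bound.\<close>
  have "\<exists>h. admissible c h \<and> s - s / real (n + 2) < Phi h" for n
  proof -
    have "s - s / real (n + 2) < s" using s by simp
    then have "s - s / real (n + 2) < (SUP h\<in>Collect (admissible c). Phi h)" by (simp only: s_def)
    then have "\<exists>h\<in>Collect (admissible c). s - s / real (n + 2) < Phi h"
      by (subst (asm) less_cSUP_iff[OF _ ba]) (use one in blast)+
    then show ?thesis by blast
  qed
  then have "\<forall>n. \<exists>h. admissible c h \<and> s - s / real (n + 2) < Phi h" ..
  from choice[OF this] obtain f where f: "\<And>n. admissible c (f n)" "\<And>n. s - s / real (n + 2) < Phi (f n)" by blast
  define h where "h n = support_fun (wulff (f n))" for n
  note norm = support_normalization[OF f(1), folded h_def]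
  have pc: "pos_cont (h n)" and vol: "dual_volume (h n) \<le> c" for n
    using norm(1)[of n] unfolding admissible_def by blast+
  have Phi_ge: "s - s / real (n + 2) < Phi (h n)" for n using f(2)[of n] norm(3)[of n] by simp
  have half: "s / 2 \<le> Phi (h n)" for n
  proof -
    have "s / real (n + 2) \<le> s / 2" using s by (intro divide_left_mono) auto
    then show ?thesis using Phi_ge[of n] by linarith
  qed
  obtain R where R0: "\<And>h v. admissible c h \<Longrightarrow> (\<And>v. v \<in> sphere 0 1 \<Longrightarrow> support_fun (wulff h) v = h v) \<Longrightarrow>
    s / 2 \<le> Phi h \<Longrightarrow> v \<in> sphere 0 1 \<Longrightarrow> h v \<le> R"
    by (rule circumradius_bound[of "s / 2" c]) (use s in \<open>simp, blast\<close>)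
  have R: "h n v \<le> R" if "v \<in> sphere 0 1" for n v
    by (rule R0[OF norm(1) norm(2) half that])
  have rh: "r \<le> h n v" if "v \<in> sphere 0 1" for n v by (rule r(2)[OF pc vol that])
  have lip: "\<bar>h n v - h n w\<bar> \<le> R * norm (v - w)" for n v w
    using support_wulff_lipschitz[OF pc R, of n v w] by (simp add: norm(2))
  obtain u :: 'a where u: "u \<in> sphere 0 1" using sphere_nonempty by blast
  have Rpos: "0 < R" using r(1) rh[OF u, of 0] R[OF u, of 0] by linarith
  obtain g k where g: "continuous_on (sphere 0 1) g" "strict_mono (k :: nat \<Rightarrow> nat)"
    "\<And>e. 0 < e \<Longrightarrow> \<exists>N. \<forall>n x. N \<le> n \<and> x \<in> sphere 0 1 \<longrightarrow> norm (h (k n) x - g x) < e"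
  proof (rule Arzela_Ascoli[OF compact_sphere, of "0::'a" 1 h R])
    fix n and x :: 'a assume x: "x \<in> sphere 0 1"
    show "norm (h n x) \<le> R" using R[OF x] pos_cont_pos[OF pc x] by (simp add: less_imp_le)
  next
    fix x :: 'a and e :: real assume "x \<in> sphere 0 1" "0 < e"
    show "\<exists>d>0. \<forall>n y. y \<in> sphere 0 1 \<and> norm (x - y) < d \<longrightarrow> norm (h n x - h n y) < e"
    proof (intro exI[of _ "e / R"] conjI allI impI)
      show "0 < e / R" using \<open>0 < e\<close> Rpos by simp
      fix n y assume "y \<in> sphere 0 1 \<and> norm (x - y) < e / R"
      then have "R * norm (x - y) < e" using Rpos by (simp add: field_simps)
      then show "norm (h n x - h n y) < e" using lip[of n x y] by simp
    qed
  qed blast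
  have lim: "admissible c g" "(\<lambda>n. Phi (h (k n))) \<longlonglongrightarrow> Phi g"
    using limit_admissible[OF norm(1) r(1) rh R g(1), of "\<lambda>n. k n"] g(3) unfolding real_norm_def by blast+
  have "s \<le> Phi g"
  proof (rule LIMSEQ_le[OF _ lim(2)])
    have "(\<lambda>n. s - s / real (n + 2)) \<longlonglongrightarrow> s - 0"
      by (intro tendsto_intros LIMSEQ_ignore_initial_segment lim_const_over_n)
    then have "(\<lambda>n. s - s / real (k n + 2)) \<longlonglongrightarrow> s"
      using LIMSEQ_subseq_LIMSEQ[OF _ g(2)] by (fastforce simp: o_def)
    then show "(\<lambda>n. s - s / real (k n + 2)) \<longlonglongrightarrow> s" .
    show "\<exists>N. \<forall>n\<ge>N. s - s / real (k n + 2) \<le> Phi (h (k n))" using Phi_ge less_imp_le by blast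
  qed
  note fin = support_normalization[OF lim(1)]
  show thesis
  proof (rule that[of "support_fun (wulff g)"])
    show "Phi h' \<le> Phi (support_fun (wulff g))" if "admissible (dual_volume (\<lambda>_. 1)) h'" for h'
      using le_s[of h'] that \<open>s \<le> Phi g\<close> fin(3) by (simp add: c_def)
  qed (use fin in \<open>simp_all add: c_def\<close>)
qed

section \<open>The Euler-Lagrange equation\<close>

text \<open>
  Minus the density of the first variation of \<open>dual_volume\<close>, positive because \<open>G\<^sub>t < 0\<close>.
\<close>

definition vol_density :: "('a \<Rightarrow> real) \<Rightarrow> 'a \<Rightarrow> real" where
  "vol_density h u = - (1 / wulff_gauge h u * partial_t G (1 / wulff_gauge h u) u)"

lemma vol_density_continuous: "pos_cont h \<Longrightarrow> continuous_on (sphere 0 1) (vol_density h)"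
  unfolding vol_density_def[abs_def]
  by (intro continuous_on_minus continuous_on_mult continuous_radial
      continuous_on_superposition[OF Gt_cont continuous_radial radial_pos])

lemma vol_density_pos: "pos_cont h \<Longrightarrow> u \<in> sphere 0 1 \<Longrightarrow> 0 < vol_density h u"
  unfolding vol_density_def
  using mult_pos_neg[OF radial_pos Gt_neg[OF radial_pos], of h u h u u] by simp

text \<open>
  If the derivative of the volume along \<open>h * exp (t * f)\<close> is negative, the deformed function is
  admissible for small \<open>t > 0\<close>, so \<open>Phi\<close> does not increase and has derivative
  \<open>- \<integral> \<psi>(h) f d\<mu> \<le> 0\<close>.
\<close>

lemma first_variation_sign:
  assumes adm: "admissible c h"
    and max: "\<And>h'. admissible c h' \<Longrightarrow> Phi h' \<le> Phi h"
    and f: "continuous_on (sphere 0 1) f" "\<And>v. v \<in> sphere 0 1 \<Longrightarrow> f (- v) = f v"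
    and pos: "0 < (LINT u|sphere_measure. vol_density h u * f (normal_map h u))"
  shows "0 \<le> (LINT v|\<mu>. \<psi> (h v) * f v)"
proof -
  have h: "pos_cont h" "\<And>v. v \<in> sphere 0 1 \<Longrightarrow> h (- v) = h v" "dual_volume h \<le> c"
    using adm unfolding admissible_def by blast+
  have hc: "continuous_on (sphere 0 1) h" using h(1) by (simp add: pos_cont_def)
  obtain M where M: "\<And>v. v \<in> sphere 0 1 \<Longrightarrow> \<bar>f v\<bar> \<le> M"
    by (rule continuous_on_sphere_bounded[OF f(1)]) blast
  obtain r R where r: "0 < r" "\<And>v. v \<in> sphere 0 1 \<Longrightarrow> r \<le> h v" and R: "\<And>v. v \<in> sphere 0 1 \<Longrightarrow> h v \<le> R"
    by (rule pos_cont_bounds[OF h(1)]) blast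
  obtain u0 :: 'a where u0: "u0 \<in> sphere 0 1" using sphere_nonempty by blast
  have M0: "0 \<le> M" using M[OF u0] by simp
  have R0: "0 < R" using r(1) r(2)[OF u0] R[OF u0] by linarith
  define t where "t n = 1 / real (Suc n)" for n
  have t: "0 < t n" "t n \<le> 1" for n by (auto simp: t_def)
  have t0: "t \<longlonglongrightarrow> 0" unfolding t_def by (rule LIMSEQ_Suc[OF lim_const_over_n])
  define hn where "hn n v = h v * exp (t n * f v)" for n v
  have hn: "pos_cont (hn n)" for n unfolding hn_def by (rule pos_cont_exp[OF h(1) f(1)])
  \<comment> \<open>For \<open>0 \<le> t \<le> 1\<close> all functions that occur take values in
    \<open>{exp (- M) * r..exp M * R}\<close>.\<close>
  have ep: "0 < exp (- M) * r" using r(1) by simp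
  have expM: "1 \<le> exp M" "exp (- M) \<le> 1" using M0 by auto
  have rad: "1 / wulff_gauge h u \<in> {r..R}" if "u \<in> sphere 0 1" for u
    by (rule radial_in_Icc[OF h(1) r(1) r(2) R that])
  have strip: "exp (- M) * r \<le> r" "R \<le> exp M * R"
    using mult_right_mono[OF expM(2), of r] mult_right_mono[OF expM(1), of R] r(1) R0 by auto
  have dvol: "(\<lambda>n. (dual_volume (hn n) - dual_volume h) / t n) \<longlonglongrightarrow>
     (LINT u|sphere_measure. partial_t G (1 / wulff_gauge h u) u * (1 / wulff_gauge h u * f (normal_map h u)))"
    unfolding dual_volume_def
  proof (rule integral_superposition_derivative[OF sphere_borel_sphere_measure G_cont Gt_cont G_deriv ep])
    show "1 / wulff_gauge (hn n) u \<in> {exp (- M) * r..exp M * R}" if u: "u \<in> sphere 0 1" for n u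
    proof -
      have "exp (- M) * r \<le> exp (- M) * (1 / wulff_gauge h u)" "exp M * (1 / wulff_gauge h u) \<le> exp M * R"
        using rad[OF u] by (auto intro!: mult_left_mono simp del: times_divide_eq_right)
      then show ?thesis
        using radial_exp_bound(2,3)[OF h(1) f(1) M less_imp_le[OF t(1)] t(2) u, of n] unfolding hn_def by auto
    qed
    show "1 / wulff_gauge h u \<in> {exp (- M) * r..exp M * R}" if u: "u \<in> sphere 0 1" for u
      using rad[OF u] strip by auto
    show "\<bar>1 / wulff_gauge (hn n) u - 1 / wulff_gauge h u\<bar> \<le> R * (M * exp M) * t n" if u: "u \<in> sphere 0 1" for n u
    proof -
      have "\<bar>1 / wulff_gauge (hn n) u - 1 / wulff_gauge h u\<bar> \<le> 1 / wulff_gauge h u * (M * exp M) * t n"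
        unfolding hn_def by (rule radial_exp_bound(1)[OF h(1) f(1) M less_imp_le[OF t(1)] t(2) u])
      also have "\<dots> \<le> R * (M * exp M) * t n"
        using rad[OF u] M0 t(1)[of n] by (intro mult_right_mono) auto
      finally show ?thesis .
    qed
    show "(\<lambda>u. 1 / wulff_gauge h u * f (normal_map h u)) \<in> borel_measurable sphere_measure"
      by (intro borel_measurable_times measurable_continuous_normal_map[OF h(1) f(1)]
          continuous_on_measurable_sphere continuous_radial h(1))
    have "AE u in (sphere_measure :: 'a measure). u \<in> sphere 0 1" by (rule AE_I2) simp
    with AE_unique_touching[OF h(1)]
    show "AE u in sphere_measure. (\<lambda>n. (1 / wulff_gauge (hn n) u - 1 / wulff_gauge h u) / t n) \<longlonglongrightarrow>
       1 / wulff_gauge h u * f (normal_map h u)"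
    proof eventually_elim
      case (elim u)
      show ?case unfolding hn_def by (rule radial_first_variation[OF h(1) f(1) elim t0 t(1)])
    qed
  qed (use t t0 in \<open>auto intro: continuous_radial[OF hn] continuous_radial[OF h(1)]\<close>)
  have "(LINT u|sphere_measure. partial_t G (1 / wulff_gauge h u) u * (1 / wulff_gauge h u * f (normal_map h u)))
    = (LINT u|sphere_measure. - (vol_density h u * f (normal_map h u)))"
    by (rule Bochner_Integration.integral_cong) (auto simp: vol_density_def)
  also have "\<dots> < 0" using pos by simp
  finally have "\<forall>\<^sub>F n in sequentially. (dual_volume (hn n) - dual_volume h) / t n < 0"
    by (rule order_tendstoD(2)[OF dvol])
  then have ev: "\<forall>\<^sub>F n in sequentially. (Phi (hn n) - Phi h) / t n \<le> 0"
  proof eventually_elim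
    case (elim n)
    then have "dual_volume (hn n) < dual_volume h" using t(1)[of n] by (simp add: divide_less_0_iff not_less)
    then have "admissible c (hn n)"
      using hn[of n] h f(2) by (simp add: admissible_def hn_def)
    then have "Phi (hn n) \<le> Phi h" by (rule max)
    then show ?case using t(1)[of n] by (simp add: divide_nonpos_pos)
  qed
  have dphi: "(\<lambda>n. (Phi (hn n) - Phi h) / t n) \<longlonglongrightarrow> (LINT v|\<mu>. - (\<psi> (h v) / h v) * (h v * f v))"
    unfolding Phi_def
  proof (rule integral_superposition_derivative[OF sphere_borel_mu phi_joint_continuous _ phi_deriv ep])
    have "continuous_on ({0<..} \<times> sphere (0::'a) 1) (\<lambda>z. - (\<psi> (fst z) / fst z))"
      by (intro continuous_intros continuous_on_compose2[OF psi_cont continuous_on_fst[OF continuous_on_id]]) auto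
    then show "continuous_on ({0<..} \<times> sphere (0::'a) 1) (\<lambda>(t, x). - (\<psi> t / t))"
      by (simp add: case_prod_unfold)
    show "continuous_on (sphere 0 1) (hn n)" for n using hn[of n] by (simp add: pos_cont_def)
    show "hn n v \<in> {exp (- M) * r..exp M * R}" if v: "v \<in> sphere 0 1" for n v
    proof -
      have "\<bar>t n * f v\<bar> \<le> M"
        using mult_mono[OF t(2)[of n] M[OF v]] t(1)[of n] by (simp add: abs_mult)
      then have "exp (- M) \<le> exp (t n * f v)" "exp (t n * f v) \<le> exp M" by (auto simp: abs_le_iff)
      then have "r * exp (- M) \<le> h v * exp (t n * f v)" "h v * exp (t n * f v) \<le> R * exp M"
        using r(1) r(2)[OF v] R[OF v] R0 by (auto intro!: mult_mono)
      then show ?thesis by (simp add: hn_def mult.commute)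
    qed
    show "h v \<in> {exp (- M) * r..exp M * R}" if v: "v \<in> sphere 0 1" for v
      using r(2)[OF v] R[OF v] strip by auto
    show "\<bar>hn n v - h v\<bar> \<le> R * (M * exp M) * t n" if v: "v \<in> sphere 0 1" for n v
    proof -
      have "hn n v - h v = h v * (exp (t n * f v) - 1)" by (simp add: hn_def algebra_simps)
      then have "\<bar>hn n v - h v\<bar> = h v * \<bar>exp (t n * f v) - 1\<bar>"
        using pos_cont_pos[OF h(1) v] by (simp add: abs_mult)
      also have "\<dots> \<le> R * (M * exp M * t n)"
        using R[OF v] R0 exp_minus_one_bound[OF less_imp_le[OF t(1)] t(2) M[OF v], of n] by (intro mult_mono) auto
      finally show ?thesis by (simp add: mult.assoc)
    qed
    have "(\<lambda>v. h v * f v) \<in> borel_measurable \<mu>"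
      using sphere_borel_mu continuous_on_mult[OF hc f(1)] unfolding sphere_borel_def by blast
    then show "(\<lambda>v. h v * f v) \<in> borel_measurable \<mu>" .
    show "AE v in \<mu>. (\<lambda>n. (hn n v - h v) / t n) \<longlonglongrightarrow> h v * f v"
    proof (rule AE_I2)
      fix v
      have "(\<lambda>n. h v * ((exp (t n * f v) - 1) / t n)) \<longlonglongrightarrow> h v * f v"
        by (intro tendsto_mult tendsto_const exp_quotient_tendsto t0 t)
      then show "(\<lambda>n. (hn n v - h v) / t n) \<longlonglongrightarrow> h v * f v" by (simp add: hn_def algebra_simps)
    qed
  qed (use t t0 hc in auto)
  have "(LINT v|\<mu>. - (\<psi> (h v) / h v) * (h v * f v)) = (LINT v|\<mu>. - (\<psi> (h v) * f v))"
  proof (rule Bochner_Integration.integral_cong)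
    fix v assume "v \<in> space \<mu>"
    then have "v \<in> sphere 0 1" by (simp only: space_mu)
    then show "- (\<psi> (h v) / h v) * (h v * f v) = - (\<psi> (h v) * f v)" using pos_cont_pos[OF h(1)] by fastforce
  qed simp
  moreover have "(LINT v|\<mu>. - (\<psi> (h v) / h v) * (h v * f v)) \<le> 0"
    by (rule tendsto_upperbound[OF dphi ev]) simp
  ultimately show ?thesis by simp
qed

text \<open>
  The functionals \<open>A f = \<integral> vol_density f(\<alpha>) du\<close> and \<open>B f = \<integral> \<psi>(h) f d\<mu>\<close> satisfy
  \<open>A f > 0 \<Longrightarrow> B f \<ge> 0\<close> on even functions, and both are positive at the constant 1. Applied to
  \<open>f + k\<close> with the constant \<open>k\<close> chosen such that \<open>A (f + k) = d * A 1\<close>, this gives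
  \<open>B f \<ge> (A f / A 1) B 1 - d * B 1\<close> for every \<open>d > 0\<close>. The same bound for \<open>- f\<close> gives equality,
  with multiplier \<open>B 1 / A 1\<close>.
\<close>

lemma euler_lagrange:
  assumes adm: "admissible c h"
    and max: "\<And>h'. admissible c h' \<Longrightarrow> Phi h' \<le> Phi h"
  obtains \<Lambda> where "0 < \<Lambda>"
    "\<And>f. continuous_on (sphere 0 1) f \<Longrightarrow> (\<And>v. v \<in> sphere 0 1 \<Longrightarrow> f (- v) = f v) \<Longrightarrow>
      (LINT v|\<mu>. \<psi> (h v) * f v) = \<Lambda> * (LINT u|sphere_measure. vol_density h u * f (normal_map h u))"
proof -
  have h: "pos_cont h" using adm unfolding admissible_def by blast
  have psih: "continuous_on (sphere 0 1) (\<lambda>v. \<psi> (h v))"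
    by (rule continuous_on_compose2[OF psi_cont]) (use h in \<open>auto simp: pos_cont_def\<close>)
  define A where "A f = (LINT u|sphere_measure. vol_density h u * f (normal_map h u))" for f :: "'a \<Rightarrow> real"
  define B where "B f = (LINT v|\<mu>. \<psi> (h v) * f v)" for f :: "'a \<Rightarrow> real"
  have iA: "integrable sphere_measure (\<lambda>u. vol_density h u * f (normal_map h u))"
    if f: "continuous_on (sphere 0 1) f" for f
  proof -
    obtain M where M: "\<And>v. v \<in> sphere 0 1 \<Longrightarrow> \<bar>f v\<bar> \<le> M"
      by (rule continuous_on_sphere_bounded[OF f]) blast
    obtain D where D: "\<And>v. v \<in> sphere 0 1 \<Longrightarrow> \<bar>vol_density h v\<bar> \<le> D"
      by (rule continuous_on_sphere_bounded[OF vol_density_continuous[OF h]]) blast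
    show ?thesis
    proof (rule sphere_borel_integrable_bounded[OF sphere_borel_sphere_measure])
      show "(\<lambda>u. vol_density h u * f (normal_map h u)) \<in> borel_measurable sphere_measure"
        by (intro borel_measurable_times measurable_continuous_normal_map[OF h f]
            continuous_on_measurable_sphere vol_density_continuous h)
      show "\<bar>vol_density h u * f (normal_map h u)\<bar> \<le> D * M" if u: "u \<in> sphere 0 1" for u
        unfolding abs_mult using D[OF u] M[OF normal_map_in_sphere] by (intro mult_mono) auto
    qed
  qed
  have iB: "integrable \<mu> (\<lambda>v. \<psi> (h v) * f v)" if "continuous_on (sphere 0 1) f" for f
    by (intro sphere_borel_integrable[OF sphere_borel_mu] continuous_on_mult psih that)
  have Aadd: "A (\<lambda>v. s * f v + d) = s * A f + d * A (\<lambda>_. 1)" if f: "continuous_on (sphere 0 1) f" for f s d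
  proof -
    have "A (\<lambda>v. s * f v + d) = (LINT u|sphere_measure. s * (vol_density h u * f (normal_map h u)) + d * (vol_density h u * 1))"
      unfolding A_def by (rule Bochner_Integration.integral_cong) (auto simp: algebra_simps)
    also have "\<dots> = s * A f + d * A (\<lambda>_. 1)" unfolding A_def
      using iA[OF f] iA[OF continuous_on_const, of 1] by (subst Bochner_Integration.integral_add) (auto simp only: integrable_mult_right integral_mult_right_zero)
    finally show ?thesis .
  qed
  have Badd: "B (\<lambda>v. s * f v + d) = s * B f + d * B (\<lambda>_. 1)" if f: "continuous_on (sphere 0 1) f" for f s d
  proof -
    have "B (\<lambda>v. s * f v + d) = (LINT v|\<mu>. s * (\<psi> (h v) * f v) + d * (\<psi> (h v) * 1))"
      unfolding B_def by (rule Bochner_Integration.integral_cong) (auto simp: algebra_simps)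
    also have "\<dots> = s * B f + d * B (\<lambda>_. 1)" unfolding B_def
      using iB[OF f] iB[OF continuous_on_const, of 1] by (subst Bochner_Integration.integral_add) (auto simp only: integrable_mult_right integral_mult_right_zero)
    finally show ?thesis .
  qed
  have int_pos: "0 < (LINT x|M. g x)"
    if M: "sphere_borel M" "0 < measure M (sphere 0 1)" and g: "continuous_on (sphere 0 1) g" "\<And>x. x \<in> sphere 0 1 \<Longrightarrow> 0 < g x"
    for M and g :: "'a \<Rightarrow> real"
  proof -
    interpret finite_measure M using M(1) by (simp add: sphere_borel_def)
    have sp: "space M = sphere 0 1" using M(1) by (simp add: sphere_borel_def)
    obtain x0 where x0: "x0 \<in> sphere 0 1" "\<And>x. x \<in> sphere 0 1 \<Longrightarrow> g x0 \<le> g x"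
      using continuous_attains_inf[OF compact_sphere sphere_nonempty g(1)] by blast
    have "0 < g x0 * measure M (sphere 0 1)" using g(2)[OF x0(1)] M(2) by simp
    also have "\<dots> = (LINT x|M. g x0)" by (simp add: sp)
    also have "\<dots> \<le> (LINT x|M. g x)"
    proof (rule integral_mono[OF _ sphere_borel_integrable[OF M(1) g(1)]])
      show "g x0 \<le> g x" if "x \<in> space M" for x using x0(2) that by (simp only: sp)
    qed simp
    finally show ?thesis .
  qed
  have A1: "0 < A (\<lambda>_. 1)"
    using int_pos[OF sphere_borel_sphere_measure sphere_measure_pos vol_density_continuous[OF h] vol_density_pos[OF h]]
    by (simp add: A_def)
  have B1: "0 < B (\<lambda>_. 1)"
    using int_pos[OF sphere_borel_mu mu_pos psih psi_pos[OF pos_cont_pos[OF h]]] by (simp add: B_def)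
  have ge: "A f / A (\<lambda>_. 1) * B (\<lambda>_. 1) \<le> B f"
    if f: "continuous_on (sphere 0 1) f" "\<And>v. v \<in> sphere 0 1 \<Longrightarrow> f (- v) = f v" for f
  proof (rule field_le_epsilon)
    fix e :: real assume "0 < e"
    \<comment> \<open>\<open>d * B 1\<close> is the error term \<open>e\<close>.\<close>
    define d where "d = e / B (\<lambda>_. 1)"
    have d: "0 < d" using \<open>0 < e\<close> B1 by (simp add: d_def)
    define k where "k = d - A f / A (\<lambda>_. 1)"
    have fk: "continuous_on (sphere 0 1) (\<lambda>v. 1 * f v + k)" by (intro continuous_intros f)
    have "A (\<lambda>v. 1 * f v + k) = d * A (\<lambda>_. 1)"
      unfolding Aadd[OF f(1)] using A1 by (simp add: k_def algebra_simps)
    then have "0 < A (\<lambda>v. 1 * f v + k)" using d A1 by simp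
    then have "0 \<le> B (\<lambda>v. 1 * f v + k)"
      unfolding A_def B_def by (intro first_variation_sign[OF adm max fk]) (use f(2) in auto)
    then have "0 \<le> B f + k * B (\<lambda>_. 1)" unfolding Badd[OF f(1)] by simp
    moreover have "d * B (\<lambda>_. 1) = e" using B1 by (simp add: d_def)
    ultimately show "A f / A (\<lambda>_. 1) * B (\<lambda>_. 1) \<le> B f + e" by (simp add: k_def algebra_simps)
  qed
  show thesis
  proof (rule that[of "B (\<lambda>_. 1) / A (\<lambda>_. 1)"])
    show "0 < B (\<lambda>_. 1) / A (\<lambda>_. 1)" using A1 B1 by simp
    fix f :: "'a \<Rightarrow> real" assume f: "continuous_on (sphere 0 1) f" "\<And>v. v \<in> sphere 0 1 \<Longrightarrow> f (- v) = f v"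
    have f': "continuous_on (sphere 0 1) (\<lambda>v. (-1) * f v + 0)" by (intro continuous_intros f)
    have "A (\<lambda>v. (-1) * f v + 0) / A (\<lambda>_. 1) * B (\<lambda>_. 1) \<le> B (\<lambda>v. (-1) * f v + 0)"
      by (rule ge[OF f']) (use f(2) in auto)
    then have "B f \<le> A f / A (\<lambda>_. 1) * B (\<lambda>_. 1)" unfolding Aadd[OF f(1)] Badd[OF f(1)] by simp
    with ge[OF f] have "B f = A f / A (\<lambda>_. 1) * B (\<lambda>_. 1)" by linarith
    then show "(LINT v|\<mu>. \<psi> (h v) * f v) = B (\<lambda>_. 1) / A (\<lambda>_. 1) * (LINT u|sphere_measure. vol_density h u * f (normal_map h u))"
      by (simp add: A_def[of f, symmetric] B_def[of f, symmetric])
  qed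
qed

section \<open>The curvature measure of the maximizer\<close>

lemma integral_mu_uminus:
  assumes g: "continuous_on (sphere 0 1) (g :: 'a \<Rightarrow> real)"
  shows "(LINT v|\<mu>. g (- v)) = (LINT v|\<mu>. g v)"
proof -
  have im: "uminus -` E \<inter> sphere 0 1 = uminus ` E" if "E \<subseteq> sphere 0 1" for E :: "'a set"
    using that by (force simp: image_iff)
  have E_sub: "E \<subseteq> sphere 0 1" if "E \<in> sets \<mu>" for E using sets.sets_into_space[OF that] by (simp only: space_mu)
  have meas: "uminus \<in> measurable \<mu> \<mu>"
    unfolding measurable_cong_sets[OF mu_sets mu_sets]
    by (rule measurable_restrict_space2) (auto simp: space_restrict_space intro!: measurable_restrict_space1)
  have "distr \<mu> \<mu> uminus = \<mu>"
  proof (rule measure_eqI)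
    fix E assume "E \<in> sets (distr \<mu> \<mu> uminus)"
    then have E: "E \<in> sets \<mu>" by simp
    have "emeasure (distr \<mu> \<mu> uminus) E = emeasure \<mu> (uminus -` E \<inter> space \<mu>)"
      by (rule emeasure_distr[OF meas E])
    then show "emeasure (distr \<mu> \<mu> uminus) E = emeasure \<mu> E"
      by (simp only: space_mu im[OF E_sub[OF E]] mu_even[OF E])
  qed simp
  moreover have "g \<in> borel_measurable \<mu>" using sphere_borel_mu g by (simp add: sphere_borel_def)
  ultimately show ?thesis using integral_distr[OF meas, of g] by simp
qed

text \<open>
  Minus \<open>DIM('a)\<close> times the density, in the variable \<open>u\<close>, of the dual Orlicz curvature measure.
\<close>

definition curvature_density :: "('a \<Rightarrow> real) \<Rightarrow> 'a \<Rightarrow> real" where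
  "curvature_density h u = vol_density h u / \<psi> (h (normal_map h u))"

lemma continuous_psi: "pos_cont h \<Longrightarrow> continuous_on (sphere 0 1) (\<lambda>v. \<psi> (h v))"
  by (rule continuous_on_compose2[OF psi_cont]) (auto simp: pos_cont_def)

lemma curvature_density_measurable:
  assumes h: "pos_cont h" shows "curvature_density h \<in> borel_measurable sphere_measure"
  unfolding curvature_density_def[abs_def]
  by (intro borel_measurable_divide measurable_continuous_normal_map[OF h continuous_psi[OF h]]
      continuous_on_measurable_sphere vol_density_continuous h)

lemma curvature_density_pos: "pos_cont h \<Longrightarrow> u \<in> sphere 0 1 \<Longrightarrow> 0 < curvature_density h u"
  unfolding curvature_density_def
  by (intro divide_pos_pos vol_density_pos psi_pos pos_cont_pos normal_map_in_sphere)

lemma curvature_density_integrable: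
  assumes h: "pos_cont h" and f: "f \<in> borel_measurable sphere_measure" "\<And>u. u \<in> sphere 0 1 \<Longrightarrow> \<bar>f u\<bar> \<le> M"
  shows "integrable sphere_measure (\<lambda>u. curvature_density h u * f u)"
proof -
  obtain D where D: "\<And>v. v \<in> sphere 0 1 \<Longrightarrow> \<bar>vol_density h v\<bar> \<le> D"
    by (rule continuous_on_sphere_bounded[OF vol_density_continuous[OF h]]) blast
  have "continuous_on (sphere 0 1) (\<lambda>v. 1 / \<psi> (h v))"
    using psi_pos[OF pos_cont_pos[OF h]] by (intro continuous_intros continuous_psi[OF h]) force
  then obtain P where P: "\<And>v. v \<in> sphere 0 1 \<Longrightarrow> \<bar>1 / \<psi> (h v)\<bar> \<le> P"
    by (rule continuous_on_sphere_bounded) blast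
  show ?thesis
  proof (rule sphere_borel_integrable_bounded[OF sphere_borel_sphere_measure])
    show "(\<lambda>u. curvature_density h u * f u) \<in> borel_measurable sphere_measure"
      by (intro borel_measurable_times curvature_density_measurable h f)
    fix u :: 'a assume u: "u \<in> sphere 0 1"
    have "0 \<le> D" "0 \<le> P" using D[OF u] P[OF normal_map_in_sphere, of h u] by linarith+
    have "\<bar>curvature_density h u * f u\<bar> = \<bar>vol_density h u\<bar> * \<bar>1 / \<psi> (h (normal_map h u))\<bar> * \<bar>f u\<bar>"
      by (simp add: curvature_density_def abs_mult)
    also have "\<dots> \<le> D * P * M"
      using D[OF u] P[OF normal_map_in_sphere, of h u] f(2)[OF u] \<open>0 \<le> D\<close> \<open>0 \<le> P\<close>
      by (intro mult_mono mult_nonneg_nonneg) auto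
    finally show "\<bar>curvature_density h u * f u\<bar> \<le> D * P * M" .
  qed
qed

lemma curvature_density_even:
  assumes h: "pos_cont h" and ev: "\<And>v. h (- v) = h v" and u: "u \<in> sphere 0 1" "unique_touching h u"
  shows "curvature_density h (- u) = curvature_density h u"
  using Gt_even[OF radial_pos[OF h u(1)] u(1)]
  by (simp add: curvature_density_def vol_density_def gauge_even[OF h ev] normal_map_uminus[OF h ev u(2)] ev)

text \<open>
  The Euler-Lagrange equation for \<open>f v = (g v + g (- v)) / \<psi> (h v)\<close>. Evenness of \<open>\<mu>\<close> on the
  left, and of \<open>G\<^sub>t\<close>, \<open>h\<close> and the surface measure on the right, turn the symmetrization of \<open>g\<close>
  into a factor 2 on both sides. So \<open>\<mu>\<close> has the same integrals of continuous functions as \<open>\<Lambda>\<close>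
  times the image under the normal map of the measure with density \<open>curvature_density\<close>.
\<close>

lemma mu_as_push_forward:
  assumes h: "pos_cont h" and ev: "\<And>v. h (- v) = h v" and "0 < \<Lambda>"
    and EL: "\<And>f. continuous_on (sphere 0 1) f \<Longrightarrow> (\<And>v. v \<in> sphere 0 1 \<Longrightarrow> f (- v) = f v) \<Longrightarrow>
      (LINT v|\<mu>. \<psi> (h v) * f v) = \<Lambda> * (LINT u|sphere_measure. vol_density h u * f (normal_map h u))"
    and E: "E \<in> sets \<mu>"
  shows "measure \<mu> E = \<Lambda> * (LINT u|sphere_measure. curvature_density h u * indicator E (normal_map h u))"
proof -
  let ?S = "restrict_space borel (sphere (0::'a) 1)"
  let ?k = "curvature_density h" and ?a = "normal_map h"
  have a: "?a \<in> measurable sphere_measure ?S"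
    by (rule measurable_restrict_space2[OF _ measurable_normal_map[OF h]]) (use normal_map_in_sphere in blast)
  have int: "integrable sphere_measure (\<lambda>u. ?k u * g (?a u))" if g: "continuous_on (sphere 0 1) g" for g
  proof -
    obtain M where M: "\<And>v. v \<in> sphere 0 1 \<Longrightarrow> \<bar>g v\<bar> \<le> M"
      by (rule continuous_on_sphere_bounded[OF g]) blast
    show ?thesis
      by (rule curvature_density_integrable[OF h measurable_continuous_normal_map[OF h g] M[OF normal_map_in_sphere]])
  qed
  have cu: "continuous_on (sphere 0 1) (\<lambda>v. g (- v))" if g: "continuous_on (sphere 0 1) g" for g :: "'a \<Rightarrow> real"
    by (rule continuous_on_compose2[OF g]) (auto intro: continuous_intros)
  have cont: "(LINT v|\<mu>. g v) = \<Lambda> * (LINT u|sphere_measure. ?k u * g (?a u))" if g: "continuous_on (sphere 0 1) g" for g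
  proof -
    define f where "f v = (g v + g (- v)) / \<psi> (h v)" for v
    have ps: "0 < \<psi> (h v)" if "v \<in> sphere 0 1" for v by (rule psi_pos[OF pos_cont_pos[OF h that]])
    have fc: "continuous_on (sphere 0 1) f"
      unfolding f_def using ps by (intro continuous_intros g cu continuous_psi[OF h]) force
    have "(LINT v|\<mu>. \<psi> (h v) * f v) = (LINT v|\<mu>. g v + g (- v))"
    proof (rule Bochner_Integration.integral_cong)
      fix v assume "v \<in> space \<mu>"
      then have "v \<in> sphere 0 1" by (simp only: space_mu)
      from ps[OF this] show "\<psi> (h v) * f v = g v + g (- v)" by (simp add: f_def)
    qed simp
    also have "\<dots> = (LINT v|\<mu>. g v) + (LINT v|\<mu>. g (- v))"
      by (intro Bochner_Integration.integral_add sphere_borel_integrable[OF sphere_borel_mu] g cu)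
    also have "\<dots> = 2 * (LINT v|\<mu>. g v)" by (simp add: integral_mu_uminus[OF g])
    finally have L: "2 * (LINT v|\<mu>. g v) = (LINT v|\<mu>. \<psi> (h v) * f v)" ..
    have "(LINT u|sphere_measure. vol_density h u * f (?a u))
        = (LINT u|sphere_measure. ?k u * g (?a u) + ?k u * g (- ?a u))"
      by (rule Bochner_Integration.integral_cong) (simp_all add: f_def curvature_density_def add_divide_distrib algebra_simps)
    also have "\<dots> = (LINT u|sphere_measure. ?k u * g (?a u)) + (LINT u|sphere_measure. ?k u * g (- ?a u))"
      by (intro Bochner_Integration.integral_add int[OF g] int[OF cu[OF g]])
    also have "(LINT u|sphere_measure. ?k u * g (- ?a u)) = (LINT u|sphere_measure. ?k (- u) * g (?a (- u)))"
    proof (rule integral_cong_AE)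
      show m: "(\<lambda>u. ?k u * g (- ?a u)) \<in> borel_measurable sphere_measure"
        by (rule borel_measurable_integrable[OF int[OF cu[OF g]]])
      show "(\<lambda>u. ?k (- u) * g (?a (- u))) \<in> borel_measurable sphere_measure"
        by (rule measurable_compose[OF uminus_measurable_sphere borel_measurable_integrable[OF int[OF g]]])
      have "AE u in (sphere_measure :: 'a measure). u \<in> sphere 0 1" by (rule AE_I2) simp
      with AE_unique_touching[OF h]
      show "AE u in sphere_measure. ?k u * g (- ?a u) = ?k (- u) * g (?a (- u))"
      proof eventually_elim
        case (elim u)
        then show ?case by (simp only: curvature_density_even[OF h ev elim(2,1)] normal_map_uminus[OF h ev elim(1)])
      qed
    qed
    also have "\<dots> = (LINT u|sphere_measure. ?k u * g (?a u))"
      by (rule integral_sphere_measure_uminus[OF borel_measurable_integrable[OF int[OF g]]])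
    finally have R: "(LINT u|sphere_measure. vol_density h u * f (?a u)) = 2 * (LINT u|sphere_measure. ?k u * g (?a u))" by simp
    have "f (- v) = f v" for v by (simp add: f_def ev add.commute)
    then have "(LINT v|\<mu>. \<psi> (h v) * f v) = \<Lambda> * (LINT u|sphere_measure. vol_density h u * f (?a u))" by (intro EL fc)
    with L R show ?thesis by simp
  qed
  define D where "D = density sphere_measure (\<lambda>u. ennreal (\<Lambda> * ?k u))"
  define N where "N = distr D ?S ?a"
  have km: "(\<lambda>u. \<Lambda> * ?k u) \<in> borel_measurable sphere_measure"
    by (intro borel_measurable_times curvature_density_measurable[OF h] borel_measurable_const)
  have knn: "AE u in sphere_measure. 0 \<le> \<Lambda> * ?k u"
    using \<open>0 < \<Lambda>\<close> curvature_density_pos[OF h] by (intro AE_I2) (simp add: less_imp_le)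
  have aD: "?a \<in> measurable D ?S"
    using a by (simp add: D_def)
  have intN: "(LINT x|N. g x) = (LINT u|sphere_measure. (\<Lambda> * ?k u) * g (?a u))" if g: "g \<in> borel_measurable ?S" for g :: "'a \<Rightarrow> real"
  proof -
    have "(LINT x|N. g x) = (LINT u|D. g (?a u))" unfolding N_def by (rule integral_distr[OF aD g])
    also have "\<dots> = (LINT u|sphere_measure. (\<Lambda> * ?k u) *\<^sub>R g (?a u))"
      unfolding D_def by (rule integral_density[OF measurable_compose[OF a g] km knn])
    finally show ?thesis by simp
  qed
  have Dfin: "finite_measure D"
  proof
    have "integrable sphere_measure (\<lambda>u. \<Lambda> * (?k u * 1))"
      by (intro integrable_mult_right curvature_density_integrable[OF h, of _ 1]) auto
    then have "integrable sphere_measure (\<lambda>u. \<Lambda> * ?k u)" by simp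
    then have "(\<integral>\<^sup>+u. ennreal (\<Lambda> * ?k u) \<partial>sphere_measure) < \<infinity>"
      using knn by (subst nn_integral_eq_integral) auto
    moreover have "emeasure D (space D) = (\<integral>\<^sup>+u. ennreal (\<Lambda> * ?k u) \<partial>sphere_measure)"
      unfolding D_def space_density using km
      by (subst emeasure_density) (auto intro!: nn_integral_cong simp del: space_sphere_measure)
    ultimately show "emeasure D (space D) \<noteq> \<infinity>" by simp
  qed
  have Nfin: "finite_measure N"
    unfolding N_def by (rule finite_measure.finite_measure_distr[OF Dfin aD])
  have "\<mu> = N"
  proof (rule sphere_measure_eqI_continuous[OF sphere_borel_mu mu_sets Nfin])
    show "sets N = sets ?S" by (simp add: N_def)
    fix g :: "'a \<Rightarrow> real" assume g: "continuous_on (sphere 0 1) g"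
    have "(LINT x|N. g x) = (LINT u|sphere_measure. \<Lambda> * (?k u * g (?a u)))"
      using intN[OF borel_measurable_continuous_on_restrict[OF g]] by (simp add: mult.assoc)
    then show "(LINT x|\<mu>. g x) = (LINT x|N. g x)" by (simp add: cont[OF g])
  qed
  have ES: "E \<in> sets ?S" using E by (simp only: mu_sets)
  have "measure \<mu> E = measure N E" using \<open>\<mu> = N\<close> by simp
  also have "\<dots> = (LINT x|N. indicator E x)"
  proof -
    have "E \<inter> space N = E" using sets.sets_into_space[OF ES] by (auto simp: N_def)
    then show ?thesis by simp
  qed
  also have "\<dots> = (LINT u|sphere_measure. (\<Lambda> * ?k u) * indicator E (?a u))"
    by (rule intN) (rule borel_measurable_indicator[OF ES])
  finally show ?thesis by (simp add: mult.assoc)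
qed

text \<open>
  Where the normal is unique, \<open>u\<close> belongs to the reverse radial Gauss image of \<open>E\<close> if and only
  if its normal belongs to \<open>E\<close>.
\<close>

lemma dual_orlicz_curvature_eq:
  assumes h: "pos_cont h" and supp: "\<And>v. support_fun (wulff h) v = h v" and E: "E \<in> sets \<mu>"
  shows "dual_orlicz_curvature G \<psi> (wulff h) E =
    - (1 / real DIM('a)) * (LINT u|sphere_measure. curvature_density h u * indicator E (normal_map h u))"
proof -
  let ?K = "wulff h"
  let ?F = "\<lambda>u. indicator (reverse_radial_gauss_image ?K E) u *\<^sub>R (radial_fun ?K u * partial_t G (radial_fun ?K u) u
          / \<psi> (support_fun ?K (radial_gauss_map ?K u)))"
  let ?H = "\<lambda>u. - (curvature_density h u * indicator E (normal_map h u))"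
  have ES: "E \<in> sets (restrict_space borel (sphere 0 1))" using E by (simp only: mu_sets)
  have mH: "?H \<in> borel_measurable sphere_measure"
  proof (intro borel_measurable_uminus borel_measurable_times curvature_density_measurable[OF h])
    have "normal_map h \<in> measurable sphere_measure (restrict_space borel (sphere 0 1))"
      by (rule measurable_restrict_space2[OF _ measurable_normal_map[OF h]]) (use normal_map_in_sphere in blast)
    then show "(\<lambda>u. indicator E (normal_map h u) :: real) \<in> borel_measurable sphere_measure"
      by (rule measurable_compose) (rule borel_measurable_indicator[OF ES])
  qed
  have "AE u in (sphere_measure :: 'a measure). u \<in> sphere 0 1" by (rule AE_I2) simp
  with AE_unique_touching[OF h] have ae: "AE u in sphere_measure. ?F u = ?H u"
  proof eventually_elim
    case (elim u)
    have out: "outer_normal_at ?K u v \<longleftrightarrow> v = normal_map h u" for v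
      using outer_normal_iff_touching[OF h supp elim(2)] touching_normal_map[OF elim(1)] by simp
    have rgm: "radial_gauss_map ?K u = normal_map h u" by (simp add: radial_gauss_map_def out)
    have rev: "u \<in> reverse_radial_gauss_image ?K E \<longleftrightarrow> normal_map h u \<in> E"
      using elim(2) by (auto simp: reverse_radial_gauss_image_def out)
    show ?case
      by (simp add: indicator_def rev rgm supp radial_wulff[OF h elim(2)] curvature_density_def vol_density_def)
  qed
  have "(LINT u|sphere_measure. ?F u) = (LINT u|sphere_measure. ?H u)"
    by (rule integral_cong_AE[OF measurable_sphere_measure_AE[OF mH ae] mH ae])
  then show ?thesis unfolding dual_orlicz_curvature_def set_lebesgue_integral_def by simp
qed

theorem curvature_problem_solvable:
  "\<exists>K \<in> convex_bodies_os. \<forall>E \<in> sets \<mu>.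
    measure \<mu> E / measure \<mu> (sphere 0 1) =
      dual_orlicz_curvature G \<psi> K E / dual_orlicz_curvature G \<psi> K (sphere 0 1)"
proof -
  obtain h where h: "admissible (dual_volume (\<lambda>_. 1)) h"
    and supp: "\<And>v. support_fun (wulff h) v = h v" and ev: "\<And>v. h (- v) = h v"
    and max: "\<And>h'. admissible (dual_volume (\<lambda>_. 1)) h' \<Longrightarrow> Phi h' \<le> Phi h"
    by (rule maximizer_exists) blast
  have pc: "pos_cont h" using h unfolding admissible_def by blast
  obtain \<Lambda> where L: "0 < \<Lambda>"
    "\<And>f. continuous_on (sphere 0 1) f \<Longrightarrow> (\<And>v. v \<in> sphere 0 1 \<Longrightarrow> f (- v) = f v) \<Longrightarrow>
      (LINT v|\<mu>. \<psi> (h v) * f v) = \<Lambda> * (LINT u|sphere_measure. vol_density h u * f (normal_map h u))"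
    by (rule euler_lagrange[OF h max]) blast+
  have K: "wulff h \<in> convex_bodies_os"
    using wulff_convex_body[OF pc] uminus_image_wulff[of h] ev by (simp add: convex_bodies_os_def)
  have C: "dual_orlicz_curvature G \<psi> (wulff h) E = - (1 / (real DIM('a) * \<Lambda>)) * measure \<mu> E" if "E \<in> sets \<mu>" for E
    using dual_orlicz_curvature_eq[OF pc supp that] mu_as_push_forward[OF pc ev L that] L(1) by simp
  have S: "sphere 0 1 \<in> sets \<mu>" using sets.top[of \<mu>] by (simp only: space_mu)
  have "measure \<mu> E / measure \<mu> (sphere 0 1) =
      dual_orlicz_curvature G \<psi> (wulff h) E / dual_orlicz_curvature G \<psi> (wulff h) (sphere 0 1)" if "E \<in> sets \<mu>" for E
    unfolding C[OF that] C[OF S] using L(1) by simp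
  then show ?thesis using K by blast
qed

end

theorem theorem7p3:
  fixes \<mu> :: "(real ^ 'n) measure"
    and G :: "real \<Rightarrow> real ^ 'n \<Rightarrow> real"
    and \<psi> :: "real \<Rightarrow> real"
    and \<epsilon>\<^sub>0 :: real
  assumes dim: "CARD('n) \<ge> 2"
    and mu_sets: "sets \<mu> = sets (restrict_space borel (sphere 0 1))"
    and mu_finite: "finite_measure \<mu>"
    and mu_nonzero: "emeasure \<mu> (sphere 0 1) \<noteq> 0"
    and mu_even: "\<And>E. E \<in> sets \<mu> \<Longrightarrow> emeasure \<mu> (uminus ` E) = emeasure \<mu> E"
    and mu_subspheres: "\<And>v. v \<in> sphere 0 1 \<Longrightarrow> emeasure \<mu> {u \<in> sphere 0 1. v \<bullet> u = 0} = 0"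
    and G_pos: "\<And>t u. t > 0 \<Longrightarrow> u \<in> sphere 0 1 \<Longrightarrow> G t u > 0"
    and G_cont: "continuous_on ({0<..} \<times> sphere 0 1) (\<lambda>(t, u). G t u)"
    and G_diff: "\<And>t u. t > 0 \<Longrightarrow> u \<in> sphere 0 1 \<Longrightarrow> (\<lambda>s. G s u) differentiable (at t)"
    and Gt_cont: "continuous_on ({0<..} \<times> sphere 0 1) (\<lambda>(t, u). partial_t G t u)"
    and Gt_neg: "\<And>t u. t > 0 \<Longrightarrow> u \<in> sphere 0 1 \<Longrightarrow> partial_t G t u < 0"
    and Gt_even: "\<And>t u. t > 0 \<Longrightarrow> u \<in> sphere 0 1 \<Longrightarrow> partial_t G t u = partial_t G t (- u)"
    and eps: "0 < \<epsilon>\<^sub>0" "\<epsilon>\<^sub>0 < 1"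
    and G_lim: "\<And>v. v \<in> sphere 0 1 \<Longrightarrow>
      filterlim (\<lambda>t. LINT u : {u \<in> sphere 0 1. u \<bullet> v \<ge> \<epsilon>\<^sub>0} | sphere_measure. G t u)
        at_top (at_right 0)"
    and psi_pos: "\<And>s. s > 0 \<Longrightarrow> \<psi> s > 0"
    and psi_cont: "continuous_on {0<..} \<psi>"
    and phi_bar_finite: "\<And>t. t > 0 \<Longrightarrow> set_integrable lborel {t..} (\<lambda>s. \<psi> s / s)"
  shows "\<exists>K \<in> convex_bodies_os. \<forall>E \<in> sets \<mu>.
    measure \<mu> E / measure \<mu> (sphere 0 1) =
      dual_orlicz_curvature G \<psi> K E / dual_orlicz_curvature G \<psi> K (sphere 0 1)"
proof -
  have "dual_orlicz \<mu> G \<psi> \<epsilon>\<^sub>0" by (rule dual_orlicz.intro) (fact assms)+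
  then show ?thesis by (rule dual_orlicz.curvature_problem_solvable)
qed

end
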